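(* For any non-degenerate ellipsoid $\mathcal{E}\subset\mathbb{R}^d$, any $k\in\{0,1,\dots,d\}$, and any real number $p>-d+k$, $$\int_{\mathcal{E}^{k}}|\operatorname{conv}(0,\mathbf{x}_1,\dots,\mathbf{x}_k)|^p\,d\mathbf{x}_1\dots d\mathbf{x}_k=\frac{1}{(k!)^p}\,\frac{\kappa_{d+p}^{k}}{\kappa_k^{p+d}}\,\frac{b_{d,k}}{b_{d+p,k}}\int_{G_{d,k}}|\mathcal{E}\cap L|^{p+d}\,\nu_{d,k}(dL).$$
   Context: $|\cdot|$ denotes $k$-dimensional volume (for $k=0$ a point has volume $1$, and the left-hand side is $1$). For real $q\ge0$, $\kappa_q:=\pi^{q/2}/\Gamma(q/2+1)$ (so $\kappa_0=1$, and for integer $q$ this is the volume of the unit ball in $\mathbb{R}^q$); for $q>0$, $\omega_q:=q\kappa_q$. For real $q>k-1$, $b_{q,k}:=\dfrac{\omega_{q-k+1}\,\omega_{q-k+2}\cdots\omega_q}{\omega_1\cdots\omega_k}$ (numerator and denominator have $k$ factors each; $b_{q,0}=1$). $G_{d,k}$ is the Grassmannian of $k$-dimensional linear subspaces of $\mathbb{R}^d$ with its unique rotation invariant probability measure $\nu_{d,k}$.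
   Formalization: The ellipsoid is assumed to be centred at the origin; for off-centre ellipsoids the formula fails, e.g. for d = k = p = 1 and the interval [c-1, c+1], where the left side depends on c and the right side does not. *)

theory Defs
  imports "HOL-Probability.Probability"
begin

definition orthonormal_family :: "nat \<Rightarrow> (nat \<Rightarrow> 'a::real_inner) \<Rightarrow> bool" where
  "orthonormal_family k b \<longleftrightarrow>
    (\<forall>i\<in>{1..k}. \<forall>j\<in>{1..k}. b i \<bullet> b j = (if i = j then 1 else 0))"

definition flat_coord :: "nat \<Rightarrow> 'a::real_inner \<Rightarrow> (nat \<Rightarrow> 'a) \<Rightarrow> (nat \<Rightarrow> real) \<Rightarrow> 'a" where
  "flat_coord k a b c = a + (\<Sum>i=1..k. c i *\<^sub>R b i)"

text \<open>
  The \<open>k\<close>-dimensional volume of a set \<open>S\<close> that is contained in some \<open>k\<close>-dimensional affine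
  subspace: the Lebesgue measure of \<open>S\<close> in Cartesian coordinates of such a subspace. It does not
  depend on the chosen subspace and coordinates, since any two choices are related by an isometry
  unless \<open>S\<close> lies in a flat of smaller dimension, and then the volume is \<open>0\<close>. For \<open>k = 0\<close> the
  product measure is the unit mass at a single point, so a point has volume \<open>1\<close>. The value is
  meaningless if \<open>S\<close> is not contained in a \<open>k\<close>-dimensional affine subspace.
\<close>
definition k_volume :: "nat \<Rightarrow> 'a::euclidean_space set \<Rightarrow> real" where
  "k_volume k S =
    (let (a, b) = (SOME (a, b). orthonormal_family k b \<and> S \<subseteq> range (flat_coord k a b));
         M = Pi\<^sub>M {1..k} (\<lambda>_. lborel :: real measure)
     in measure M {c \<in> space M. flat_coord k a b c \<in> S})"

text \<open>
  Ellipsoids are centred at the origin. The library constant \<open>unit_ball_vol\<close>, used below, is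
  \<open>\<kappa>\<^sub>q = pi powr (q / 2) / Gamma (q / 2 + 1)\<close> for real \<open>q\<close>.
\<close>
definition nondegenerate_ellipsoid :: "(real ^ 'n) set \<Rightarrow> bool" where
  "nondegenerate_ellipsoid E \<longleftrightarrow>
    (\<exists>A :: real ^ 'n ^ 'n. invertible A \<and> E = (\<lambda>x. A *v x) ` cball 0 1)"

definition omega :: "real \<Rightarrow> real" where
  "omega q = q * unit_ball_vol q"

definition b_const :: "real \<Rightarrow> nat \<Rightarrow> real" where
  "b_const q k = (\<Prod>i=1..k. omega (q - real k + real i)) / (\<Prod>i=1..k. omega (real i))"

definition Grassmannian :: "nat \<Rightarrow> (real ^ 'n) set set" where
  "Grassmannian k = {L. subspace L \<and> dim L = k}"

text \<open>
  The usual topology of the Grassmannian is the one that makes the identification of \<open>L\<close> with the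
  orthogonal projection onto \<open>L\<close> (which is \<open>closest_point L\<close>) a homeomorphism onto its image. The
  measurable space below carries the Borel sets of this topology.
\<close>
definition grassmannian_borel :: "nat \<Rightarrow> (real ^ 'n) set measure" where
  "grassmannian_borel k =
    vimage_algebra (Grassmannian k)
      (\<lambda>L. matrix (closest_point L) :: real ^ 'n ^ 'n) borel"

definition rotation_invariant_prob :: "nat \<Rightarrow> (real ^ 'n) set measure \<Rightarrow> bool" where
  "rotation_invariant_prob k \<nu> \<longleftrightarrow>
    prob_space \<nu> \<and> sets \<nu> = sets (grassmannian_borel k) \<and>
    (\<forall>Q :: real ^ 'n ^ 'n. rotation_matrix Q \<longrightarrow>
      distr \<nu> \<nu> (\<lambda>L. (\<lambda>x. Q *v x) ` L) = \<nu>)"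

end

theory Submission
  imports Defs
begin

text \<open>
  The integrand is a power of a Gram determinant and hence homogeneous under the right action of
  $GL_k$. Average a function of $YT$ over $k$-tuples $Y$ of points of the unit ball and over
  $k \times k$ matrices $T$, and evaluate the double integral in two ways. Substituting so that
  $YT$ becomes the free variable, and using that only the Gram matrix of $YT$ matters, gives a
  constant times the integral over the ellipsoid; normalising the Gram matrix of $A^{-1}Y$, where
  $A$ maps the ball to the ellipsoid, gives the same constant times the mean of the $(p+d)$-th power
  of the volume of the section by the span of $Y$. Taking the ball itself as the ellipsoid
  identifies the remaining factor, because moments of Gram determinants of the ball are computed
  one vector at a time from Gaussian integrals. Finally, the span of $Y$ has the invariant law:
  the mean is unchanged when $Y$ is rotated, and a rotation obtained by Gram--Schmidt from a random
  matrix has a law under which the image of any fixed subspace is distributed like $\nu_{d,k}$.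
\<close>

section \<open>Linear substitutions in product measures\<close>

text \<open>Two exponents make the double integral work. Let M be the matrix of \<open>T\<close>, B
  the inverse of the matrix of the ellipsoid, f the integrand and D the Gram volume; the kernel is
  f(YM) |det M|^(d-k) D(Y)^d for Y in the ball. Passing to Z = YM costs |det M|^(-d) and leaves |det
  M|^(-k) dM, the Haar measure of the linear group, which is why the integral over M cannot depend
  on Z. With Y fixed, normalising BY yields D(BY)^(-(p+d)), while f and the weight supply D(Y)^p and
  D(Y)^d. The quotient D(Y)/D(BY) is, up to kappa_k, the volume of the section by the span of Y. The
  group integral is never computed: the ball shows that it is finite and positive, so it cancels.
  Nor is a Haar measure on rotations constructed; comparing both laws with one random rotation
  suffices. All identities are proved in \<open>ennreal\<close>, which admits negative p and leaves
  integrability to a bound at the end. Since d is the size of the type \<open>'n\<close> but k is a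
  variable, a k x k matrix is stored as a d x d matrix that is the identity outside a set K of k
  indices.\<close>

lemma (in product_sigma_finite) nn_integral_PiM_componentwise:
  assumes "finite I"
    and g: "\<And>i. i \<in> I \<Longrightarrow> g i \<in> measurable (M i) (M i)"
    and C: "\<And>i h. i \<in> I \<Longrightarrow> h \<in> borel_measurable (M i) \<Longrightarrow>
      (\<integral>\<^sup>+x. h (g i x) \<partial>M i) = C i * (\<integral>\<^sup>+x. h x \<partial>M i)"
    and "f \<in> borel_measurable (Pi\<^sub>M I M)"
  shows "(\<integral>\<^sup>+x. f (\<lambda>i\<in>I. g i (x i)) \<partial>Pi\<^sub>M I M) = (\<Prod>i\<in>I. C i) * (\<integral>\<^sup>+x. f x \<partial>Pi\<^sub>M I M)"
  using assms
proof (induction I arbitrary: f rule: finite_induct)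
  case empty
  then show ?case by (simp add: PiM_empty nn_integral_count_space_finite)
next
  case (insert i I)
  note [measurable] = insert.prems(3)
  have [measurable]: "g i \<in> measurable (M i) (M i)" using insert.prems by auto
  have gI[measurable]: "(\<lambda>x. \<lambda>j\<in>I. g j (x j)) \<in> measurable (Pi\<^sub>M I M) (Pi\<^sub>M I M)"
    using insert.prems by (intro measurable_restrict measurable_compose[OF measurable_component_singleton]) auto
  have gI'[measurable]: "(\<lambda>x. \<lambda>j\<in>insert i I. g j (x j)) \<in> measurable (Pi\<^sub>M (insert i I) M) (Pi\<^sub>M (insert i I) M)"
    using insert.prems by (intro measurable_restrict measurable_compose[OF measurable_component_singleton]) auto
  have hm: "(\<lambda>x. \<integral>\<^sup>+y. f (x(i := y)) \<partial>M i) \<in> borel_measurable (Pi\<^sub>M I M)"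
    by measurable
  have eq: "(\<lambda>j\<in>insert i I. g j ((x(i := y)) j)) = (\<lambda>j\<in>I. g j (x j))(i := g i y)" for x y
    using insert.hyps by (auto simp: fun_eq_iff)
  interpret Mi: sigma_finite_measure "M i" by (rule sigma_finite_measures)
  have fm: "(\<lambda>x. f (\<lambda>j\<in>insert i I. g j (x j))) \<in> borel_measurable (Pi\<^sub>M (insert i I) M)"
    by measurable
  have "(\<integral>\<^sup>+x. f (\<lambda>j\<in>insert i I. g j (x j)) \<partial>Pi\<^sub>M (insert i I) M)
      = (\<integral>\<^sup>+x. (\<integral>\<^sup>+y. f ((\<lambda>j\<in>I. g j (x j))(i := g i y)) \<partial>M i) \<partial>Pi\<^sub>M I M)"
    by (subst product_nn_integral_insert[OF insert.hyps(1,2) fm]) (simp only: eq)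
  also have "\<dots> = (\<integral>\<^sup>+x. C i * (\<integral>\<^sup>+y. f ((\<lambda>j\<in>I. g j (x j))(i := y)) \<partial>M i) \<partial>Pi\<^sub>M I M)"
  proof (rule nn_integral_cong)
    fix x assume "x \<in> space (Pi\<^sub>M I M)"
    then have "(\<lambda>j\<in>I. g j (x j)) \<in> space (Pi\<^sub>M I M)" by (rule measurable_space[OF gI])
    then show "(\<integral>\<^sup>+y. f ((\<lambda>j\<in>I. g j (x j))(i := g i y)) \<partial>M i) = C i * (\<integral>\<^sup>+y. f ((\<lambda>j\<in>I. g j (x j))(i := y)) \<partial>M i)"
      by (intro insert.prems(2)[of i "\<lambda>y. f ((\<lambda>j\<in>I. g j (x j))(i := y))"]) (auto intro: measurable_compose[OF measurable_component_update] insert.hyps)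
  qed
  also have "\<dots> = C i * (\<integral>\<^sup>+x. (\<integral>\<^sup>+y. f ((\<lambda>j\<in>I. g j (x j))(i := y)) \<partial>M i) \<partial>Pi\<^sub>M I M)"
    by (rule nn_integral_cmult) measurable
  also have "(\<integral>\<^sup>+x. (\<integral>\<^sup>+y. f ((\<lambda>j\<in>I. g j (x j))(i := y)) \<partial>M i) \<partial>Pi\<^sub>M I M)
      = (\<Prod>i\<in>I. C i) * (\<integral>\<^sup>+x. (\<integral>\<^sup>+y. f (x(i := y)) \<partial>M i) \<partial>Pi\<^sub>M I M)"
    by (intro insert.IH insert.prems insertI2 hm)
  also have "(\<integral>\<^sup>+x. (\<integral>\<^sup>+y. f (x(i := y)) \<partial>M i) \<partial>Pi\<^sub>M I M) = (\<integral>\<^sup>+x. f x \<partial>Pi\<^sub>M (insert i I) M)"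
    by (subst product_nn_integral_insert[OF insert.hyps(1,2)]) auto
  finally show ?case using insert.hyps by (simp add: mult.assoc)
qed

text \<open>The tuple \<open>Y\<close>, its vectors taken as columns, times the matrix
  \<open>M\<close>. Restricting the result to \<open>K\<close> keeps it inside the space of the
  product measure over \<open>K\<close>.\<close>

definition act :: "'n set \<Rightarrow> real^'n^'n \<Rightarrow> ('n \<Rightarrow> 'a::real_vector) \<Rightarrow> 'n \<Rightarrow> 'a" where
  "act K M Y = (\<lambda>j\<in>K. \<Sum>i\<in>K. M $ i $ j *\<^sub>R Y i)"

text \<open>A matrix indexed by \<open>K\<close>, padded by the identity. The size of a matrix is a
  type, whereas \<open>k\<close> is a variable; with the padding, products, inverses and
  \<open>det\<close> of the \<open>K\<close>-part are those of the library.\<close>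

definition block :: "'n set \<Rightarrow> real^'n^'n \<Rightarrow> bool" where
  "block K M \<longleftrightarrow> (\<forall>i j. i \<notin> K \<or> j \<notin> K \<longrightarrow> M $ i $ j = (if i = j then 1 else 0))"

text \<open>The action is from the right. One padded factor suffices, since it kills the terms of
  the matrix product whose summation index lies outside \<open>K\<close>.\<close>

lemma act_mult:
  fixes A B :: "real^'n^'n"
  assumes "block K A \<or> block K B \<or> K = UNIV"
  shows "act K B (act K A Y) = act K (A ** B) Y"
proof -
  have eq: "(\<Sum>l\<in>K. A $ i $ l * B $ l $ j) = (A ** B) $ i $ j" if "i \<in> K" "j \<in> K" for i j
  proof -
    have "(\<Sum>l\<in>K. A $ i $ l * B $ l $ j) = (\<Sum>l\<in>UNIV. A $ i $ l * B $ l $ j)"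
      using assms that by (intro sum.mono_neutral_left) (auto simp: block_def split: if_splits)
    then show ?thesis by (simp add: matrix_matrix_mult_def)
  qed
  have "(\<Sum>l\<in>K. B $ l $ j *\<^sub>R (\<Sum>i\<in>K. A $ i $ l *\<^sub>R Y i)) = (\<Sum>i\<in>K. (A ** B) $ i $ j *\<^sub>R Y i)"
    if "j \<in> K" for j
  proof -
    have "(\<Sum>l\<in>K. B $ l $ j *\<^sub>R (\<Sum>i\<in>K. A $ i $ l *\<^sub>R Y i))
        = (\<Sum>i\<in>K. (\<Sum>l\<in>K. A $ i $ l * B $ l $ j) *\<^sub>R Y i)"
      by (simp add: scaleR_sum_right scaleR_sum_left mult.commute) (rule sum.swap)
    then show ?thesis using that by (simp add: eq)
  qed
  then show ?thesis by (auto simp: act_def fun_eq_iff)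
qed

text \<open>What the substitution rule for tuples needs of Lebesgue measure, so that one proof
  serves the line, the whole space and every subspace. \<open>W\<close> carries the measure, hence
  translations by elements of \<open>W\<close>; \<open>m\<close> is the degree of homogeneity, in
  all instances the dimension of \<open>W\<close>.\<close>

locale homogeneous_measure = sigma_finite_measure N
  for N :: "'a::euclidean_space measure" +
  fixes W :: "'a set" and m :: nat
  assumes sets_N[measurable_cong, simp]: "sets N = sets borel"
    and AE_W: "AE x in N. x \<in> W"
    and subspace_W: "subspace W"
    and translate: "a \<in> W \<Longrightarrow> h \<in> borel_measurable borel \<Longrightarrow> (\<integral>\<^sup>+x. h (x + a) \<partial>N) = (\<integral>\<^sup>+x. h x \<partial>N)"
    and scale: "c \<noteq> 0 \<Longrightarrow> h \<in> borel_measurable borel \<Longrightarrow>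
      (\<integral>\<^sup>+x. h (c *\<^sub>R x) \<partial>N) = ennreal (1 / \<bar>c\<bar> ^ m) * (\<integral>\<^sup>+x. h x \<partial>N)"
    and finite_positive: "\<exists>B\<in>sets borel. 0 < emeasure N B \<and> emeasure N B < \<infinity>"
begin

lemma space_N[simp]: "space N = UNIV"
  using sets_eq_imp_space_eq[OF sets_N] by simp

sublocale product_sigma_finite "\<lambda>_. N"
  by unfold_locales

lemma W_borel[measurable]: "W \<in> sets borel"
  using closed_subspace[OF subspace_W] by auto

lemma AE_PiM_W:
  assumes "finite I"
  shows "AE x in Pi\<^sub>M I (\<lambda>_. N). \<forall>i\<in>I. x i \<in> W"
proof -
  interpret finite_product_sigma_finite "\<lambda>_. N" I by standard fact
  have "AE x in Pi\<^sub>M I (\<lambda>_. N). x i \<in> W" if "i \<in> I" for i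
  proof (rule AE_I)
    let ?A = "\<lambda>j. if j = i then - W else UNIV"
    show "{x \<in> space (Pi\<^sub>M I (\<lambda>_. N)). x i \<notin> W} \<subseteq> Pi\<^sub>E I ?A"
      by (auto simp: space_PiM PiE_def Pi_def)
    have "emeasure N (- W) = 0"
      using AE_W by (subst (asm) AE_iff_measurable[of "-W"]) auto
    then have "(\<Prod>j\<in>I. emeasure N (?A j)) = 0"
      using that assms by (intro prod_zero) auto
    then show "emeasure (Pi\<^sub>M I (\<lambda>_. N)) (Pi\<^sub>E I ?A) = 0"
      by (subst emeasure_PiM) (auto simp: assms)
    show "Pi\<^sub>E I ?A \<in> sets (Pi\<^sub>M I (\<lambda>_. N))"
      by (intro sets_PiM_I_finite) (auto simp: assms)
  qed
  then show ?thesis using assms by (simp add: AE_finite_all)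
qed

lemma measurable_act[measurable]: "act K M \<in> measurable (Pi\<^sub>M K (\<lambda>_. N)) (Pi\<^sub>M K (\<lambda>_. N))"
  unfolding act_def by measurable

text \<open>Factor \<open>M\<close> into elementary matrices: a diagonal matrix rescales each
  vector, a transposition permutes the factors of the product measure, and a shear translates one
  vector by another. The exponent \<open>m\<close> appears because rescaling a single vector already
  costs the \<open>m\<close>-th power.\<close>

lemma nn_integral_act_UNIV:
  fixes M :: "real^'n^'n"
  assumes "det M \<noteq> 0" "f \<in> borel_measurable (Pi\<^sub>M UNIV (\<lambda>_::'n. N))"
  shows "(\<integral>\<^sup>+Y. f (act UNIV M Y) \<partial>Pi\<^sub>M UNIV (\<lambda>_. N)) = ennreal (1 / \<bar>det M\<bar> ^ m) * (\<integral>\<^sup>+Y. f Y \<partial>Pi\<^sub>M UNIV (\<lambda>_. N))"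
  using assms
proof (induction M arbitrary: f rule: induct_matrix_elementary_alt)
  case (1 A B)
  have "(\<integral>\<^sup>+Y. f (act UNIV (A ** B) Y) \<partial>Pi\<^sub>M UNIV (\<lambda>_. N)) = (\<integral>\<^sup>+Y. f (act UNIV B (act UNIV A Y)) \<partial>Pi\<^sub>M UNIV (\<lambda>_. N))"
    by (simp add: act_mult)
  also have "\<dots> = ennreal (1 / \<bar>det A\<bar> ^ m) * (\<integral>\<^sup>+Y. f (act UNIV B Y) \<partial>Pi\<^sub>M UNIV (\<lambda>_. N))"
    using 1 by (intro 1(1)[of "\<lambda>Y. f (act UNIV B Y)"]) (auto simp: det_mul intro!: measurable_compose[OF measurable_act])
  also have "\<dots> = ennreal (1 / \<bar>det A\<bar> ^ m) * (ennreal (1 / \<bar>det B\<bar> ^ m) * (\<integral>\<^sup>+Y. f Y \<partial>Pi\<^sub>M UNIV (\<lambda>_. N)))"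
    using 1 by (subst 1(2)) (auto simp: det_mul)
  finally show ?case
    by (simp add: det_mul abs_mult power_mult_distrib mult.assoc[symmetric] ennreal_mult[symmetric] divide_simps)
next
  case (2 A i)
  then show ?case using det_zero_row(2) by blast
next
  case (3 A)
  have d: "det A = (\<Prod>i\<in>UNIV. A $ i $ i)" using 3 by (intro det_diagonal) auto
  have "act UNIV A Y = (\<lambda>j\<in>UNIV. A $ j $ j *\<^sub>R Y j)" for Y :: "'n \<Rightarrow> 'a"
  proof
    fix j
    have "(\<Sum>i\<in>UNIV. A $ i $ j *\<^sub>R Y i) = (\<Sum>i\<in>UNIV. if i = j then A $ j $ j *\<^sub>R Y j else 0)"
      using 3(1) by (intro sum.cong) auto
    then show "act UNIV A Y j = (\<lambda>j\<in>UNIV. A $ j $ j *\<^sub>R Y j) j" by (simp add: act_def)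
  qed
  then have "(\<integral>\<^sup>+Y. f (act UNIV A Y) \<partial>Pi\<^sub>M UNIV (\<lambda>_. N)) = (\<integral>\<^sup>+Y. f (\<lambda>j\<in>UNIV. A $ j $ j *\<^sub>R Y j) \<partial>Pi\<^sub>M UNIV (\<lambda>_. N))"
    by simp
  also have "\<dots> = (\<Prod>j\<in>UNIV. ennreal (1 / \<bar>A $ j $ j\<bar> ^ m)) * (\<integral>\<^sup>+Y. f Y \<partial>Pi\<^sub>M UNIV (\<lambda>_. N))"
    using 3 d by (intro nn_integral_PiM_componentwise[where g = "\<lambda>j y. A $ j $ j *\<^sub>R y"] scale) auto
  also have "(\<Prod>j\<in>UNIV. ennreal (1 / \<bar>A $ j $ j\<bar> ^ m)) = ennreal (1 / \<bar>det A\<bar> ^ m)"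
    by (simp add: d prod_ennreal abs_prod prod_dividef prod_power_distrib)
  finally show ?case .
next
  case (4 p q)
  let ?M = "\<chi> i j. (mat 1 :: real^'n^'n) $ i $ Transposition.transpose p q j"
  let ?t = "Transposition.transpose p q"
  have ?case if "\<bar>det (?M::real^'n^'n)\<bar> = 1"
  proof -
    have act: "act UNIV ?M Y = (\<lambda>j. Y (?t j))" for Y :: "'n \<Rightarrow> 'a"
    proof
      fix j
      have "(\<Sum>i\<in>UNIV. ?M $ i $ j *\<^sub>R Y i) = (\<Sum>i\<in>UNIV. if i = ?t j then Y (?t j) else 0)"
        by (intro sum.cong) (auto simp: mat_def)
      then show "act UNIV ?M Y j = Y (?t j)" by (simp add: act_def)
    qed
    have "distr (Pi\<^sub>M UNIV (\<lambda>_. N)) (Pi\<^sub>M UNIV (\<lambda>_. N)) (\<lambda>Y j. Y (?t j)) = Pi\<^sub>M UNIV (\<lambda>_::'n. N)"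
    proof (rule PiM_eqI)
      fix A :: "'n \<Rightarrow> 'a set" assume A: "\<And>i. i \<in> UNIV \<Longrightarrow> A i \<in> sets N"
      interpret finite_product_sigma_finite "\<lambda>_. N" "UNIV :: 'n set" by standard simp
      have tt: "?t (?t j) = j" for j by simp
      have "(\<lambda>Y j. Y (?t j)) -` Pi\<^sub>E UNIV A \<inter> space (Pi\<^sub>M UNIV (\<lambda>_. N)) = Pi\<^sub>E UNIV (\<lambda>j. A (?t j))"
        by (auto simp: space_PiM PiE_def Pi_def extensional_def) (metis tt)+
      then have "emeasure (distr (Pi\<^sub>M UNIV (\<lambda>_. N)) (Pi\<^sub>M UNIV (\<lambda>_. N)) (\<lambda>Y j. Y (?t j))) (Pi\<^sub>E UNIV A)
        = emeasure (Pi\<^sub>M UNIV (\<lambda>_. N)) (Pi\<^sub>E UNIV (\<lambda>j. A (?t j)))"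
        using A by (subst emeasure_distr) (auto intro!: measurable_PiM_single')
      also have "\<dots> = (\<Prod>j\<in>UNIV. emeasure N (A (?t j)))"
        using A by (subst emeasure_PiM) auto
      also have "\<dots> = (\<Prod>j\<in>UNIV. emeasure N (A j))"
        by (rule prod.reindex_bij_betw[of ?t UNIV UNIV "\<lambda>j. emeasure N (A j)"]) simp
      finally show "emeasure (distr (Pi\<^sub>M UNIV (\<lambda>_. N)) (Pi\<^sub>M UNIV (\<lambda>_. N)) (\<lambda>Y j. Y (?t j))) (Pi\<^sub>E UNIV A) = (\<Prod>j\<in>UNIV. emeasure N (A j))" .
    qed auto
    then have "(\<integral>\<^sup>+Y. f Y \<partial>Pi\<^sub>M UNIV (\<lambda>_. N)) = (\<integral>\<^sup>+Y. f Y \<partial>distr (Pi\<^sub>M UNIV (\<lambda>_. N)) (Pi\<^sub>M UNIV (\<lambda>_. N)) (\<lambda>Y j. Y (?t j)))"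
      by simp
    also have "\<dots> = (\<integral>\<^sup>+Y. f (\<lambda>j. Y (?t j)) \<partial>Pi\<^sub>M UNIV (\<lambda>_. N))"
      using 4 by (subst nn_integral_distr) (auto intro!: measurable_PiM_single')
    finally show ?thesis using that by (simp add: act)
  qed
  moreover have "\<bar>det (?M::real^'n^'n)\<bar> = 1"
    using det_permute_columns[of ?t "mat 1 :: real^'n^'n"] 4
    by (simp add: permutes_swap_id sign_swap_id)
  ultimately show ?case by blast
next
  case (5 p q)
  let ?M = "(\<chi> i j. of_bool (i = p \<and> j = q \<or> i = j)) :: real^'n^'n"
  note [measurable] = 5(3)
  have d: "det (?M::real^'n^'n) = 1"
  proof -
    have "?M = (\<chi> k. if k = p then row p (mat 1) + row q (mat 1) else row k (mat 1 :: real^'n^'n))"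
      using 5 by (auto simp: vec_eq_iff row_def mat_def)
    moreover have "row q (mat 1 :: real^'n^'n) \<in> vec.span {row j (mat 1) |j. j \<noteq> p}"
      using 5 by (auto intro!: vec.span_base)
    ultimately show ?thesis using det_row_span[of "row q (mat 1)" "mat 1 :: real^'n^'n" p]
      by (simp add: 5)
  qed
  have act: "act UNIV ?M Y = Y(q := Y q + Y p)" for Y :: "'n \<Rightarrow> 'a"
  proof
    fix j
    have "(\<Sum>i\<in>UNIV. ?M $ i $ j *\<^sub>R Y i) = (\<Sum>i\<in>UNIV. (if i = j then Y j else 0) + (if i = p \<and> j = q then Y p else 0))"
      using 5 by (intro sum.cong) auto
    also have "\<dots> = Y j + (if j = q then Y p else 0)"
      by (simp add: sum.distrib)
    finally show "act UNIV ?M Y j = (Y(q := Y q + Y p)) j" by (simp add: act_def)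
  qed
  let ?J = "UNIV - {q}"
  have U: "UNIV = insert q ?J" by auto
  have m1: "(\<lambda>Y. f (Y(q := Y q + Y p))) \<in> borel_measurable (Pi\<^sub>M (insert q ?J) (\<lambda>_. N))"
    using measurable_compose[OF measurable_act[of UNIV ?M] 5(3)] unfolding act U[symmetric] .
  have AEW: "AE x in Pi\<^sub>M ?J (\<lambda>_. N). x p \<in> W"
    by (rule eventually_mono[OF AE_PiM_W[OF finite]]) (use 5 in auto)
  have "(\<integral>\<^sup>+Y. f (act UNIV ?M Y) \<partial>Pi\<^sub>M UNIV (\<lambda>_. N)) = (\<integral>\<^sup>+Y. f (Y(q := Y q + Y p)) \<partial>Pi\<^sub>M (insert q ?J) (\<lambda>_. N))"
    unfolding act U[symmetric] ..
  \<comment> \<open>Vector \<open>q\<close> is integrated innermost, with the others fixed: there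
    the shear is a translation by \<open>x p\<close>, which lies in \<open>W\<close> for almost
    every \<open>x\<close>.\<close>
  also have "\<dots> = (\<integral>\<^sup>+x. (\<integral>\<^sup>+y. f (x(q := y + x p)) \<partial>N) \<partial>Pi\<^sub>M ?J (\<lambda>_. N))"
    using 5 by (subst product_nn_integral_insert[OF _ _ m1]) auto
  also have "\<dots> = (\<integral>\<^sup>+x. (\<integral>\<^sup>+y. f (x(q := y)) \<partial>N) \<partial>Pi\<^sub>M ?J (\<lambda>_. N))"
  proof (rule nn_integral_cong_AE)
    show "AE x in Pi\<^sub>M ?J (\<lambda>_. N). (\<integral>\<^sup>+y. f (x(q := y + x p)) \<partial>N) = (\<integral>\<^sup>+y. f (x(q := y)) \<partial>N)"
      using AEW AE_space
    proof eventually_elim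
      case (elim x)
      have "(\<lambda>y. f (x(q := y))) \<in> borel_measurable N"
        using elim 5(3) U by (intro measurable_compose[OF measurable_component_update]) auto
      then have "(\<lambda>y. f (x(q := y))) \<in> borel_measurable borel" by simp
      from translate[OF elim(1) this] show ?case by simp
    qed
  qed
  also have "\<dots> = (\<integral>\<^sup>+Y. f Y \<partial>Pi\<^sub>M (insert q ?J) (\<lambda>_. N))"
    using 5 U by (subst product_nn_integral_insert) auto
  finally show ?case unfolding d U[symmetric] by simp
qed

text \<open>Adjoin the vectors outside \<open>K\<close>, restricted to a set \<open>B\<close> of
  finite positive measure. \<open>M\<close> leaves them alone, so the rule for all indices applies
  and their factor cancels.\<close>

lemma nn_integral_act:
  fixes M :: "real^'n^'n"
  assumes M: "block K M" "det M \<noteq> 0" and [measurable]: "f \<in> borel_measurable (Pi\<^sub>M K (\<lambda>_. N))"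
  shows "(\<integral>\<^sup>+Y. f (act K M Y) \<partial>Pi\<^sub>M K (\<lambda>_. N)) = ennreal (1 / \<bar>det M\<bar> ^ m) * (\<integral>\<^sup>+Y. f Y \<partial>Pi\<^sub>M K (\<lambda>_. N))"
proof -
  from finite_positive obtain B where B[measurable]: "B \<in> sets borel" "0 < emeasure N B" "emeasure N B < \<infinity>" by auto
  let ?g = "\<lambda>h Y. h (restrict Y K) * (\<Prod>j\<in>-K. indicator B (Y j))"
  let ?b = "emeasure N B ^ card (-K)"
  have ext: "(\<integral>\<^sup>+Y. ?g h Y \<partial>Pi\<^sub>M UNIV (\<lambda>_. N)) = (\<integral>\<^sup>+Y. h Y \<partial>Pi\<^sub>M K (\<lambda>_. N)) * ?b"
    if [measurable]: "h \<in> borel_measurable (Pi\<^sub>M K (\<lambda>_. N))" for h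
  proof -
    have m: "?g h \<in> borel_measurable (Pi\<^sub>M (K \<union> -K) (\<lambda>_. N))"
      by (intro borel_measurable_times_ennreal borel_measurable_prod_ennreal measurable_compose[OF measurable_restrict_subset that]) auto
    have "(\<integral>\<^sup>+Y. ?g h Y \<partial>Pi\<^sub>M (K \<union> -K) (\<lambda>_. N))
       = (\<integral>\<^sup>+x. \<integral>\<^sup>+y. h x * (\<Prod>j\<in>-K. indicator B (y j)) \<partial>Pi\<^sub>M (-K) (\<lambda>_. N) \<partial>Pi\<^sub>M K (\<lambda>_. N))"
    proof (subst product_nn_integral_fold[OF _ _ _ m]; (intro nn_integral_cong)?)
      fix x y assume x: "x \<in> space (Pi\<^sub>M K (\<lambda>_. N))" and y: "y \<in> space (Pi\<^sub>M (-K) (\<lambda>_. N))"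
      have "restrict (merge K (-K) (x, y)) K = x" using x by (auto simp: merge_def restrict_def fun_eq_iff space_PiM PiE_def extensional_def)
      moreover have "(\<Prod>j\<in>-K. indicator B (merge K (-K) (x, y) j)) = (\<Prod>j\<in>-K. indicator B (y j) :: ennreal)"
        by (intro prod.cong) (auto simp: merge_def)
      ultimately show "?g h (merge K (-K) (x, y)) = h x * (\<Prod>j\<in>-K. indicator B (y j))" by simp
    qed auto
    also have "\<dots> = (\<integral>\<^sup>+x. h x * (\<integral>\<^sup>+y. (\<Prod>j\<in>-K. indicator B (y j)) \<partial>Pi\<^sub>M (-K) (\<lambda>_. N)) \<partial>Pi\<^sub>M K (\<lambda>_. N))"
      by (intro nn_integral_cong nn_integral_cmult borel_measurable_prod_ennreal) auto
    also have "(\<integral>\<^sup>+y. (\<Prod>j\<in>-K. indicator B (y j)) \<partial>Pi\<^sub>M (-K) (\<lambda>_. N)) = ?b"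
      by (subst product_nn_integral_prod) auto
    also have "(\<integral>\<^sup>+x. h x * ?b \<partial>Pi\<^sub>M K (\<lambda>_. N)) = (\<integral>\<^sup>+x. h x \<partial>Pi\<^sub>M K (\<lambda>_. N)) * ?b"
      by (rule nn_integral_multc) measurable
    finally show ?thesis unfolding Compl_partition .
  qed
  have restr: "restrict (act UNIV M Y) K = act K M (restrict Y K)" for Y :: "'n \<Rightarrow> 'a"
  proof -
    have "(\<Sum>i\<in>UNIV. M $ i $ j *\<^sub>R Y i) = (\<Sum>i\<in>K. M $ i $ j *\<^sub>R Y i)" if "j \<in> K" for j
      using M(1) that by (intro sum.mono_neutral_right) (auto simp: block_def split: if_splits)
    then show ?thesis by (auto simp: act_def fun_eq_iff intro!: sum.cong)
  qed
  have out: "act UNIV M Y j = Y j" if "j \<notin> K" for Y :: "'n \<Rightarrow> 'a" and j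
  proof -
    have "(\<Sum>i\<in>UNIV. M $ i $ j *\<^sub>R Y i) = (\<Sum>i\<in>UNIV. if i = j then Y i else 0)"
      using M(1) that by (intro sum.cong) (auto simp: block_def)
    then show ?thesis by (simp add: act_def)
  qed
  have "(\<integral>\<^sup>+Y. f (act K M Y) \<partial>Pi\<^sub>M K (\<lambda>_. N)) * ?b = (\<integral>\<^sup>+Y. ?g (\<lambda>Y. f (act K M Y)) Y \<partial>Pi\<^sub>M UNIV (\<lambda>_. N))"
    by (rule ext[symmetric]) measurable
  also have "\<dots> = (\<integral>\<^sup>+Y. ?g f (act UNIV M Y) \<partial>Pi\<^sub>M UNIV (\<lambda>_. N))"
    by (simp add: restr out)
  also have "\<dots> = ennreal (1 / \<bar>det M\<bar> ^ m) * (\<integral>\<^sup>+Y. ?g f Y \<partial>Pi\<^sub>M UNIV (\<lambda>_. N))"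
    using M by (intro nn_integral_act_UNIV borel_measurable_times_ennreal borel_measurable_prod_ennreal
        measurable_compose[OF measurable_restrict_subset assms(3)]) auto
  also have "(\<integral>\<^sup>+Y. ?g f Y \<partial>Pi\<^sub>M UNIV (\<lambda>_. N)) = (\<integral>\<^sup>+Y. f Y \<partial>Pi\<^sub>M K (\<lambda>_. N)) * ?b"
    by (rule ext) measurable
  finally have *: "(\<integral>\<^sup>+Y. f (act K M Y) \<partial>Pi\<^sub>M K (\<lambda>_. N)) * ?b
      = ennreal (1 / \<bar>det M\<bar> ^ m) * (\<integral>\<^sup>+Y. f Y \<partial>Pi\<^sub>M K (\<lambda>_. N)) * ?b"
    by (simp add: mult.assoc)
  have "?b \<noteq> 0" "?b \<noteq> top" using B(2,3) by (auto simp: power_eq_top_ennreal)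
  then show ?thesis
    using * ennreal_mult_cancel_left[of ?b] unfolding mult.commute[of _ ?b] by blast
qed

end

interpretation lborel_real: homogeneous_measure "lborel :: real measure" UNIV 1
proof
  show "\<exists>B\<in>sets borel. 0 < emeasure lborel (B :: real set) \<and> emeasure lborel B < \<infinity>"
    by (rule bexI[of _ "{0..1}"]) auto
  fix a c :: real and h :: "real \<Rightarrow> ennreal" assume h[measurable]: "h \<in> borel_measurable borel"
  show "(\<integral>\<^sup>+x. h (x + a) \<partial>lborel) = (\<integral>\<^sup>+x. h x \<partial>lborel)"
    using nn_integral_real_affine[OF h, of 1 a] by (simp add: add.commute)
  assume "c \<noteq> 0"
  then show "(\<integral>\<^sup>+x. h (c *\<^sub>R x) \<partial>lborel) = ennreal (1 / \<bar>c\<bar> ^ 1) * (\<integral>\<^sup>+x. h x \<partial>lborel)"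
    using nn_integral_real_affine[OF h, of c 0] by (simp add: mult.assoc[symmetric] ennreal_mult[symmetric])
qed auto

section \<open>Lebesgue measure on subspaces\<close>

definition orthonormal_on :: "'i set \<Rightarrow> ('i \<Rightarrow> 'a::real_inner) \<Rightarrow> bool" where
  "orthonormal_on J b \<longleftrightarrow> (\<forall>i\<in>J. \<forall>j\<in>J. b i \<bullet> b j = (if i = j then 1 else 0))"

text \<open>Lebesgue measure of the span of an orthonormal \<open>b\<close>, kept as a Borel measure
  on the ambient space so that measures on different subspaces share one type and one
  sigma-algebra.\<close>

definition frame_measure :: "'n set \<Rightarrow> ('n \<Rightarrow> 'a::euclidean_space) \<Rightarrow> 'a measure" where
  "frame_measure J b = distr (Pi\<^sub>M J (\<lambda>_. lborel)) borel (\<lambda>c. \<Sum>i\<in>J. c i *\<^sub>R b i)"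

lemma sets_frame_measure[measurable_cong, simp]: "sets (frame_measure J b) = sets borel"
  by (simp add: frame_measure_def)

lemma space_frame_measure[simp]: "space (frame_measure J b) = UNIV"
  by (simp add: frame_measure_def)

lemma nn_integral_frame_measure:
  assumes "h \<in> borel_measurable borel"
  shows "(\<integral>\<^sup>+x. h x \<partial>frame_measure J b) = (\<integral>\<^sup>+c. h (\<Sum>i\<in>J. c i *\<^sub>R b i) \<partial>Pi\<^sub>M J (\<lambda>_. lborel))"
  unfolding frame_measure_def using assms by (subst nn_integral_distr) auto

lemma inner_orthonormal_sum:
  assumes "orthonormal_on J b" "finite J" "j \<in> J"
  shows "(\<Sum>i\<in>J. c i *\<^sub>R b i) \<bullet> b j = c j"
proof -
  have "(\<Sum>i\<in>J. c i *\<^sub>R b i) \<bullet> b j = (\<Sum>i\<in>J. c i * (if i = j then 1 else 0))"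
    unfolding inner_sum_left using assms by (intro sum.cong) (auto simp: orthonormal_on_def)
  then show ?thesis using assms by (simp add: if_distrib cong: if_cong)
qed

lemma inner_orthonormal_sums:
  assumes "orthonormal_on J b" "finite J"
  shows "(\<Sum>i\<in>J. c i *\<^sub>R b i) \<bullet> (\<Sum>i\<in>J. d i *\<^sub>R b i) = (\<Sum>i\<in>J. c i * d i)"
  using inner_orthonormal_sum[OF assms]
  by (subst inner_sum_right) (auto intro!: sum.cong simp: mult.commute)

lemma norm_orthonormal_sum:
  assumes "orthonormal_on J b" "finite J"
  shows "norm (\<Sum>i\<in>J. c i *\<^sub>R b i) = sqrt (\<Sum>i\<in>J. (c i)\<^sup>2)"
  unfolding norm_eq_sqrt_inner inner_orthonormal_sums[OF assms] by (simp add: power2_eq_square)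

lemma emeasure_frame_measure_cball:
  fixes J :: "'n::finite set"
  assumes "orthonormal_on J b" "r > 0"
  shows "emeasure (frame_measure J b) (cball 0 r) = ennreal (unit_ball_vol (real (card J)) * r ^ card J)"
proof -
  have "(\<lambda>c. \<Sum>i\<in>J. c i *\<^sub>R b i) -` cball 0 r \<inter> space (Pi\<^sub>M J (\<lambda>_. lborel)) =
     {c. sqrt (\<Sum>i\<in>J. (c i)\<^sup>2) \<le> r} \<inter> space (Pi\<^sub>M J (\<lambda>_. lborel))"
    using norm_orthonormal_sum[OF assms(1)] by (auto simp: dist_norm)
  then show ?thesis
    unfolding frame_measure_def using assms emeasure_cball_aux[of J r] by (subst emeasure_distr) auto
qed

lemma orthonormal_on_inj_on: "orthonormal_on J b \<Longrightarrow> inj_on b J"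
  unfolding orthonormal_on_def inj_on_def by (metis zero_neq_one)

text \<open>Translations and dilations act on each coefficient separately, so both rules come from
  the real line; balls exhaust the space with finite measure.\<close>

lemma homogeneous_frame_measure:
  fixes J :: "'n::finite set"
  assumes b: "orthonormal_on J b"
  shows "homogeneous_measure (frame_measure J b) (span (b ` J)) (card J)"
proof
  show "\<exists>A. countable A \<and> A \<subseteq> sets (frame_measure J b) \<and> \<Union> A = space (frame_measure J b) \<and> (\<forall>a\<in>A. emeasure (frame_measure J b) a \<noteq> \<infinity>)"
  proof (intro exI conjI)
    show "countable (range (\<lambda>n::nat. cball (0::'a) (real (Suc n))))" by auto
    have "x \<in> cball 0 (real (Suc (nat \<lceil>norm x\<rceil>)))" for x :: 'a
      by (simp add: dist_norm) linarith
    then show "\<Union> (range (\<lambda>n::nat. cball (0::'a) (real (Suc n)))) = space (frame_measure J b)"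
      unfolding space_frame_measure by blast
    show "\<forall>a\<in>range (\<lambda>n. cball 0 (real (Suc n))). emeasure (frame_measure J b) a \<noteq> \<infinity>"
      using emeasure_frame_measure_cball[OF b] by (auto simp del: of_nat_Suc)
  qed auto
  show "AE x in frame_measure J b. x \<in> span (b ` J)"
    unfolding frame_measure_def using closed_subspace[OF subspace_span[of "b ` J"]]
    by (subst AE_distr_iff) (auto intro!: AE_I2 span_sum span_scale intro: span_base)
  show "\<exists>B\<in>sets borel. 0 < emeasure (frame_measure J b) B \<and> emeasure (frame_measure J b) B < \<infinity>"
    using emeasure_frame_measure_cball[OF b, of 1] by (intro bexI[of _ "cball 0 1"]) auto
  fix a :: 'a and c :: real and h :: "'a \<Rightarrow> ennreal" assume h[measurable]: "h \<in> borel_measurable borel"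
  { assume "a \<in> span (b ` J)"
    then obtain u where u: "a = (\<Sum>v\<in>b ` J. u v *\<^sub>R v)"
      by (subst (asm) span_finite) auto
    have a: "a = (\<Sum>i\<in>J. u (b i) *\<^sub>R b i)"
      using orthonormal_on_inj_on[OF b] unfolding u by (subst sum.reindex) auto
    have "(\<integral>\<^sup>+x. h (x + a) \<partial>frame_measure J b) = (\<integral>\<^sup>+c. h (\<Sum>i\<in>J. (\<lambda>i\<in>J. c i + u (b i)) i *\<^sub>R b i) \<partial>Pi\<^sub>M J (\<lambda>_. lborel))"
      by (subst nn_integral_frame_measure) (auto simp: a scaleR_add_left sum.distrib intro!: nn_integral_cong)
    also have "\<dots> = (\<Prod>i\<in>J. 1) * (\<integral>\<^sup>+c. h (\<Sum>i\<in>J. c i *\<^sub>R b i) \<partial>Pi\<^sub>M J (\<lambda>_. lborel))"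
      using lborel_real.translate
      by (intro lborel_real.nn_integral_PiM_componentwise[where g = "\<lambda>i x. x + u (b i)"]) auto
    finally show "(\<integral>\<^sup>+x. h (x + a) \<partial>frame_measure J b) = (\<integral>\<^sup>+x. h x \<partial>frame_measure J b)"
      by (simp add: nn_integral_frame_measure) }
  { assume "c \<noteq> 0"
    have "(\<integral>\<^sup>+x. h (c *\<^sub>R x) \<partial>frame_measure J b) = (\<integral>\<^sup>+x. h (\<Sum>i\<in>J. (\<lambda>i\<in>J. c * x i) i *\<^sub>R b i) \<partial>Pi\<^sub>M J (\<lambda>_. lborel))"
      by (subst nn_integral_frame_measure) (auto simp: scaleR_sum_right intro!: nn_integral_cong)
    also have "\<dots> = (\<Prod>i\<in>J. ennreal (1 / \<bar>c\<bar>)) * (\<integral>\<^sup>+x. h (\<Sum>i\<in>J. x i *\<^sub>R b i) \<partial>Pi\<^sub>M J (\<lambda>_. lborel))"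
      using lborel_real.scale[OF \<open>c \<noteq> 0\<close>]
      by (intro lborel_real.nn_integral_PiM_componentwise[where g = "\<lambda>i x. c * x"]) auto
    finally show "(\<integral>\<^sup>+x. h (c *\<^sub>R x) \<partial>frame_measure J b) = ennreal (1 / \<bar>c\<bar> ^ card J) * (\<integral>\<^sup>+x. h x \<partial>frame_measure J b)"
      by (simp add: nn_integral_frame_measure ennreal_power power_one_over) }
qed auto

text \<open>Bridges two index sets: the theorem indexes tuples by \<open>{1..k}\<close>, the matrix
  arguments by a set \<open>K\<close> of coordinate indices.\<close>

lemma distr_PiM_reindex_bij:
  assumes N: "sigma_finite_measure N" and e: "bij_betw e I J" and I: "finite I"
  shows "distr (Pi\<^sub>M I (\<lambda>_. N)) (Pi\<^sub>M J (\<lambda>_. N)) (\<lambda>x. \<lambda>j\<in>J. x (the_inv_into I e j)) = Pi\<^sub>M J (\<lambda>_. N)"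
proof -
  interpret product_sigma_finite "\<lambda>_. N" by (rule product_sigma_finite.intro) (rule N)
  have J: "finite J" using e I bij_betw_finite by blast
  have inv: "the_inv_into I e j \<in> I" "e (the_inv_into I e j) = j" if "j \<in> J" for j
    using that e by (auto simp: bij_betw_def intro: the_inv_into_into f_the_inv_into_f)
  have inv': "the_inv_into I e (e i) = i" "e i \<in> J" if "i \<in> I" for i
    using that e by (auto simp: bij_betw_def intro: the_inv_into_f_f)
  have m[measurable]: "(\<lambda>x. \<lambda>j\<in>J. x (the_inv_into I e j)) \<in> measurable (Pi\<^sub>M I (\<lambda>_. N)) (Pi\<^sub>M J (\<lambda>_. N))"
    using inv by (intro measurable_restrict measurable_component_singleton) auto
  show ?thesis
  proof (rule PiM_eqI[OF J])
    fix A assume A: "\<And>i. i \<in> J \<Longrightarrow> A i \<in> sets N"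
    interpret finite_product_sigma_finite "\<lambda>_. N" I by standard fact
    have "(\<lambda>x. \<lambda>j\<in>J. x (the_inv_into I e j)) -` Pi\<^sub>E J A \<inter> space (Pi\<^sub>M I (\<lambda>_. N)) = Pi\<^sub>E I (\<lambda>i. A (e i))"
    proof (intro equalityI subsetI)
      fix x assume x: "x \<in> (\<lambda>x. \<lambda>j\<in>J. x (the_inv_into I e j)) -` Pi\<^sub>E J A \<inter> space (Pi\<^sub>M I (\<lambda>_. N))"
      then have "x i \<in> A (e i)" if "i \<in> I" for i
        using inv'[OF that] by (auto simp: PiE_def Pi_def)
      then show "x \<in> Pi\<^sub>E I (\<lambda>i. A (e i))" using x by (auto simp: space_PiM PiE_def)
    next
      fix x assume x: "x \<in> Pi\<^sub>E I (\<lambda>i. A (e i))"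
      then have "x (the_inv_into I e j) \<in> A j" if "j \<in> J" for j
        using inv[OF that] by (auto simp: PiE_def Pi_def)
      moreover have "A (e i) \<subseteq> space N" if "i \<in> I" for i
        using A[of "e i"] inv'[OF that] sets.sets_into_space by auto
      ultimately show "x \<in> (\<lambda>x. \<lambda>j\<in>J. x (the_inv_into I e j)) -` Pi\<^sub>E J A \<inter> space (Pi\<^sub>M I (\<lambda>_. N))"
        using x by (auto simp: space_PiM PiE_def Pi_def)
    qed
    then have "emeasure (distr (Pi\<^sub>M I (\<lambda>_. N)) (Pi\<^sub>M J (\<lambda>_. N)) (\<lambda>x. \<lambda>j\<in>J. x (the_inv_into I e j))) (Pi\<^sub>E J A)
       = emeasure (Pi\<^sub>M I (\<lambda>_. N)) (Pi\<^sub>E I (\<lambda>i. A (e i)))"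
      using A J by (subst emeasure_distr) (auto intro!: sets_PiM_I_finite)
    also have "\<dots> = (\<Prod>i\<in>I. emeasure N (A (e i)))"
      using A inv' I by (subst emeasure_PiM) auto
    also have "\<dots> = (\<Prod>j\<in>J. emeasure N (A j))"
      by (rule prod.reindex_bij_betw[OF e])
    finally show "emeasure (distr (Pi\<^sub>M I (\<lambda>_. N)) (Pi\<^sub>M J (\<lambda>_. N)) (\<lambda>x. \<lambda>j\<in>J. x (the_inv_into I e j))) (Pi\<^sub>E J A) = (\<Prod>j\<in>J. emeasure N (A j))" .
  qed auto
qed

lemma nn_integral_PiM_reindex:
  assumes N: "sigma_finite_measure N" and e: "bij_betw e I J" and I: "finite I"
    and f: "f \<in> borel_measurable (Pi\<^sub>M J (\<lambda>_. N))"
  shows "(\<integral>\<^sup>+x. f x \<partial>Pi\<^sub>M J (\<lambda>_. N)) = (\<integral>\<^sup>+x. f (\<lambda>j\<in>J. x (the_inv_into I e j)) \<partial>Pi\<^sub>M I (\<lambda>_. N))"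
proof -
  have "the_inv_into I e j \<in> I" if "j \<in> J" for j
    using that e by (auto simp: bij_betw_def intro: the_inv_into_into)
  then show ?thesis
    using f by (subst distr_PiM_reindex_bij[OF N e I, symmetric], subst nn_integral_distr)
      (auto intro!: measurable_restrict measurable_component_singleton)
qed

lemma in_span_image_sum:
  assumes "x \<in> span (b ` J)" "finite J"
  shows "\<exists>u. x = (\<Sum>i\<in>J. u i *\<^sub>R b i)"
  using assms(2,1)
proof (induction J arbitrary: x rule: finite_induct)
  case empty
  then show ?case by simp
next
  case (insert j J)
  then obtain a where "x - a *\<^sub>R b j \<in> span (b ` J)"
    by (auto simp: span_breakdown_eq)
  then obtain u where "x - a *\<^sub>R b j = (\<Sum>i\<in>J. u i *\<^sub>R b i)" using insert.IH by blast
  then have "x = (\<Sum>i\<in>insert j J. (u(j := a)) i *\<^sub>R b i)"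
    using insert.hyps by (subst sum.insert) (auto simp: algebra_simps intro!: sum.cong)
  then show ?case by blast
qed

lemma orthonormal_expansion:
  assumes b: "orthonormal_on J b" and J: "finite J" and x: "x \<in> span (b ` J)"
  shows "(\<Sum>i\<in>J. (x \<bullet> b i) *\<^sub>R b i) = x"
proof -
  obtain u where u: "x = (\<Sum>i\<in>J. u i *\<^sub>R b i)"
    using in_span_image_sum[OF x J] by blast
  have "x \<bullet> b i = u i" if "i \<in> J" for i
    unfolding u by (rule inner_orthonormal_sum[OF b J that])
  then show ?thesis unfolding u by (intro sum.cong) auto
qed

text \<open>Two orthonormal frames of one subspace differ by an orthogonal matrix, and the
  substitution rule for the coefficients sees only \<open>\<bar>det U\<bar> = 1\<close>.\<close>

lemma frame_measure_cong_span:
  fixes J :: "'n::finite set" and b b' :: "'n \<Rightarrow> 'a::euclidean_space"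
  assumes b: "orthonormal_on J b" and b': "orthonormal_on J b'"
    and span: "span (b ` J) = span (b' ` J)"
  shows "frame_measure J b = frame_measure J b'"
proof -
  \<comment> \<open>Row \<open>j\<close> of \<open>U\<close> holds the coordinates of
    \<open>b' j\<close> in the frame \<open>b\<close>, padded to a \<open>block\<close>
    matrix.\<close>
  define U where "U = (\<chi> j i. if i \<in> J \<and> j \<in> J then b i \<bullet> b' j else if i = j then 1 else (0 :: real))"
  have expand: "b' j = (\<Sum>i\<in>J. U $ j $ i *\<^sub>R b i)" if "j \<in> J" for j
    using orthonormal_expansion[OF b finite, of "b' j"] that span span_base[of "b' j" "b' ` J"]
    by (auto simp: U_def inner_commute)
  have block: "block J U" by (auto simp: block_def U_def)
  have "U ** transpose U = mat 1"
  proof -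
    have "(\<Sum>l\<in>UNIV. U $ i $ l * U $ j $ l) = (if i = j then 1 else 0)" for i j
    proof (cases "i \<in> J \<and> j \<in> J")
      case True
      then have "(\<Sum>l\<in>UNIV. U $ i $ l * U $ j $ l) = (\<Sum>l\<in>J. U $ i $ l * U $ j $ l)"
        by (intro sum.mono_neutral_right) (auto simp: U_def)
      also have "\<dots> = b' i \<bullet> b' j"
        using True by (subst (1 2) expand) (auto simp: inner_orthonormal_sums[OF b finite])
      finally show ?thesis using b' True by (auto simp: orthonormal_on_def)
    next
      case False
      have "U $ i $ l * U $ j $ l = (if l = i then (if i = j then 1 else 0) else 0)" for l
        using False by (cases "l = i"; cases "i = j"; cases "l = j"; auto simp: U_def)
      then show ?thesis by simp
    qed
    then show ?thesis by (simp add: matrix_matrix_mult_def transpose_def mat_def vec_eq_iff)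
  qed
  then have "det U * det U = 1" by (metis det_mul det_transpose det_I)
  then have det: "\<bar>det U\<bar> = 1" by (metis abs_mult_self_eq abs_1 abs_square_eq_1 power2_eq_square)
  show ?thesis
  proof (rule measure_eqI)
    fix A assume "A \<in> sets (frame_measure J b)"
    then have [measurable]: "A \<in> sets borel" by simp
    have "emeasure (frame_measure J b') A = (\<integral>\<^sup>+c. indicator A (\<Sum>j\<in>J. c j *\<^sub>R b' j) \<partial>Pi\<^sub>M J (\<lambda>_. lborel))"
      using nn_integral_frame_measure[of "indicator A" J b'] by (simp add: nn_integral_indicator)
    also have "\<dots> = (\<integral>\<^sup>+c. indicator A (\<Sum>i\<in>J. act J U c i *\<^sub>R b i) \<partial>Pi\<^sub>M J (\<lambda>_. lborel))"
    proof (intro nn_integral_cong arg_cong[where f = "indicator A"])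
      fix c
      have "(\<Sum>j\<in>J. c j *\<^sub>R b' j) = (\<Sum>j\<in>J. \<Sum>i\<in>J. (U $ j $ i * c j) *\<^sub>R b i)"
        by (intro sum.cong) (auto simp: expand scaleR_sum_right mult.commute)
      also have "\<dots> = (\<Sum>i\<in>J. act J U c i *\<^sub>R b i)"
        by (subst sum.swap) (auto simp: act_def scaleR_sum_left intro!: sum.cong)
      finally show "(\<Sum>j\<in>J. c j *\<^sub>R b' j) = (\<Sum>i\<in>J. act J U c i *\<^sub>R b i)" .
    qed
    also have "\<dots> = ennreal (1 / \<bar>det U\<bar> ^ 1) * (\<integral>\<^sup>+c. indicator A (\<Sum>i\<in>J. c i *\<^sub>R b i) \<partial>Pi\<^sub>M J (\<lambda>_. lborel))"
      using det by (intro lborel_real.nn_integral_act block) auto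
    also have "(\<integral>\<^sup>+c. indicator A (\<Sum>i\<in>J. c i *\<^sub>R b i) \<partial>Pi\<^sub>M J (\<lambda>_. lborel)) = emeasure (frame_measure J b) A"
      using nn_integral_frame_measure[of "indicator A" J b] by (simp add: nn_integral_indicator)
    finally show "emeasure (frame_measure J b) A = emeasure (frame_measure J b') A"
      using det by simp
  qed simp
qed

lemma orthonormal_on_axis: "orthonormal_on J (\<lambda>i. axis i 1 :: real^'n)"
  by (auto simp: orthonormal_on_def inner_axis_axis)

text \<open>Makes the ambient Lebesgue measure one more frame measure, so that it inherits the rules
  proved for these.\<close>

lemma frame_measure_axis: "frame_measure UNIV (\<lambda>i. axis i 1 :: real^'n) = lborel"
proof (rule measure_eqI)
  fix A assume "A \<in> sets (frame_measure UNIV (\<lambda>i. axis i 1 :: real^'n))"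
  then have [measurable]: "A \<in> sets borel" by simp
  let ?e = "\<lambda>i. axis i (1::real) :: real^'n"
  have inj: "inj ?e" by (auto simp: inj_def axis_eq_axis)
  have Basis: "range ?e = Basis" by (auto simp: Basis_vec_def)
  have bij: "bij_betw ?e UNIV Basis" using inj Basis by (auto simp: bij_betw_def)
  have "emeasure lborel A = (\<integral>\<^sup>+x. indicator A x \<partial>(lborel :: (real^'n) measure))" by simp
  also have "\<dots> = (\<integral>\<^sup>+f. indicator A (\<Sum>b\<in>Basis. f b *\<^sub>R b) \<partial>Pi\<^sub>M Basis (\<lambda>_. lborel))"
    by (subst lborel_eq, subst nn_integral_distr) auto
  also have "\<dots> = (\<integral>\<^sup>+x. indicator A (\<Sum>b\<in>Basis. (\<lambda>j\<in>Basis. x (the_inv_into UNIV ?e j)) b *\<^sub>R b) \<partial>Pi\<^sub>M UNIV (\<lambda>_. lborel))"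
    by (rule nn_integral_PiM_reindex[OF _ bij]) (auto intro: lborel.sigma_finite_measure_axioms)
  also have "\<dots> = (\<integral>\<^sup>+x. indicator A (\<Sum>i\<in>UNIV. x i *\<^sub>R ?e i) \<partial>Pi\<^sub>M UNIV (\<lambda>_. lborel))"
    unfolding Basis[symmetric] by (simp add: sum.reindex[OF inj] the_inv_f_f[OF inj])
  also have "\<dots> = emeasure (frame_measure UNIV ?e) A"
    using nn_integral_frame_measure[of "indicator A" UNIV ?e] by (simp add: nn_integral_indicator)
  finally show "emeasure (frame_measure UNIV ?e) A = emeasure lborel A" ..
qed simp

lemma span_orthonormal_UNIV:
  assumes "orthonormal_on UNIV (b :: 'n \<Rightarrow> real^'n)"
  shows "span (range b) = UNIV"
proof -
  have "independent (range b)"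
    using assms by (intro pairwise_orthogonal_independent)
      (auto simp: pairwise_def orthogonal_def orthonormal_on_def, metis inner_zero_left zero_neq_one)
  moreover have "card (range b) = CARD('n)"
    using orthonormal_on_inj_on[OF assms] by (simp add: card_image)
  ultimately show ?thesis
    using card_ge_dim_independent[of "range b" UNIV] by auto
qed

lemma homogeneous_lborel: "homogeneous_measure (lborel :: (real^'n) measure) UNIV CARD('n)"
proof -
  let ?e = "\<lambda>i. axis i 1 :: real^'n"
  have "homogeneous_measure (frame_measure UNIV ?e) (span (range ?e)) CARD('n)"
    by (rule homogeneous_frame_measure) (rule orthonormal_on_axis)
  moreover have "span (range ?e) = UNIV"
    by (rule span_orthonormal_UNIV) (rule orthonormal_on_axis)
  ultimately show ?thesis by (simp only: frame_measure_axis)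
qed


section \<open>Gram determinants\<close>

text \<open>Because of the padding, the determinant of this matrix is the Gram determinant of the
  vectors indexed by \<open>K\<close>; its root is the volume of the parallelepiped that they
  span.\<close>

definition gram :: "'n set \<Rightarrow> ('n \<Rightarrow> 'a::real_inner) \<Rightarrow> real^'n^'n" where
  "gram K Y = (\<chi> i j. if i \<in> K \<and> j \<in> K then Y i \<bullet> Y j else if i = j then 1 else 0)"

definition gram_vol :: "'n::finite set \<Rightarrow> ('n \<Rightarrow> 'a::real_inner) \<Rightarrow> real" where
  "gram_vol K Y = sqrt (det (gram K Y))"

lemma block_mult_entry:
  fixes A B :: "real^'n^'n"
  assumes "block K A \<or> block K B" "i \<in> K" "j \<in> K"
  shows "(A ** B) $ i $ j = (\<Sum>l\<in>K. A $ i $ l * B $ l $ j)"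
proof -
  have "(\<Sum>l\<in>UNIV. A $ i $ l * B $ l $ j) = (\<Sum>l\<in>K. A $ i $ l * B $ l $ j)"
    using assms by (intro sum.mono_neutral_right) (auto simp: block_def split: if_splits)
  then show ?thesis by (simp add: matrix_matrix_mult_def)
qed

lemma block_mult:
  fixes A B :: "real^'n^'n"
  assumes "block K A" "block K B"
  shows "block K (A ** B)"
  unfolding block_def
proof (intro allI impI)
  fix i j assume ij: "i \<notin> K \<or> j \<notin> K"
  have "(\<Sum>l\<in>UNIV. A $ i $ l * B $ l $ j) = (if i = j then 1 else 0)"
  proof (cases "i \<in> K")
    case False
    then have "A $ i $ l = (if l = i then 1 else 0)" for l using assms(1) by (auto simp: block_def)
    then show ?thesis using assms(2) False by (simp add: block_def if_distrib[of "\<lambda>x. x * _"] cong: if_cong)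
  next
    case True
    then have "B $ l $ j = (if l = j then 1 else 0)" for l using assms(2) ij by (auto simp: block_def)
    then show ?thesis using assms(1) ij by (simp add: block_def if_distrib[of "\<lambda>x. _ * x"] cong: if_cong)
  qed
  then show "(A ** B) $ i $ j = (if i = j then 1 else 0)" by (simp add: matrix_matrix_mult_def)
qed

lemma block_transpose[simp]: "block K (transpose A) = block K A"
  by (auto simp: block_def transpose_def)

lemma block_gram[simp]: "block K (gram K Y)"
  by (auto simp: block_def gram_def)

lemma block_eqI:
  assumes "block K A" "block K B" "\<And>i j. i \<in> K \<Longrightarrow> j \<in> K \<Longrightarrow> A $ i $ j = B $ i $ j"
  shows "A = B"
  unfolding vec_eq_iff
proof (intro allI)
  fix i j show "A $ i $ j = B $ i $ j"
    using assms by (cases "i \<in> K \<and> j \<in> K") (auto simp: block_def)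
qed

lemma gram_act:
  fixes M :: "real^'n^'n"
  assumes M: "block K M"
  shows "gram K (act K M Y) = transpose M ** gram K Y ** M"
proof (rule block_eqI)
  show "block K (transpose M ** gram K Y ** M)" using M by (intro block_mult) auto
  fix i j assume ij: "i \<in> K" "j \<in> K"
  have "(transpose M ** gram K Y ** M) $ i $ j = (\<Sum>b\<in>K. (\<Sum>a\<in>K. M $ a $ i * (Y a \<bullet> Y b)) * M $ b $ j)"
  proof -
    have "(transpose M ** gram K Y) $ i $ b = (\<Sum>a\<in>K. M $ a $ i * (Y a \<bullet> Y b))" if "b \<in> K" for b
      using ij M that block_mult_entry[of K "transpose M" "gram K Y" i b]
      by (simp add: transpose_def[of M]) (simp add: gram_def)
    then show ?thesis using ij M by (subst block_mult_entry[of K]) auto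
  qed
  also have "\<dots> = act K M Y i \<bullet> act K M Y j"
    using ij by (simp add: act_def inner_sum_left inner_sum_right sum_distrib_left sum_distrib_right mult_ac)
  finally show "gram K (act K M Y) $ i $ j = (transpose M ** gram K Y ** M) $ i $ j"
    using ij by (simp add: gram_def)
qed auto

lemma gram_vol_act:
  assumes "block K M"
  shows "gram_vol K (act K M Y) = \<bar>det M\<bar> * gram_vol K Y"
  by (simp add: gram_vol_def gram_act[OF assms] det_mul real_sqrt_mult)

lemma gram_cong: "(\<And>i. i \<in> K \<Longrightarrow> Y i = Z i) \<Longrightarrow> gram K Y = gram K Z"
  by (simp add: gram_def vec_eq_iff)

lemma gram_vol_cong: "(\<And>i. i \<in> K \<Longrightarrow> Y i = Z i) \<Longrightarrow> gram_vol K Y = gram_vol K Z"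
  by (simp add: gram_vol_def gram_cong[of K Y Z])

lemma gram_orthonormal: "orthonormal_on K b \<Longrightarrow> gram K b = mat 1"
  by (auto simp: gram_def orthonormal_on_def mat_def vec_eq_iff)

text \<open>The tuple written in an orthonormal frame. If the frame spans a space containing the
  tuple, this replaces \<open>card K\<close> vectors of a large space by a square matrix whose
  determinant is, up to sign, their Gram volume.\<close>

definition frame_coords :: "'n set \<Rightarrow> ('n \<Rightarrow> 'a::real_inner) \<Rightarrow> ('n \<Rightarrow> 'a) \<Rightarrow> real^'n^'n" where
  "frame_coords K b Y = (\<chi> i j. if i \<in> K \<and> j \<in> K then Y j \<bullet> b i else if i = j then 1 else 0)"

lemma block_frame_coords[simp]: "block K (frame_coords K b Y)"
  by (auto simp: block_def frame_coords_def)

lemma act_frame_coords: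
  assumes b: "orthonormal_on K (b :: 'n::finite \<Rightarrow> 'a::real_inner)" and Y: "\<And>j. j \<in> K \<Longrightarrow> Y j \<in> span (b ` K)"
  shows "act K (frame_coords K b Y) b = restrict Y K"
proof
  fix j
  have "(\<Sum>i\<in>K. frame_coords K b Y $ i $ j *\<^sub>R b i) = Y j" if "j \<in> K"
    using that orthonormal_expansion[OF b finite Y[OF that]] by (simp add: frame_coords_def)
  then show "act K (frame_coords K b Y) b j = restrict Y K j" by (simp add: act_def)
qed

lemma gram_frame_coords:
  assumes b: "orthonormal_on K (b :: 'n::finite \<Rightarrow> 'a::real_inner)" and Y: "\<And>j. j \<in> K \<Longrightarrow> Y j \<in> span (b ` K)"
  shows "gram K Y = transpose (frame_coords K b Y) ** frame_coords K b Y"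
proof -
  have "gram K Y = gram K (act K (frame_coords K b Y) b)"
    using act_frame_coords[OF assms] by (intro gram_cong) simp
  then show ?thesis by (simp add: gram_act gram_orthonormal[OF b])
qed

lemma gram_vol_frame_coords:
  assumes b: "orthonormal_on K (b :: 'n::finite \<Rightarrow> 'a::real_inner)" and Y: "\<And>j. j \<in> K \<Longrightarrow> Y j \<in> span (b ` K)"
  shows "gram_vol K Y = \<bar>det (frame_coords K b Y)\<bar>"
  by (simp add: gram_vol_def gram_frame_coords[OF assms] det_mul)

section \<open>Orthonormal frames adapted to given subspaces\<close>

lemma dim_span_orthonormal:
  assumes "orthonormal_on J (b :: 'i \<Rightarrow> 'a::euclidean_space)"
  shows "dim (span (b ` J)) = card J"
proof -
  have "independent (b ` J)"
  proof (rule pairwise_orthogonal_independent)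
    show "pairwise orthogonal (b ` J)"
      using assms by (auto simp: pairwise_def orthogonal_def orthonormal_on_def)
    show "0 \<notin> b ` J"
    proof
      assume "0 \<in> b ` J"
      then obtain i where "i \<in> J" "b i = 0" by (metis imageE)
      then show False using assms unfolding orthonormal_on_def by (metis inner_zero_left zero_neq_one)
    qed
  qed
  then show ?thesis
    using orthonormal_on_inj_on[OF assms] by (simp add: dim_eq_card_independent card_image dim_span)
qed

text \<open>An orthonormal basis of \<open>U\<close> together with one of its orthogonal complement
  inside \<open>W\<close>; the first is indexed by \<open>K\<close>, the second by
  \<open>J - K\<close>.\<close>

lemma orthonormal_frame_exists:
  fixes U W :: "'a::euclidean_space set" and J K :: "'i set"
  assumes U: "subspace U" and W: "subspace W" and UW: "U \<subseteq> W"
    and KJ: "K \<subseteq> J" "finite J" and K: "dim U = card K" and J: "dim W = card J"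
  obtains b where "orthonormal_on J b" "span (b ` K) = U" "span (b ` J) = W"
proof -
  let ?V = "{y \<in> W. \<forall>x\<in>U. orthogonal x y}"
  have V: "subspace ?V"
    using W by (auto simp: subspace_def orthogonal_clauses)
  have dimV: "dim ?V + dim U = dim W"
    using dim_subspace_orthogonal_to_vectors[OF U W UW] .
  obtain B1 where B1: "B1 \<subseteq> U" "pairwise orthogonal B1" "\<And>x. x \<in> B1 \<Longrightarrow> norm x = 1"
     "independent B1" "card B1 = dim U" "span B1 = U"
    by (rule orthonormal_basis_subspace[OF U], rule that; (assumption | simp))
  obtain B2 where B2: "B2 \<subseteq> ?V" "pairwise orthogonal B2" "\<And>x. x \<in> B2 \<Longrightarrow> norm x = 1"
     "independent B2" "card B2 = dim ?V" "span B2 = ?V"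
    by (rule orthonormal_basis_subspace[OF V], rule that; (assumption | simp))
  have fin: "finite B1" "finite B2" "finite K" "finite (J - K)"
    using independent_imp_finite[OF B1(4)] independent_imp_finite[OF B2(4)] KJ finite_subset[OF KJ] by auto
  obtain f where f: "bij_betw f K B1"
    using finite_same_card_bij[OF fin(3,1)] B1(5) K by auto
  have "card (J - K) = card B2"
    using B2(5) dimV K J KJ by (simp add: card_Diff_subset[OF fin(3)])
  then obtain g where g: "bij_betw g (J - K) B2"
    using finite_same_card_bij[OF fin(4,2)] by auto
  define b where "b i = (if i \<in> K then f i else g i)" for i
  have bK: "b ` K = B1" using f by (auto simp: b_def bij_betw_def)
  have bJK: "b ` (J - K) = B2" using g by (auto simp: b_def bij_betw_def)
  have bJ: "b ` J = B1 \<union> B2" using bK bJK KJ by blast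
  have cross: "x \<bullet> y = 0" if "x \<in> B1" "y \<in> B2" for x y
    using that B1(1) B2(1) unfolding orthogonal_def by blast
  have orth: "orthonormal_on J b"
    unfolding orthonormal_on_def
  proof (intro ballI)
    fix i j assume ij: "i \<in> J" "j \<in> J"
    have n: "b i \<bullet> b i = 1" if "i \<in> J" for i
    proof -
      have "b i \<in> B1 \<union> B2" unfolding bJ[symmetric] using that by (rule imageI)
      then have "b i \<in> B1 \<or> b i \<in> B2" by simp
      then have "norm (b i) = 1" by (elim disjE) (rule B1(3) B2(3), assumption)+
      then show ?thesis by (simp add: norm_eq_1)
    qed
    show "b i \<bullet> b j = (if i = j then 1 else 0)"
    proof (cases "i = j")
      case True then show ?thesis using n[OF ij(1)] by simp
    next
      case False
      consider "i \<in> K" "j \<in> K" | "i \<in> K" "j \<in> J - K" | "i \<in> J - K" "j \<in> K" | "i \<in> J - K" "j \<in> J - K"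
        using ij by auto
      then have "b i \<bullet> b j = 0"
      proof cases
        case 1
        then have "f i \<noteq> f j" "f i \<in> B1" "f j \<in> B1"
          using f False by (auto simp: bij_betw_def inj_on_def)
        then show ?thesis using 1 B1(2) unfolding b_def pairwise_def orthogonal_def by simp
      next
        case 2
        then show ?thesis using cross bK bJK by blast
      next
        case 3
        then have "b j \<bullet> b i = 0" using cross bK bJK by blast
        then show ?thesis using inner_commute[of "b i" "b j"] by argo
      next
        case 4
        then have "g i \<noteq> g j" "g i \<in> B2" "g j \<in> B2"
          using g False by (auto simp: bij_betw_def inj_on_def)
        then show ?thesis using 4 B2(2) unfolding b_def pairwise_def orthogonal_def by simp
      qed
      then show ?thesis using False by simp
    qed
  qed
  have "span (b ` J) = W"
  proof -
    have "b ` J \<subseteq> W" unfolding bJ using B1(1) B2(1) UW by auto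
    then have "span (b ` J) \<subseteq> W" by (rule span_minimal[OF _ W])
    then show ?thesis
      by (rule subspace_dim_equal[OF subspace_span W]) (simp add: J dim_span_orthonormal[OF orth] del: dim_span)
  qed
  moreover have "span (b ` K) = U" unfolding bK by (rule B1(6))
  ultimately show thesis using that orth by blast
qed

text \<open>Variant for a subspace that may be too small to fill \<open>K\<close>, as happens for
  the span of dependent vectors.\<close>

lemma orthonormal_frame_superset:
  fixes U W :: "'a::euclidean_space set" and J K :: "'i set"
  assumes U: "subspace U" and W: "subspace W" and UW: "U \<subseteq> W"
    and KJ: "K \<subseteq> J" "finite J" and K: "dim U \<le> card K" and J: "dim W = card J"
  obtains b where "orthonormal_on J b" "U \<subseteq> span (b ` K)" "span (b ` J) = W"
proof -
  obtain K' where "K' \<subseteq> K" "card K' = dim U"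
    using K obtain_subset_with_card_n by metis
  moreover then obtain b where "orthonormal_on J b" "span (b ` K') = U" "span (b ` J) = W"
    using orthonormal_frame_exists[OF U W UW _ KJ(2) _ J, of K'] KJ by (metis order_trans)
  ultimately show thesis using that[of b] span_mono[of "b ` K'" "b ` K"] by auto
qed

lemma dim_image_le_card:
  fixes Y :: "'i \<Rightarrow> 'a::euclidean_space"
  assumes "finite K" shows "dim (span (Y ` K)) \<le> card K"
  using dim_le_card'[of "Y ` K"] card_image_le[OF assms, of Y] assms by (simp add: dim_span)

lemma orthonormal_on_subset: "orthonormal_on J b \<Longrightarrow> K \<subseteq> J \<Longrightarrow> orthonormal_on K b"
  unfolding orthonormal_on_def by blast

lemma ex_frame_coords:
  fixes Y :: "'n::finite \<Rightarrow> real^'n"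
  obtains b where "orthonormal_on UNIV b" "\<And>j. j \<in> K \<Longrightarrow> Y j \<in> span (b ` K)"
proof -
  have dimU: "dim (UNIV :: (real^'n) set) = card (UNIV :: 'n set)" by simp
  have dimY: "dim (span (Y ` K)) \<le> card K" by (rule dim_image_le_card) simp
  obtain b where b: "orthonormal_on (UNIV::'n set) b" "span (Y ` K) \<subseteq> span (b ` K)"
    using orthonormal_frame_superset[OF subspace_span subspace_UNIV subset_UNIV subset_UNIV finite dimY dimU] .
  have "Y j \<in> span (b ` K)" if "j \<in> K" for j
    using that b(2) span_base[of "Y j" "Y ` K"] by blast
  with b(1) show thesis by (rule that)
qed

lemma det_gram_nonneg: "0 \<le> det (gram K (Y :: 'n::finite \<Rightarrow> real^'n))"
proof -
  obtain b where b: "orthonormal_on UNIV b" "\<And>j. j \<in> K \<Longrightarrow> Y j \<in> span (b ` K)"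
    using ex_frame_coords[of K Y] by blast
  have "orthonormal_on K b" using b(1) by (rule orthonormal_on_subset) simp
  then show ?thesis using gram_frame_coords[of K b Y] b(2) by (simp add: det_mul)
qed

lemma gram_vol_nonneg[simp]: "0 \<le> gram_vol K (Y :: 'n::finite \<Rightarrow> real^'n)"
  by (simp add: gram_vol_def det_gram_nonneg)

text \<open>Volume is height times base. Removing from \<open>Y i\<close> its component in the span
  of the others is a column operation of determinant \<open>1\<close>; afterwards row
  \<open>i\<close> of the Gram matrix is \<open>(norm v)\<^sup>2\<close> times a unit row.\<close>

lemma gram_vol_insert:
  fixes Y :: "'n::finite \<Rightarrow> 'a::real_inner"
  assumes i: "i \<notin> K" and u: "Y i - v \<in> span (Y ` K)" and v: "\<And>j. j \<in> K \<Longrightarrow> v \<bullet> Y j = 0"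
  shows "gram_vol (insert i K) Y = norm v * gram_vol K Y"
proof -
  have "\<exists>c. Y i - v = (\<Sum>j\<in>K. c j *\<^sub>R Y j)"
    using in_span_image_sum[OF u finite] .
  then obtain c where c: "Y i - v = (\<Sum>j\<in>K. c j *\<^sub>R Y j)" ..
  let ?L = "insert i K"
  \<comment> \<open>Column \<open>i\<close> of \<open>M\<close> subtracts the combination with
    coefficients \<open>c\<close>; the other columns are those of the identity.\<close>
  define M :: "real^'n^'n" where "M = (\<chi> a j. if a = j then 1 else if j = i \<and> a \<in> K then - c a else 0)"
  have blockM: "block ?L M" using i by (auto simp: block_def M_def)
  have detM: "det M = 1"
  proof -
    \<comment> \<open>The determinant rule used below adds multiples of rows to a row, hence the
      transpose.\<close>
    have eq: "transpose M = (\<chi> k. if k = i then row i (mat 1) + (\<Sum>a\<in>K. (- c a) *s row a (mat 1)) else row k (mat 1))"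
    proof (unfold vec_eq_iff, intro allI)
      fix k j
      have "(\<Sum>a\<in>K. (- c a) * (if a = j then 1 else 0)) = (if j \<in> K then - c j else 0)"
        by (simp add: if_distrib cong: if_cong)
      then show "transpose M $ k $ j = (\<chi> k. if k = i then row i (mat 1) + (\<Sum>a\<in>K. (- c a) *s row a (mat 1)) else row k (mat 1)) $ k $ j"
        using i by (auto simp: transpose_def M_def row_def mat_def)
    qed
    have "(\<Sum>a\<in>K. (- c a) *s row a (mat 1 :: real^'n^'n)) \<in> vec.span {row j (mat 1) |j. j \<noteq> i}"
      using i by (intro vec.span_sum vec.span_scale vec.span_base) auto
    from det_row_span[OF this] have "det (transpose M) = 1" unfolding eq by simp
    then show ?thesis by (simp add: det_transpose)
  qed
  have actM: "act ?L M Y j = (Y(i := v)) j" if "j \<in> ?L" for j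
  proof (cases "j = i")
    case True
    have "(\<Sum>a\<in>K. M $ a $ i *\<^sub>R Y a) = (\<Sum>a\<in>K. - (c a *\<^sub>R Y a))"
      using i by (intro sum.cong) (auto simp: M_def)
    then have "act ?L M Y i = Y i - (\<Sum>j\<in>K. c j *\<^sub>R Y j)"
      using i by (simp add: act_def M_def sum_negf)
    then show ?thesis using True c by (simp add: algebra_simps)
  next
    case False
    have "(\<Sum>a\<in>?L. M $ a $ j *\<^sub>R Y a) = (\<Sum>a\<in>?L. if a = j then Y a else 0)"
      using False by (intro sum.cong) (auto simp: M_def)
    then show ?thesis using that False by (simp add: act_def)
  qed
  have "gram_vol ?L Y = gram_vol ?L (act ?L M Y)"
    by (simp add: gram_vol_act[OF blockM] detM)
  also have "\<dots> = gram_vol ?L (Y(i := v))"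
    by (intro gram_vol_cong actM)
  also have "gram ?L (Y(i := v)) = (\<chi> r. if r = i then (norm v)\<^sup>2 *s gram K Y $ r else gram K Y $ r)"
    using i v by (auto simp: vec_eq_iff gram_def power2_norm_eq_inner inner_commute)
  then have "det (gram ?L (Y(i := v))) = (norm v)\<^sup>2 * det (gram K Y)"
    using det_row_mul[of i "(norm v)\<^sup>2" "\<lambda>r. gram K Y $ r" "\<lambda>r. gram K Y $ r"] by simp
  then have "gram_vol ?L (Y(i := v)) = norm v * gram_vol K Y"
    by (simp add: gram_vol_def real_sqrt_mult)
  finally show ?thesis .
qed

lemma borel_measurable_det[measurable (raw)]:
  fixes f :: "'a \<Rightarrow> real^'n^'n"
  assumes "\<And>i j. (\<lambda>x. f x $ i $ j) \<in> borel_measurable M"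
  shows "(\<lambda>x. det (f x)) \<in> borel_measurable M"
  unfolding det_def using assms by measurable

lemma measurable_gram_vol[measurable]:
  fixes K :: "'n::finite set" and N :: "'a::euclidean_space measure"
  assumes [measurable_cong]: "sets N = sets borel"
  shows "gram_vol K \<in> borel_measurable (Pi\<^sub>M K (\<lambda>_. N))"
proof -
  have "(\<lambda>Y. gram K Y $ i $ j) \<in> borel_measurable (Pi\<^sub>M K (\<lambda>_. N))" for i j
    by (cases "i \<in> K \<and> j \<in> K") (auto simp: gram_def)
  then show ?thesis unfolding gram_vol_def[abs_def] by measurable
qed

section \<open>Moments of Gram determinants\<close>

text \<open>Layer cake form of the Gaussian: with \<open>a = (norm x)\<^sup>2\<close> it becomes a
  mixture of indicators of balls.\<close>

lemma nn_integral_exp_neg_atLeast: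
  "(\<integral>\<^sup>+t. ennreal (exp (- t)) * (if a \<le> t then 1 else 0) \<partial>lborel) = ennreal (exp (- a))"
proof -
  have "((\<lambda>t::real. - exp (- t)) \<longlongrightarrow> 0) at_top"
    by real_asymp
  then have "(\<integral>\<^sup>+t. ennreal (exp (- t)) * indicator {a..} t \<partial>lborel) = ennreal (0 - - exp (- a))"
    by (intro nn_integral_FTC_atLeast) (auto intro!: derivative_eq_intros)
  moreover have "indicator {a..} t = (if a \<le> t then 1 else 0 :: ennreal)" for t
    by (simp add: indicator_def)
  ultimately show ?thesis by simp
qed

text \<open>Exchanges the ball with the Gaussian for a homogeneous integrand. The Gaussian is a
  mixture of balls of radius \<open>sqrt t\<close>; scaling gives the integral over such a ball as
  \<open>t powr ((real m + p) / 2)\<close> times the one over the unit ball, and integrating over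
  \<open>t\<close> produces a Gamma function. The Gaussian is wanted because it factors over
  orthogonal subspaces.\<close>

lemma (in homogeneous_measure) nn_integral_gaussian_homogeneous:
  fixes p :: real
  assumes h[measurable]: "h \<in> borel_measurable borel"
    and hom: "\<And>c x. 0 < c \<Longrightarrow> h (c *\<^sub>R x) = ennreal (c powr p) * h x"
    and p: "real m + p > -2"
  shows "(\<integral>\<^sup>+x. h x * ennreal (exp (- (norm x)\<^sup>2)) \<partial>N)
       = ennreal (Gamma ((real m + p) / 2 + 1)) * (\<integral>\<^sup>+x. h x * indicator (cball 0 1) x \<partial>N)"
proof -
  let ?I = "\<integral>\<^sup>+x. h x * indicator (cball 0 1) x \<partial>N"
  interpret P: pair_sigma_finite N "lborel :: real measure" by standard
  have "0 < x / 2 + 1" if "- 2 < x" for x :: real using that by linarith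
  from this[OF p] have pos: "0 < (real m + p) / 2 + 1" .
  have [measurable]: "cball (0::'a) 1 \<in> sets borel" by simp
  have ball: "(\<integral>\<^sup>+x. h x * (if (norm x)\<^sup>2 \<le> t then 1 else 0) \<partial>N) = ennreal (t powr ((real m + p) / 2)) * ?I" if "0 < t" for t :: real
  proof -
    define c where "c = sqrt t"
    have c: "0 < c" "c\<^sup>2 = t" using that by (auto simp: c_def)
    let ?g = "\<lambda>x. h x * (if (norm x)\<^sup>2 \<le> t then 1 else 0)"
    have meas: "?g \<in> borel_measurable borel"
      by measurable
    have eq: "?g (c *\<^sub>R x) = ennreal (c powr p) * (h x * indicator (cball 0 1) x)" for x
    proof -
      have "c\<^sup>2 * (norm x)\<^sup>2 \<le> c\<^sup>2 \<longleftrightarrow> norm x \<le> 1"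
        using c(1) by (simp add: abs_square_le_1)
      then show ?thesis
        using hom[OF c(1), of x] c by (auto simp: indicator_def power_mult_distrib mult_ac)
    qed
    have "ennreal (c powr p) * ?I = (\<integral>\<^sup>+x. ennreal (c powr p) * (h x * indicator (cball 0 1) x) \<partial>N)"
      by (rule nn_integral_cmult[symmetric]) measurable
    also have "\<dots> = (\<integral>\<^sup>+x. ?g (c *\<^sub>R x) \<partial>N)"
      by (intro nn_integral_cong eq[symmetric])
    also have "\<dots> = ennreal (1 / \<bar>c\<bar> ^ m) * (\<integral>\<^sup>+x. ?g x \<partial>N)"
      using c by (intro scale meas) auto
    finally have "ennreal (c ^ m) * (ennreal (c powr p) * ?I) = ennreal (c ^ m) * (ennreal (1 / \<bar>c\<bar> ^ m) * (\<integral>\<^sup>+x. ?g x \<partial>N))"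
      by simp
    then have "ennreal (c ^ m * c powr p) * ?I = (\<integral>\<^sup>+x. ?g x \<partial>N)"
      using c by (simp add: mult.assoc[symmetric] ennreal_mult[symmetric])
    moreover have "c ^ m * c powr p = t powr ((real m + p) / 2)"
    proof -
      have ct: "c = t powr (1 / 2)" using that by (simp add: c_def powr_half_sqrt)
      have "c ^ m * c powr p = c powr (real m + p)"
        by (simp only: powr_realpow[OF c(1), symmetric] powr_add)
      then show ?thesis by (simp add: ct powr_powr)
    qed
    ultimately show ?thesis by simp
  qed
  have "(\<integral>\<^sup>+x. h x * ennreal (exp (- (norm x)\<^sup>2)) \<partial>N)
      = (\<integral>\<^sup>+x. \<integral>\<^sup>+t. h x * (ennreal (exp (- t)) * (if (norm x)\<^sup>2 \<le> t then 1 else 0)) \<partial>lborel \<partial>N)"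
    by (subst nn_integral_cmult) (auto simp: nn_integral_exp_neg_atLeast)
  also have "\<dots> = (\<integral>\<^sup>+t. \<integral>\<^sup>+x. h x * (ennreal (exp (- t)) * (if (norm x)\<^sup>2 \<le> t then 1 else 0)) \<partial>N \<partial>lborel)"
    by (rule P.Fubini'[symmetric]) measurable
  also have "\<dots> = (\<integral>\<^sup>+t. ?I * ennreal (indicator {0..} t * t powr ((real m + p) / 2) / exp t) \<partial>lborel)"
  proof (rule nn_integral_cong_AE, rule AE_mp[OF AE_lborel_singleton[of "0::real"]], rule AE_I2, rule impI)
    fix t :: real assume "t \<noteq> 0"
    show "(\<integral>\<^sup>+x. h x * (ennreal (exp (- t)) * (if (norm x)\<^sup>2 \<le> t then 1 else 0)) \<partial>N) = ?I * ennreal (indicator {0..} t * t powr ((real m + p) / 2) / exp t)"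
    proof (cases "t < 0")
      case True
      then have "\<not> (norm x)\<^sup>2 \<le> t" for x :: 'a
        using zero_le_power2[of "norm x"] by linarith
      then show ?thesis using True by simp
    next
      case False
      then have t: "0 < t" using \<open>t \<noteq> 0\<close> by simp
      have "(\<integral>\<^sup>+x. h x * (ennreal (exp (- t)) * (if (norm x)\<^sup>2 \<le> t then 1 else 0)) \<partial>N)
          = ennreal (exp (- t)) * (\<integral>\<^sup>+x. h x * (if (norm x)\<^sup>2 \<le> t then 1 else 0) \<partial>N)"
        by (subst nn_integral_cmult[symmetric]) (auto simp: mult_ac)
      also have "\<dots> = ?I * (ennreal (exp (- t)) * ennreal (t powr ((real m + p) / 2)))"
        by (simp add: ball[OF t] mult_ac)
      also have "ennreal (exp (- t)) * ennreal (t powr ((real m + p) / 2)) = ennreal (indicator {0..} t * t powr ((real m + p) / 2) / exp t)"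
        using t by (simp add: ennreal_mult[symmetric] exp_minus field_simps)
      finally show ?thesis .
    qed
  qed
  also have "\<dots> = ?I * (\<integral>\<^sup>+t. ennreal (indicator {0..} t * t powr ((real m + p) / 2 + 1 - 1) / exp t) \<partial>lborel)"
    by (subst nn_integral_cmult) auto
  also have "(\<integral>\<^sup>+t. ennreal (indicator {0..} t * t powr ((real m + p) / 2 + 1 - 1) / exp t) \<partial>lborel) = ennreal (Gamma ((real m + p) / 2 + 1))"
    by (rule Gamma_conv_nn_integral_real[symmetric]) (rule pos)
  finally show ?thesis by (simp add: mult.commute)
qed

text \<open>Radial integration without polar coordinates: the law of the norm in the unit ball has
  the same tails as the density \<open>real n * \<kappa> * r ^ (n - 1)\<close> on
  \<open>{0..1}\<close>, so a function of the norm can be integrated over the line.\<close>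

lemma nn_integral_frame_measure_cball_norm_powr:
  fixes J :: "'n::finite set" and b :: "'n \<Rightarrow> 'a::euclidean_space" and p :: real
  assumes b: "orthonormal_on J b" and m: "card J > 0" and p: "real (card J) + p > 0"
  shows "(\<integral>\<^sup>+x. ennreal (norm x powr p) * indicator (cball 0 1) x \<partial>frame_measure J b)
     = ennreal (real (card J) * unit_ball_vol (card J) / (real (card J) + p))"
proof -
  define n where "n = card J"
  define \<kappa> where "\<kappa> = unit_ball_vol (real n)"
  have \<kappa>: "0 < \<kappa>" by (simp add: \<kappa>_def)
  let ?N = "frame_measure J b"
  interpret homogeneous_measure ?N "span (b ` J)" "card J" by (rule homogeneous_frame_measure[OF b])
  let ?M1 = "distr (density ?N (indicator (cball 0 1))) borel norm"
  let ?M2 = "density lborel (\<lambda>r. ennreal (real n * \<kappa> * r ^ (n - 1)) * indicator {0..1} r)"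
  have N_ball: "emeasure ?N (cball 0 r) = ennreal (\<kappa> * r ^ n)" if "0 \<le> r" for r
  proof (cases "r = 0")
    case False
    then show ?thesis using emeasure_frame_measure_cball[OF b, of r] that by (simp add: \<kappa>_def n_def)
  next
    case True
    have "emeasure ?N (cball 0 0) \<le> ennreal (\<kappa> * e ^ n)" if "0 < e" for e
      using emeasure_mono[of "cball 0 0 :: 'a set" "cball 0 e" ?N] emeasure_frame_measure_cball[OF b that] that by (simp add: \<kappa>_def n_def)
    then have "emeasure ?N (cball 0 0) \<le> ennreal e" if "0 < e" for e
    proof -
      \<comment> \<open>The radius whose ball has measure \<open>e\<close>; letting \<open>e\<close>
        shrink shows that the origin is a null set.\<close>
      have pos: "0 < root n (e / \<kappa>)" using m \<kappa> that by (simp add: n_def)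
      have "\<kappa> * root n (e / \<kappa>) ^ n = e" using m \<kappa> that by (simp add: n_def)
      then show ?thesis using \<open>\<And>e. 0 < e \<Longrightarrow> emeasure ?N (cball 0 0) \<le> ennreal (\<kappa> * e ^ n)\<close>[OF pos] by simp
    qed
    note le = this
    have "emeasure ?N (cball 0 0) \<le> 0"
      by (rule ennreal_le_epsilon) (use le in simp)
    then show ?thesis using True m by (simp add: n_def zero_power)
  qed
  have N_shell: "emeasure ?N {x. r < norm x \<and> norm x \<le> 1} = ennreal (\<kappa> - \<kappa> * r ^ n)" if "0 \<le> r" "r \<le> 1" for r
  proof -
    have "{x. r < norm x \<and> norm x \<le> 1} = cball 0 1 - cball (0::'a) r" by (auto simp: dist_norm)
    moreover have "emeasure ?N (cball 0 1 - cball 0 r) = emeasure ?N (cball 0 1) - emeasure ?N (cball 0 r)"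
      using that N_ball[of r] by (intro emeasure_Diff) auto
    ultimately show ?thesis using that N_ball[of r] N_ball[of 1] \<kappa> by (simp add: ennreal_minus)
  qed
  have M1: "emeasure ?M1 {r<..} = emeasure ?N {x. r < norm x \<and> norm x \<le> 1}" for r
  proof -
    have [measurable]: "{x::'a. r < norm x} \<in> sets borel" "cball (0::'a) 1 \<in> sets borel"
      by (auto intro!: borel_open open_Collect_less continuous_intros)
    have "emeasure ?M1 {r<..} = (\<integral>\<^sup>+x. indicator (cball 0 1) x * indicator {x. r < norm x} x \<partial>?N)"
      by (subst emeasure_distr) (auto simp: vimage_def intro!: emeasure_density)
    also have "\<dots> = (\<integral>\<^sup>+x. indicator {x. r < norm x \<and> norm x \<le> 1} x \<partial>?N)"
      by (intro nn_integral_cong) (auto simp: indicator_def)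
    finally show ?thesis by simp
  qed
  have M2: "emeasure ?M2 {r<..} = ennreal (\<kappa> - \<kappa> * r ^ n)" if "0 \<le> r" "r \<le> 1" for r
  proof -
    have "emeasure ?M2 {r<..} = (\<integral>\<^sup>+s. ennreal (real n * \<kappa> * s ^ (n - 1)) * indicator {0..1} s * indicator {r<..} s \<partial>lborel)"
      by (rule emeasure_density) measurable
    also have "\<dots> = (\<integral>\<^sup>+s. ennreal (real n * \<kappa> * s ^ (n - 1)) * indicator {r..1} s \<partial>lborel)"
    proof (rule nn_integral_cong_AE, rule AE_mp[OF AE_lborel_singleton[of r]], rule AE_I2, rule impI)
      fix s assume "s \<noteq> r"
      then show "ennreal (real n * \<kappa> * s ^ (n - 1)) * indicator {0..1} s * indicator {r<..} s = ennreal (real n * \<kappa> * s ^ (n - 1)) * indicator {r..1} s"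
        using that by (cases "r < s"; cases "s \<le> 1"; simp)
    qed
    also have "\<dots> = ennreal (\<kappa> * 1 ^ n - \<kappa> * r ^ n)"
    proof (rule nn_integral_FTC_Icc)
      fix s :: real assume "s \<in> {r..1}"
      then show "0 \<le> real n * \<kappa> * s ^ (n - 1)" using that \<kappa> by simp
      show "((\<lambda>s. \<kappa> * s ^ n) has_real_derivative real n * \<kappa> * s ^ (n - 1)) (at s)"
        using DERIV_cmult[OF DERIV_pow[of n s], of \<kappa>] by (simp add: mult_ac)
    qed (use that in simp_all)
    finally show ?thesis unfolding power_one mult_1_right .
  qed
  \<comment> \<open>Tails determine a measure on the line. The shell formula covers radii in
    \<open>{0..1}\<close>; below this range the tail is the whole ball, above it the tail is
    empty.\<close>
  have "?M1 = ?M2"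
  proof (rule measure_eqI_lessThan)
    fix r :: real
    consider "r < 0" | "0 \<le> r" "r \<le> 1" | "1 < r" by linarith
    then have "emeasure ?M1 {r<..} = emeasure ?M2 {r<..} \<and> emeasure ?M1 {r<..} < \<infinity>"
    proof cases
      case 1
      have "{x::'a. r < norm x \<and> norm x \<le> 1} = cball 0 1"
        using 1 by (auto simp: dist_norm intro: less_le_trans)
      moreover have "emeasure ?M2 {r<..} = emeasure ?M2 {0<..}"
      proof -
        have "emeasure ?M2 {r<..} = (\<integral>\<^sup>+s. ennreal (real n * \<kappa> * s ^ (n - 1)) * indicator {0..1} s * indicator {r<..} s \<partial>lborel)"
          by (rule emeasure_density) measurable
        also have "\<dots> = (\<integral>\<^sup>+s. ennreal (real n * \<kappa> * s ^ (n - 1)) * indicator {0..1} s * indicator {0<..} s \<partial>lborel)"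
        proof (rule nn_integral_cong_AE, rule AE_mp[OF AE_lborel_singleton[of "0::real"]], rule AE_I2, rule impI)
          fix s :: real assume "s \<noteq> 0"
          then show "ennreal (real n * \<kappa> * s ^ (n - 1)) * indicator {0..1} s * indicator {r<..} s = ennreal (real n * \<kappa> * s ^ (n - 1)) * indicator {0..1} s * indicator {0<..} s"
            using 1 by (cases "0 < s"; simp)
        qed
        also have "\<dots> = emeasure ?M2 {0<..}" by (rule emeasure_density[symmetric]) measurable
        finally show ?thesis .
      qed
      ultimately show ?thesis using M1[of r] M2[of 0] N_ball[of 1] m by (simp add: n_def zero_power)
    next
      case 2
      then show ?thesis using M1[of r] M2[of r] N_shell[of r] by simp
    next
      case 3
      have empty: "{x::'a. r < norm x \<and> norm x \<le> 1} = {}" using 3 by auto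
      have "emeasure ?M1 {r<..} = 0" unfolding M1 empty by simp
      moreover have "emeasure ?M2 {r<..} = 0"
        using 3 by (subst emeasure_density) (auto simp: indicator_def nn_integral_0_iff_AE)
      ultimately show ?thesis by simp
    qed
    then show "emeasure ?M1 {r<..} = emeasure ?M2 {r<..}" "emeasure ?M1 {r<..} < \<infinity>" by auto
  qed auto
  have [measurable]: "cball (0::'a) 1 \<in> sets borel" by simp
  have "(\<integral>\<^sup>+x. ennreal (norm x powr p) * indicator (cball 0 1) x \<partial>?N)
      = (\<integral>\<^sup>+x. indicator (cball 0 1) x * ennreal (norm x powr p) \<partial>?N)"
    by (simp add: mult.commute)
  also have "\<dots> = (\<integral>\<^sup>+x. ennreal (norm x powr p) \<partial>density ?N (indicator (cball 0 1)))"
    by (rule nn_integral_density[symmetric]) measurable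
  also have "\<dots> = (\<integral>\<^sup>+r. ennreal (r powr p) \<partial>?M1)"
    by (rule nn_integral_distr[symmetric]) measurable
  also have "\<dots> = (\<integral>\<^sup>+r. ennreal (r powr p) \<partial>?M2)"
    using \<open>?M1 = ?M2\<close> by simp
  also have "\<dots> = (\<integral>\<^sup>+r. ennreal (real n * \<kappa> * r ^ (n - 1)) * indicator {0..1} r * ennreal (r powr p) \<partial>lborel)"
    by (rule nn_integral_density) measurable
  also have "\<dots> = (\<integral>\<^sup>+r. ennreal (real n * \<kappa>) * ennreal (r powr (real n + p - 1) * indicator {0..1} r) \<partial>lborel)"
  proof (rule nn_integral_cong_AE, rule AE_mp[OF AE_lborel_singleton[of "0::real"]], rule AE_I2, rule impI)
    fix r :: real assume "r \<noteq> 0"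
    have "r ^ (n - 1) * r powr p = r powr (real n + p - 1)" if "0 < r"
    proof -
      have "r ^ (n - 1) * r powr p = r powr (real (n - 1) + p)"
        by (simp only: powr_realpow[OF that, symmetric] powr_add)
      also have "real (n - 1) + p = real n + p - 1"
        using m unfolding n_def by linarith
      finally show ?thesis .
    qed
    then show "ennreal (real n * \<kappa> * r ^ (n - 1)) * indicator {0..1} r * ennreal (r powr p) = ennreal (real n * \<kappa>) * ennreal (r powr (real n + p - 1) * indicator {0..1} r)"
      using \<open>r \<noteq> 0\<close> \<kappa> by (cases "0 < r \<and> r \<le> 1") (auto simp: ennreal_mult[symmetric] indicator_def mult.assoc)
  qed
  also have "\<dots> = ennreal (real n * \<kappa>) * (\<integral>\<^sup>+r. ennreal (r powr (real n + p - 1) * indicator {0..1} r) \<partial>lborel)"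
    by (rule nn_integral_cmult) measurable
  also have "(\<integral>\<^sup>+r. ennreal (r powr (real n + p - 1) * indicator {0..1} r) \<partial>lborel) = ennreal (1 / (real n + p))"
  proof -
    have "((\<lambda>r. r powr (real n + p - 1)) has_integral (1 powr (real n + p - 1 + 1) / (real n + p - 1 + 1))) {0..1}"
      using p by (intro has_integral_powr_from_0) (auto simp: n_def)
    then have "((\<lambda>r. r powr (real n + p - 1)) has_integral (1 / (real n + p))) {0..1}" by simp
    from nn_integral_has_integral_lebesgue[OF _ this] show ?thesis
      by (simp add: ennreal_indicator ennreal_mult' mult.commute)
  qed
  finally show ?thesis using \<kappa> p by (simp add: ennreal_mult[symmetric] n_def \<kappa>_def)
qed

text \<open>Degree \<open>0\<close>: the Gamma factor is exactly the denominator in the definition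
  of \<open>unit_ball_vol\<close>.\<close>

lemma nn_integral_gaussian_frame_measure:
  assumes "orthonormal_on J (b :: 'n::finite \<Rightarrow> 'a::euclidean_space)"
  shows "(\<integral>\<^sup>+x. ennreal (exp (- (norm x)\<^sup>2)) \<partial>frame_measure J b) = ennreal (pi powr (card J / 2))"
proof -
  interpret homogeneous_measure "frame_measure J b" "span (b ` J)" "card J" by (rule homogeneous_frame_measure[OF assms])
  define G where "G = Gamma (real (card J) / 2 + 1)"
  have G: "G > 0" unfolding G_def by (intro Gamma_real_pos) auto
  have "(\<integral>\<^sup>+x. ennreal (exp (- (norm x)\<^sup>2)) \<partial>frame_measure J b) = ennreal G * ennreal (pi powr (card J / 2) / G)"
    using nn_integral_gaussian_homogeneous[of "\<lambda>_. 1" 0] emeasure_frame_measure_cball[OF assms, of 1]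
    by (simp add: unit_ball_vol_def G_def)
  also have "\<dots> = ennreal (pi powr (card J / 2))"
    using G by (subst ennreal_mult[symmetric]) auto
  finally show ?thesis .
qed

lemma nn_integral_gaussian_norm_powr:
  fixes J :: "'n::finite set" and b :: "'n \<Rightarrow> 'a::euclidean_space" and p :: real
  assumes b: "orthonormal_on J b" and m: "card J > 0" and p: "real (card J) + p > 0"
  shows "(\<integral>\<^sup>+x. ennreal (norm x powr p) * ennreal (exp (- (norm x)\<^sup>2)) \<partial>frame_measure J b)
     = ennreal (Gamma ((real (card J) + p) / 2) * omega (card J) / 2)"
proof -
  interpret homogeneous_measure "frame_measure J b" "span (b ` J)" "card J" by (rule homogeneous_frame_measure[OF b])
  have "(\<integral>\<^sup>+x. ennreal (norm x powr p) * ennreal (exp (- (norm x)\<^sup>2)) \<partial>frame_measure J b)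
    = ennreal (Gamma ((real (card J) + p) / 2 + 1)) * ennreal (real (card J) * unit_ball_vol (card J) / (real (card J) + p))"
    unfolding nn_integral_frame_measure_cball_norm_powr[OF assms, symmetric]
    using p by (intro nn_integral_gaussian_homogeneous) (auto simp: powr_mult ennreal_mult)
  also have "Gamma ((real (card J) + p) / 2 + 1) = (real (card J) + p) / 2 * Gamma ((real (card J) + p) / 2)"
    using p by (intro Gamma_plus1) (auto simp: nonpos_Ints_def)
  also have "ennreal ((real (card J) + p) / 2 * Gamma ((real (card J) + p) / 2)) * ennreal (real (card J) * unit_ball_vol (card J) / (real (card J) + p))
     = ennreal (Gamma ((real (card J) + p) / 2) * omega (card J) / 2)"
  proof -
    have "(s / 2 * g) * (x / s) = g * x / 2" if "s \<noteq> 0" for s g x :: real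
      using that by simp
    from this[of "real (card J) + p"] show ?thesis
      using p Gamma_real_pos[of "(real (card J) + p) / 2"]
      by (subst ennreal_mult[symmetric]) (auto simp only: omega_def, auto)
  qed
  finally show ?thesis .
qed


text \<open>The residual is the component along \<open>J - K\<close>, so the Gaussian integral
  splits into the total mass along \<open>K\<close> and a norm moment along
  \<open>J - K\<close>.\<close>

lemma nn_integral_gaussian_frame_residual:
  fixes J K :: "'n::finite set" and b :: "'n \<Rightarrow> 'a::euclidean_space" and p :: real
  assumes b: "orthonormal_on J b" and KJ: "K \<subseteq> J" and m: "card K < card J"
    and p: "real (card J) - real (card K) + p > 0"
  shows "(\<integral>\<^sup>+x. ennreal (norm (x - (\<Sum>i\<in>K. (x \<bullet> b i) *\<^sub>R b i)) powr p) * ennreal (exp (- (norm x)\<^sup>2)) \<partial>frame_measure J b)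
     = ennreal (pi powr (card K / 2) * (Gamma ((real (card J - card K) + p) / 2) * omega (card J - card K) / 2))"
    (is "(\<integral>\<^sup>+x. ?f x \<partial>_) = _")
proof -
  let ?L = "J - K"
  let ?lb = "\<lambda>J. Pi\<^sub>M J (\<lambda>_. lborel :: real measure)"
  have J: "K \<union> ?L = J" "K \<inter> ?L = {}" "finite K" "finite ?L" using KJ by auto
  have cL: "card ?L = card J - card K" using KJ by (simp add: card_Diff_subset)
  have bK: "orthonormal_on K b" and bL: "orthonormal_on ?L b"
    using b KJ by (auto intro: orthonormal_on_subset)
  have split: "(\<Sum>i\<in>J. c i *\<^sub>R b i) = (\<Sum>i\<in>K. c i *\<^sub>R b i) + (\<Sum>i\<in>?L. c i *\<^sub>R b i)" for c
    using KJ by (metis add.commute finite sum.subset_diff)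
  have val: "?f (\<Sum>i\<in>J. c i *\<^sub>R b i) = ennreal (exp (- (norm (\<Sum>i\<in>K. c i *\<^sub>R b i))\<^sup>2)) *
     (ennreal (norm (\<Sum>i\<in>?L. c i *\<^sub>R b i) powr p) * ennreal (exp (- (norm (\<Sum>i\<in>?L. c i *\<^sub>R b i))\<^sup>2)))" for c
  proof -
    have "(\<Sum>i\<in>K. ((\<Sum>i\<in>J. c i *\<^sub>R b i) \<bullet> b i) *\<^sub>R b i) = (\<Sum>i\<in>K. c i *\<^sub>R b i)"
      using inner_orthonormal_sum[OF b finite] KJ by (intro sum.cong) auto
    then have r: "(\<Sum>i\<in>J. c i *\<^sub>R b i) - (\<Sum>i\<in>K. ((\<Sum>i\<in>J. c i *\<^sub>R b i) \<bullet> b i) *\<^sub>R b i) = (\<Sum>i\<in>?L. c i *\<^sub>R b i)"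
      using split by simp
    have "(\<Sum>i\<in>J. (c i)\<^sup>2) = (\<Sum>i\<in>K. (c i)\<^sup>2) + (\<Sum>i\<in>?L. (c i)\<^sup>2)"
      using KJ by (metis add.commute finite sum.subset_diff)
    then have n: "(norm (\<Sum>i\<in>J. c i *\<^sub>R b i))\<^sup>2 = (norm (\<Sum>i\<in>K. c i *\<^sub>R b i))\<^sup>2 + (norm (\<Sum>i\<in>?L. c i *\<^sub>R b i))\<^sup>2"
      by (simp add: norm_orthonormal_sum[OF b] norm_orthonormal_sum[OF bK] norm_orthonormal_sum[OF bL] sum_nonneg)
    have "exp (- (norm (\<Sum>i\<in>J. c i *\<^sub>R b i))\<^sup>2) = exp (- (norm (\<Sum>i\<in>K. c i *\<^sub>R b i))\<^sup>2) * exp (- (norm (\<Sum>i\<in>?L. c i *\<^sub>R b i))\<^sup>2)"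
      unfolding n by (simp add: exp_add[symmetric])
    then show ?thesis unfolding r by (simp only: ennreal_mult[OF exp_ge_zero exp_ge_zero] mult_ac)
  qed
  have [measurable]: "?f \<in> borel_measurable borel" by measurable
  have m: "(\<lambda>c. ?f (\<Sum>i\<in>J. c i *\<^sub>R b i)) \<in> borel_measurable (?lb (K \<union> ?L))"
    unfolding J(1) by measurable
  have "(\<integral>\<^sup>+x. ?f x \<partial>frame_measure J b) = (\<integral>\<^sup>+c. ?f (\<Sum>i\<in>J. c i *\<^sub>R b i) \<partial>?lb (K \<union> ?L))"
    unfolding J(1) by (rule nn_integral_frame_measure) measurable
  also have "\<dots> = (\<integral>\<^sup>+x. \<integral>\<^sup>+y. ?f (\<Sum>i\<in>J. merge K ?L (x, y) i *\<^sub>R b i) \<partial>?lb ?L \<partial>?lb K)"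
    by (rule lborel_real.product_nn_integral_fold[OF J(2-4) m])
  also have "\<dots> = (\<integral>\<^sup>+x. \<integral>\<^sup>+y. ennreal (exp (- (norm (\<Sum>i\<in>K. x i *\<^sub>R b i))\<^sup>2)) *
     (ennreal (norm (\<Sum>i\<in>?L. y i *\<^sub>R b i) powr p) * ennreal (exp (- (norm (\<Sum>i\<in>?L. y i *\<^sub>R b i))\<^sup>2))) \<partial>?lb ?L \<partial>?lb K)"
  proof (intro nn_integral_cong)
    fix x y
    have "(\<Sum>i\<in>K. merge K ?L (x, y) i *\<^sub>R b i) = (\<Sum>i\<in>K. x i *\<^sub>R b i)"
         "(\<Sum>i\<in>?L. merge K ?L (x, y) i *\<^sub>R b i) = (\<Sum>i\<in>?L. y i *\<^sub>R b i)"
      by (auto simp: merge_def intro!: sum.cong)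
    then show "?f (\<Sum>i\<in>J. merge K ?L (x, y) i *\<^sub>R b i) = ennreal (exp (- (norm (\<Sum>i\<in>K. x i *\<^sub>R b i))\<^sup>2)) *
       (ennreal (norm (\<Sum>i\<in>?L. y i *\<^sub>R b i) powr p) * ennreal (exp (- (norm (\<Sum>i\<in>?L. y i *\<^sub>R b i))\<^sup>2)))"
      unfolding val by simp
  qed
  also have "\<dots> = (\<integral>\<^sup>+x. ennreal (exp (- (norm (\<Sum>i\<in>K. x i *\<^sub>R b i))\<^sup>2)) *
     ennreal (Gamma ((real (card ?L) + p) / 2) * omega (card ?L) / 2) \<partial>?lb K)"
  proof (intro nn_integral_cong)
    fix x
    let ?g = "\<lambda>y. ennreal (norm y powr p) * ennreal (exp (- (norm y)\<^sup>2))"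
    have [measurable]: "?g \<in> borel_measurable borel" by measurable
    have "(\<integral>\<^sup>+y. ?g (\<Sum>i\<in>?L. y i *\<^sub>R b i) \<partial>?lb ?L) = (\<integral>\<^sup>+y. ?g y \<partial>frame_measure ?L b)"
      by (rule nn_integral_frame_measure[symmetric]) measurable
    also have "\<dots> = ennreal (Gamma ((real (card ?L) + p) / 2) * omega (card ?L) / 2)"
      using m p assms(3) by (intro nn_integral_gaussian_norm_powr bL) (auto simp: cL of_nat_diff)
    finally show "(\<integral>\<^sup>+y. ennreal (exp (- (norm (\<Sum>i\<in>K. x i *\<^sub>R b i))\<^sup>2)) * ?g (\<Sum>i\<in>?L. y i *\<^sub>R b i) \<partial>?lb ?L)
       = ennreal (exp (- (norm (\<Sum>i\<in>K. x i *\<^sub>R b i))\<^sup>2)) * ennreal (Gamma ((real (card ?L) + p) / 2) * omega (card ?L) / 2)"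
      by (subst nn_integral_cmult) auto
  qed
  also have "\<dots> = (\<integral>\<^sup>+x. ennreal (exp (- (norm (\<Sum>i\<in>K. x i *\<^sub>R b i))\<^sup>2)) \<partial>?lb K) *
     ennreal (Gamma ((real (card ?L) + p) / 2) * omega (card ?L) / 2)"
    by (rule nn_integral_multc) measurable
  also have "(\<integral>\<^sup>+x. ennreal (exp (- (norm (\<Sum>i\<in>K. x i *\<^sub>R b i))\<^sup>2)) \<partial>?lb K) = ennreal (pi powr (card K / 2))"
    using nn_integral_frame_measure[of "\<lambda>x. ennreal (exp (- (norm x)\<^sup>2))" K b]
    unfolding nn_integral_gaussian_frame_measure[OF bK] by simp
  also have "ennreal (pi powr (card K / 2)) * ennreal (Gamma ((real (card ?L) + p) / 2) * omega (card ?L) / 2)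
     = ennreal (pi powr (card K / 2) * (Gamma ((real (card ?L) + p) / 2) * omega (card ?L) / 2))"
    by (rule ennreal_mult'[symmetric]) simp
  finally show ?thesis unfolding cL .
qed

text \<open>The residual is homogeneous, so its Gaussian moment transfers to the ball. The Gamma
  factor and the powers of pi regroup into \<open>unit_ball_vol (real (card J) + p)\<close> and a
  quotient of two values of \<open>omega\<close>.\<close>

lemma nn_integral_cball_frame_residual:
  fixes J K :: "'n::finite set" and b :: "'n \<Rightarrow> 'a::euclidean_space" and p :: real
  assumes b: "orthonormal_on J b" and KJ: "K \<subseteq> J" and m: "card K < card J"
    and p: "real (card J) - real (card K) + p > 0"
  shows "(\<integral>\<^sup>+x. ennreal (norm (x - (\<Sum>i\<in>K. (x \<bullet> b i) *\<^sub>R b i)) powr p) * indicator (cball 0 1) x \<partial>frame_measure J b)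
     = ennreal (unit_ball_vol (real (card J) + p) * (omega (real (card J - card K)) / omega (real (card J - card K) + p)))"
    (is "?I = _")
proof -
  interpret homogeneous_measure "frame_measure J b" "span (b ` J)" "card J" by (rule homogeneous_frame_measure[OF b])
  define q where "q = real (card J - card K)"
  have q: "q = real (card J) - real (card K)" "q > 0" "q + p > 0" using m p by (auto simp: q_def of_nat_diff)
  define G where "G = Gamma ((real (card J) + p) / 2 + 1)"
  define g where "g = Gamma ((q + p) / 2)"
  have "0 < (real (card J) + p) / 2 + 1" using q(1,3) by (simp add: field_simps)
  then have G: "G > 0" unfolding G_def by (rule Gamma_real_pos)
  have g: "g > 0" unfolding g_def using q by (intro Gamma_real_pos) auto
  have "ennreal G * ?I = (\<integral>\<^sup>+x. ennreal (norm (x - (\<Sum>i\<in>K. (x \<bullet> b i) *\<^sub>R b i)) powr p) * ennreal (exp (- (norm x)\<^sup>2)) \<partial>frame_measure J b)"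
    unfolding G_def
  proof (rule nn_integral_gaussian_homogeneous[symmetric])
    fix c :: real and x :: 'a assume "0 < c"
    have "c *\<^sub>R x - (\<Sum>i\<in>K. (c *\<^sub>R x \<bullet> b i) *\<^sub>R b i) = c *\<^sub>R (x - (\<Sum>i\<in>K. (x \<bullet> b i) *\<^sub>R b i))"
      by (simp add: scaleR_diff_right scaleR_sum_right)
    then show "ennreal (norm (c *\<^sub>R x - (\<Sum>i\<in>K. (c *\<^sub>R x \<bullet> b i) *\<^sub>R b i)) powr p)
       = ennreal (c powr p) * ennreal (norm (x - (\<Sum>i\<in>K. (x \<bullet> b i) *\<^sub>R b i)) powr p)"
      using \<open>0 < c\<close> by (simp add: powr_mult ennreal_mult)
  next
    show "- 2 < real (card J) + p" using q by linarith
  qed measurable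
  also have "\<dots> = ennreal (pi powr (card K / 2) * (g * omega q / 2))"
    unfolding g_def q_def by (rule nn_integral_gaussian_frame_residual[OF assms])
  finally have "ennreal (1 / G) * (ennreal G * ?I) = ennreal (1 / G) * ennreal (pi powr (card K / 2) * (g * omega q / 2))" by simp
  then have "?I = ennreal (1 / G * (pi powr (card K / 2) * (g * omega q / 2)))"
    using G g by (simp add: mult.assoc[symmetric] ennreal_mult'[symmetric])
  also have "1 / G * (pi powr (card K / 2) * (g * omega q / 2)) = unit_ball_vol (real (card J) + p) * (omega q / omega (q + p))"
  proof -
    have "Gamma ((q + p) / 2 + 1) = (q + p) / 2 * g"
      unfolding g_def using q by (intro Gamma_plus1) (auto simp: nonpos_Ints_def)
    then have "omega (q + p) = (q + p) * (pi powr ((q + p) / 2) / ((q + p) / 2 * g))"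
      unfolding omega_def unit_ball_vol_def by (simp only:)
    also have "\<dots> = 2 * pi powr ((q + p) / 2) / g"
      using q(3) g by simp
    finally have om: "omega (q + p) = 2 * pi powr ((q + p) / 2) / g" .
    \<comment> \<open>The powers of pi recombine because \<open>card K\<close> and \<open>q\<close>
      add up to \<open>card J\<close>.\<close>
    have "pi powr ((real (card J) + p) / 2) = pi powr (card K / 2) * pi powr ((q + p) / 2)"
      using q(1) by (simp add: powr_add[symmetric] add_divide_distrib[symmetric])
    then show ?thesis
      using g G unfolding om unit_ball_vol_def[of "real (card J) + p"] G_def[symmetric] by (simp add: field_simps)
  qed
  finally show ?thesis unfolding q_def .
qed

text \<open>Dependent vectors fit into a frame with one index \<open>i\<close> to spare, so row
  \<open>i\<close> of their coordinate matrix vanishes.\<close>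

lemma gram_vol_eq_0:
  fixes Y :: "'n::finite \<Rightarrow> real^'n"
  assumes "dim (span (Y ` K)) < card K"
  shows "gram_vol K Y = 0"
proof -
  obtain i where i: "i \<in> K" using assms by (metis all_not_in_conv card.empty not_less_zero)
  have dimU: "dim (UNIV :: (real^'n) set) = card (UNIV :: 'n set)" by simp
  have dimY: "dim (span (Y ` K)) \<le> card (K - {i})" using assms i by simp
  obtain b where b: "orthonormal_on (UNIV::'n set) b" "span (Y ` K) \<subseteq> span (b ` (K - {i}))"
    using orthonormal_frame_superset[OF subspace_span subspace_UNIV subset_UNIV subset_UNIV finite dimY dimU] .
  have bK: "orthonormal_on K b" using b(1) by (rule orthonormal_on_subset) simp
  have Y: "Y j \<in> span (b ` (K - {i}))" if "j \<in> K" for j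
    using that b(2) span_base[of "Y j" "Y ` K"] by blast
  have "Y j \<bullet> b i = 0" if j: "j \<in> K" for j
  proof -
    have bi: "orthonormal_on (K - {i}) b" using b(1) by (rule orthonormal_on_subset) simp
    have "(\<Sum>l\<in>K-{i}. (Y j \<bullet> b l) *\<^sub>R b l) \<bullet> b i = 0"
      using b(1) unfolding inner_sum_left by (intro sum.neutral) (auto simp: orthonormal_on_def)
    then show ?thesis using orthonormal_expansion[OF bi finite Y[OF j]] by simp
  qed
  then have "row i (frame_coords K b Y) = 0"
    using i by (auto simp: row_def frame_coords_def vec_eq_iff)
  then have "det (frame_coords K b Y) = 0" by (rule det_zero_row(2))
  moreover have "Y j \<in> span (b ` K)" if "j \<in> K" for j
    using Y[OF that] span_mono[of "b ` (K - {i})" "b ` K"] by auto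
  ultimately show ?thesis using gram_vol_frame_coords[OF bK, of Y] by simp
qed

text \<open>The factor for \<open>j\<close> is the integral, over one new vector in the ball, of the
  \<open>p\<close>-th power of its distance to the span of \<open>j\<close> independent earlier
  ones.\<close>

definition moment_const :: "real \<Rightarrow> real \<Rightarrow> nat \<Rightarrow> real" where
  "moment_const d p k = (\<Prod>j<k. unit_ball_vol (d + p) * (omega (d - real j) / omega (d - real j + p)))"

lemma moment_const_pos:
  assumes "real k \<le> d" "d - real k + 1 + p > 0"
  shows "moment_const d p k > 0"
  unfolding moment_const_def
proof (intro prod_pos)
  fix j assume "j \<in> {..<k}"
  then have j: "real j + 1 \<le> real k" by simp
  have "d + p > 0 \<or> k = 0 \<or> d + p \<ge> 0" using assms j by linarith
  moreover have "d - real j > 0" "d - real j + p > 0" "d + p > 0" using assms j by linarith+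
  ultimately show "0 < unit_ball_vol (d + p) * (omega (d - real j) / omega (d - real j + p))"
    by (simp add: omega_def)
qed

text \<open>One vector at a time: each new vector multiplies the Gram volume by its distance to the
  span of the old ones, and the moment of this distance depends only on the dimension of that span.
  The bound on \<open>p\<close> is what the last vector needs, whose distance is a norm in
  \<open>card J - card K + 1\<close> dimensions.\<close>

lemma nn_integral_gram_vol_moment:
  fixes J K :: "'n::finite set" and b :: "'n \<Rightarrow> real^'n" and p :: real
  assumes b: "orthonormal_on J b" and "card K \<le> card J" and "real (card J) - real (card K) + 1 + p > 0"
  shows "(\<integral>\<^sup>+Y. (\<Prod>i\<in>K. indicator (cball 0 1) (Y i)) * ennreal (gram_vol K Y powr p) \<partial>Pi\<^sub>M K (\<lambda>_. frame_measure J b))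
    = ennreal (moment_const (card J) p (card K))"
  using finite[of K] assms(2,3)
proof (induction K rule: finite_induct)
  case empty
  interpret homogeneous_measure "frame_measure J b" "span (b ` J)" "card J" by (rule homogeneous_frame_measure[OF b])
  have "gram {} Y = mat 1" for Y :: "'n \<Rightarrow> real^'n" by (auto simp: gram_def mat_def vec_eq_iff)
  then show ?case by (simp add: PiM_empty nn_integral_count_space_finite gram_vol_def moment_const_def)
next
  case (insert i K)
  let ?N = "frame_measure J b"
  interpret homogeneous_measure ?N "span (b ` J)" "card J" by (rule homogeneous_frame_measure[OF b])
  have card: "card (insert i K) = Suc (card K)" using insert.hyps by simp
  have cKJ: "card K < card J" and pK: "real (card J) - real (card K) + p > 0"
    using insert.prems unfolding card by auto
  let ?F = "\<lambda>K Y. (\<Prod>i\<in>K. indicator (cball 0 1) (Y i)) * ennreal (gram_vol K Y powr p)"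
  let ?c = "ennreal (unit_ball_vol (real (card J) + p) * (omega (real (card J - card K)) / omega (real (card J - card K) + p)))"
  have [measurable]: "cball (0::real^'n) 1 \<in> sets borel" by simp
  have F[measurable]: "?F K \<in> borel_measurable (Pi\<^sub>M K (\<lambda>_. ?N))" for K
    by measurable
  have inner: "(\<integral>\<^sup>+y. ?F (insert i K) (Y(i := y)) \<partial>?N) = ?F K Y * ?c"
    if Y: "\<forall>j\<in>K. Y j \<in> span (b ` J)" for Y
  proof -
    let ?U = "span (Y ` K)"
    have UW: "?U \<subseteq> span (b ` J)" using Y by (intro span_minimal) auto
    have dimU: "dim ?U \<le> card K" by (rule dim_image_le_card) simp
    \<comment> \<open>Indices for an orthonormal basis of the span \<open>?U\<close>, whose
      dimension may be less than \<open>card K\<close>.\<close>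
    obtain K0 where K0: "K0 \<subseteq> J" "card K0 = dim ?U"
      using obtain_subset_with_card_n[of "dim ?U" J] dimU cKJ by (metis le_trans less_imp_le)
    obtain b' where b': "orthonormal_on J b'" "span (b' ` K0) = ?U" "span (b' ` J) = span (b ` J)"
      using orthonormal_frame_exists[OF subspace_span subspace_span UW K0(1) finite K0(2)[symmetric] dim_span_orthonormal[OF b]] .
    have bK0: "orthonormal_on K0 b'" using b'(1) K0(1) by (rule orthonormal_on_subset)
    let ?v = "\<lambda>y. y - (\<Sum>l\<in>K0. (y \<bullet> b' l) *\<^sub>R b' l)"
    have gv: "gram_vol (insert i K) (Y(i := y)) = norm (?v y) * gram_vol K Y" for y
    proof -
      have im: "(Y(i := y)) ` K = Y ` K" using insert.hyps by auto
      have "gram_vol (insert i K) (Y(i := y)) = norm (?v y) * gram_vol K (Y(i := y))"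
      proof (rule gram_vol_insert[OF insert.hyps(2)])
        have "(\<Sum>l\<in>K0. (y \<bullet> b' l) *\<^sub>R b' l) \<in> span (b' ` K0)"
          by (intro span_sum span_scale span_base) auto
        then show "(Y(i := y)) i - ?v y \<in> span ((Y(i := y)) ` K)"
          unfolding im b'(2) by simp
        fix j assume j: "j \<in> K"
        then have Yj: "Y j \<in> span (b' ` K0)" unfolding b'(2) by (intro span_base) auto
        have v0: "?v y \<bullet> b' l = 0" if "l \<in> K0" for l
          using inner_orthonormal_sum[OF bK0 finite that] by (simp add: inner_diff_left)
        have "?v y \<bullet> (\<Sum>l\<in>K0. (Y j \<bullet> b' l) *\<^sub>R b' l) = 0"
          unfolding inner_sum_right inner_scaleR_right by (intro sum.neutral ballI) (simp only: v0 mult_zero_right)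
        then show "?v y \<bullet> (Y(i := y)) j = 0"
          using j insert.hyps orthonormal_expansion[OF bK0 finite Yj] by auto
      qed
      also have "gram_vol K (Y(i := y)) = gram_vol K Y"
        using insert.hyps by (intro gram_vol_cong) auto
      finally show ?thesis .
    qed
    have prod: "(\<Prod>j\<in>insert i K. indicator (cball 0 1) ((Y(i := y)) j)) = (indicator (cball 0 1) y * (\<Prod>j\<in>K. indicator (cball 0 1) (Y j)) :: ennreal)" for y
    proof -
      have "(\<Prod>j\<in>K. indicator (cball 0 1) ((Y(i := y)) j)) = (\<Prod>j\<in>K. indicator (cball 0 1) (Y j) :: ennreal)"
        using insert.hyps by (intro prod.cong) auto
      then show ?thesis using insert.hyps by simp
    qed
    have "?F (insert i K) (Y(i := y)) = ?F K Y * (ennreal (norm (?v y) powr p) * indicator (cball 0 1) y)" for y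
      unfolding prod gv by (simp add: powr_mult ennreal_mult mult_ac)
    then have "(\<integral>\<^sup>+y. ?F (insert i K) (Y(i := y)) \<partial>?N) = ?F K Y * (\<integral>\<^sup>+y. ennreal (norm (?v y) powr p) * indicator (cball 0 1) y \<partial>?N)"
      by (simp only:) (rule nn_integral_cmult, measurable)
    also have "\<dots> = ?F K Y * ?c"
    \<comment> \<open>For dependent vectors both sides vanish, because \<open>0 powr p\<close> is
      \<open>0\<close> for every \<open>p\<close>; for independent ones \<open>K0\<close> has
      exactly \<open>card K\<close> elements.\<close>
    proof (cases "gram_vol K Y = 0")
      case False
      then have "dim ?U = card K" using gram_vol_eq_0[of Y K] dimU by linarith
      then have c0: "card K0 = card K" using K0 by simp
      have "frame_measure J b = frame_measure J b'"
        by (rule frame_measure_cong_span[OF b b'(1) b'(3)[symmetric]])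
      then have "(\<integral>\<^sup>+y. ennreal (norm (?v y) powr p) * indicator (cball 0 1) y \<partial>?N) = ?c"
        using nn_integral_cball_frame_residual[OF b'(1) K0(1), of p] cKJ pK c0 by simp
      then show ?thesis by simp
    qed simp
    finally show ?thesis .
  qed
  have "(\<integral>\<^sup>+Y. ?F (insert i K) Y \<partial>Pi\<^sub>M (insert i K) (\<lambda>_. ?N)) = (\<integral>\<^sup>+Y. \<integral>\<^sup>+y. ?F (insert i K) (Y(i := y)) \<partial>?N \<partial>Pi\<^sub>M K (\<lambda>_. ?N))"
    by (rule product_nn_integral_insert[OF _ insert.hyps(2) F]) simp
  \<comment> \<open>Almost every tuple lies in the span of the frame, as \<open>inner\<close>
    requires.\<close>
  also have "\<dots> = (\<integral>\<^sup>+Y. ?F K Y * ?c \<partial>Pi\<^sub>M K (\<lambda>_. ?N))"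
    by (rule nn_integral_cong_AE, rule eventually_mono[OF AE_PiM_W[of K]], simp, rule inner)
  also have "\<dots> = (\<integral>\<^sup>+Y. ?F K Y \<partial>Pi\<^sub>M K (\<lambda>_. ?N)) * ?c"
    by (rule nn_integral_multc[OF F])
  also have "(\<integral>\<^sup>+Y. ?F K Y \<partial>Pi\<^sub>M K (\<lambda>_. ?N)) = ennreal (moment_const (card J) p (card K))"
    using insert.prems unfolding card by (intro insert.IH) auto
  also have "ennreal (moment_const (card J) p (card K)) * ?c = ennreal (moment_const (card J) p (card K) *
     (unit_ball_vol (real (card J) + p) * (omega (real (card J - card K)) / omega (real (card J - card K) + p))))"
    using moment_const_pos[of "card K" "card J" p] cKJ pK by (intro ennreal_mult'[symmetric]) auto
  also have "moment_const (card J) p (card K) * (unit_ball_vol (real (card J) + p) * (omega (real (card J - card K)) / omega (real (card J - card K) + p)))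
     = moment_const (card J) p (card (insert i K))"
    unfolding card moment_const_def using cKJ by (simp add: of_nat_diff mult.assoc)
  finally show ?case .
qed

section \<open>The double integral\<close>

text \<open>The inverse by Cramer's rule: its entries are quotients of determinants, hence visibly
  measurable in the entries of \<open>M\<close>.\<close>

definition cramer_inv :: "real^'n^'n \<Rightarrow> real^'n^'n" where
  "cramer_inv M = (\<chi> k l. det (\<chi> i j. if j = k then axis l 1 $ i else M $ i $ j) / det M)"

lemma cramer_inv_right:
  assumes "det M \<noteq> 0" shows "M ** cramer_inv M = mat 1"
  unfolding vec_eq_iff
proof (intro allI)
  fix i l
  have "M *v (\<chi> k. det (\<chi> i j. if j = k then axis l 1 $ i else M $ i $ j) / det M) = axis l 1"
    using cramer[OF assms] by blast
  then have "(M *v (\<chi> k. cramer_inv M $ k $ l)) $ i = axis l 1 $ i"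
    by (simp add: cramer_inv_def)
  then show "(M ** cramer_inv M) $ i $ l = mat 1 $ i $ l"
    by (simp add: matrix_matrix_mult_def matrix_vector_mult_def mat_def axis_def)
qed

lemma cramer_inv_left: "det M \<noteq> 0 \<Longrightarrow> cramer_inv M ** M = mat 1"
  using cramer_inv_right matrix_left_right_inverse by blast

lemma cramer_inv_unique:
  assumes "A ** B = mat 1" shows "cramer_inv A = B"
proof -
  have "det A \<noteq> 0" using assms by (metis det_I det_mul mult_zero_left zero_neq_one)
  then have "cramer_inv A = cramer_inv A ** (A ** B)" using assms by simp
  also have "\<dots> = B" using cramer_inv_left[OF \<open>det A \<noteq> 0\<close>] by (simp add: matrix_mul_assoc)
  finally show ?thesis .
qed

lemma block_inverse:
  fixes M :: "real^'n^'n"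
  assumes M: "block K M" and inv: "M ** B = mat 1"
  shows "block K B"
  unfolding block_def
proof (intro allI impI)
  fix i j assume ij: "i \<notin> K \<or> j \<notin> K"
  have inv': "B ** M = mat 1" using inv matrix_left_right_inverse by blast
  show "B $ i $ j = (if i = j then 1 else 0)"
  proof (cases "i \<in> K")
    case False
    then have "M $ i $ l = (if l = i then 1 else 0)" for l using M by (auto simp: block_def)
    then have "(M ** B) $ i $ j = B $ i $ j"
      by (simp add: matrix_matrix_mult_def if_distrib[of "\<lambda>x. x * _"] cong: if_cong)
    then show ?thesis using inv by (simp add: mat_def)
  next
    case True
    then have "M $ l $ j = (if l = j then 1 else 0)" for l using M ij by (auto simp: block_def)
    then have "(B ** M) $ i $ j = B $ i $ j"
      by (simp add: matrix_matrix_mult_def if_distrib[of "\<lambda>x. _ * x"] cong: if_cong)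
    then show ?thesis using inv' by (simp add: mat_def)
  qed
qed

lemma block_cramer_inv: "block K M \<Longrightarrow> det M \<noteq> 0 \<Longrightarrow> block K (cramer_inv M)"
  using block_inverse cramer_inv_right by blast

lemma frame_coords_act:
  assumes "block K (M :: real^'n^'n)"
  shows "frame_coords K b (act K M T) = frame_coords K b T ** M"
proof (rule block_eqI)
  show "block K (frame_coords K b T ** M)" using assms by (intro block_mult) auto
  fix i j assume ij: "i \<in> K" "j \<in> K"
  then show "frame_coords K b (act K M T) $ i $ j = (frame_coords K b T ** M) $ i $ j"
    by (subst block_mult_entry[of K]) (auto simp: assms frame_coords_def act_def inner_sum_left mult.commute)
qed auto

text \<open>With standard basis vectors as frame, a \<open>K\<close>-tuple of vectors in the
  coordinate subspace of \<open>K\<close> is the same as a square matrix indexed by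
  \<open>K\<close>, and the product of copies of \<open>coord_measure K\<close> is Lebesgue measure
  on these matrices.\<close>

abbreviation coord_matrix :: "'n set \<Rightarrow> ('n \<Rightarrow> real^'n) \<Rightarrow> real^'n^'n" where
  "coord_matrix K \<equiv> frame_coords K (\<lambda>i. axis i 1)"

abbreviation coord_measure :: "'n::finite set \<Rightarrow> (real^'n) measure" where
  "coord_measure K \<equiv> frame_measure K (\<lambda>i. axis i 1)"

lemma coord_matrix_left_mult:
  assumes "block K (S :: real^'n^'n)"
  shows "coord_matrix K (\<lambda>j\<in>K. S *v T j) = S ** coord_matrix K T"
proof (rule block_eqI)
  show "block K (S ** coord_matrix K T)" using assms by (intro block_mult) auto
  fix i j assume ij: "i \<in> K" "j \<in> K"
  have "(S *v T j) $ i = (\<Sum>l\<in>K. S $ i $ l * T j $ l)"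
    unfolding matrix_vector_mult_def using assms ij
    by (simp, intro sum.mono_neutral_right) (auto simp: block_def)
  then show "coord_matrix K (\<lambda>j\<in>K. S *v T j) $ i $ j = (S ** coord_matrix K T) $ i $ j"
    using ij by (subst block_mult_entry[of K]) (auto simp: assms frame_coords_def inner_axis)
qed auto

lemma borel_measurable_matrix_vector_mult[measurable]: "(\<lambda>x. (A :: real^'n^'m) *v x) \<in> borel_measurable borel"
  by (intro borel_measurable_continuous_onI continuous_intros)

text \<open>On coefficients, applying \<open>S\<close> is the right action of
  \<open>transpose S\<close> on a tuple of real numbers, so the substitution rule of the real line,
  with \<open>m = 1\<close>, applies.\<close>

lemma nn_integral_coord_measure_matrix:
  assumes S: "block K (S :: real^'n^'n)" "det S \<noteq> 0" and h[measurable]: "h \<in> borel_measurable borel"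
  shows "(\<integral>\<^sup>+x. h (S *v x) \<partial>coord_measure K) = ennreal (1 / \<bar>det S\<bar>) * (\<integral>\<^sup>+x. h x \<partial>coord_measure K)"
proof -
  let ?e = "\<lambda>i. axis i 1 :: real^'n"
  have Sv[measurable]: "(\<lambda>x. S *v x) \<in> borel_measurable borel"
    by (intro borel_measurable_continuous_onI continuous_intros)
  have comp: "(\<Sum>i\<in>K. c i *\<^sub>R ?e i) $ j = (if j \<in> K then c j else 0)" for c j
    by (simp add: axis_def if_distrib cong: if_cong)
  have eq: "S *v (\<Sum>i\<in>K. c i *\<^sub>R ?e i) = (\<Sum>i\<in>K. act K (transpose S) c i *\<^sub>R ?e i)" for c
  proof -
    have "(S *v (\<Sum>i\<in>K. c i *\<^sub>R ?e i)) $ j = (if j \<in> K then act K (transpose S) c j else 0)" for j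
    proof -
      have "(S *v (\<Sum>i\<in>K. c i *\<^sub>R ?e i)) $ j = (\<Sum>l\<in>UNIV. if l \<in> K then S $ j $ l * c l else 0)"
        unfolding matrix_vector_mult_def comp by (auto intro!: sum.cong)
      also have "\<dots> = (\<Sum>l\<in>K. S $ j $ l * c l)"
        by (subst sum.If_cases) auto
      also have "\<dots> = (if j \<in> K then act K (transpose S) c j else 0)"
        using S(1) by (auto simp: act_def transpose_def block_def intro!: sum.neutral)
      finally show ?thesis .
    qed
    then show ?thesis by (simp only: vec_eq_iff comp) simp
  qed
  have "(\<integral>\<^sup>+x. h (S *v x) \<partial>coord_measure K) = (\<integral>\<^sup>+c. h (\<Sum>i\<in>K. act K (transpose S) c i *\<^sub>R ?e i) \<partial>Pi\<^sub>M K (\<lambda>_. lborel))"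
    by (subst nn_integral_frame_measure) (auto simp: eq)
  also have "\<dots> = ennreal (1 / \<bar>det (transpose S)\<bar> ^ 1) * (\<integral>\<^sup>+c. h (\<Sum>i\<in>K. c i *\<^sub>R ?e i) \<partial>Pi\<^sub>M K (\<lambda>_. lborel))"
    using S by (intro lborel_real.nn_integral_act) (auto simp: det_transpose)
  finally show ?thesis by (simp add: det_transpose nn_integral_frame_measure)
qed

lemma act_mat_1: "act K (mat 1 :: real^'n^'n) Y = restrict Y K"
proof
  fix j
  have "(\<Sum>i\<in>K. (mat 1 :: real^'n^'n) $ i $ j *\<^sub>R Y i) = (\<Sum>i\<in>K. if i = j then Y i else 0)"
    by (intro sum.cong) (auto simp: mat_def)
  then show "act K (mat 1 :: real^'n^'n) Y j = restrict Y K j" by (simp add: act_def)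
qed

text \<open>Replaces the vectors \<open>W i\<close> by the columns of a square matrix without
  changing norms of combinations. This turns an ellipsoid condition on a product with a matrix into
  a ball condition on a product of two matrices.\<close>

lemma frame_coords_cong_norm:
  fixes K :: "'n::finite set" and b :: "'n \<Rightarrow> 'a::real_inner" and t :: "real^'n"
  assumes b: "orthonormal_on K b" and W: "\<And>j. j \<in> K \<Longrightarrow> W j \<in> span (b ` K)"
    and t: "t \<in> span ((\<lambda>i. axis i 1) ` K)"
  shows "norm (\<Sum>i\<in>K. t $ i *\<^sub>R W i) = norm (frame_coords K b W *v t)"
proof -
  let ?R = "frame_coords K b W"
  have t0: "t $ i = 0" if "i \<notin> K" for i
  proof -
    obtain u where "t = (\<Sum>l\<in>K. u l *\<^sub>R axis l 1)" using in_span_image_sum[OF t finite] by blast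
    then show ?thesis using that by (auto simp: axis_def intro!: sum.neutral)
  qed
  have comp: "(?R *v t) $ l = (\<Sum>i\<in>K. ?R $ l $ i * t $ i)" for l
    unfolding matrix_vector_mult_def using t0 by (simp, intro sum.mono_neutral_right) auto
  have "(\<Sum>i\<in>K. t $ i *\<^sub>R W i) = (\<Sum>i\<in>K. \<Sum>l\<in>K. (?R $ l $ i * t $ i) *\<^sub>R b l)"
  proof (intro sum.cong refl)
    fix i assume i: "i \<in> K"
    have "W i = (\<Sum>l\<in>K. ?R $ l $ i *\<^sub>R b l)"
      using i orthonormal_expansion[OF b finite W[OF i]] by (simp add: frame_coords_def)
    then have "t $ i *\<^sub>R W i = t $ i *\<^sub>R (\<Sum>l\<in>K. ?R $ l $ i *\<^sub>R b l)" by simp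
    then show "t $ i *\<^sub>R W i = (\<Sum>l\<in>K. (?R $ l $ i * t $ i) *\<^sub>R b l)"
      by (simp add: scaleR_sum_right mult.commute)
  qed
  also have "\<dots> = (\<Sum>l\<in>K. (?R *v t) $ l *\<^sub>R b l)"
    by (subst sum.swap) (simp add: comp scaleR_sum_left)
  finally have "norm (\<Sum>i\<in>K. t $ i *\<^sub>R W i) = sqrt (\<Sum>l\<in>K. ((?R *v t) $ l)\<^sup>2)"
    by (simp add: norm_orthonormal_sum[OF b])
  also have "(\<Sum>l\<in>K. ((?R *v t) $ l)\<^sup>2) = (\<Sum>l\<in>UNIV. ((?R *v t) $ l)\<^sup>2)"
  proof (intro sum.mono_neutral_left ballI)
    fix l assume "l \<in> UNIV - K"
    then have "(?R *v t) $ l = 0"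
      unfolding comp by (intro sum.neutral) (auto simp: frame_coords_def)
    then show "((?R *v t) $ l)\<^sup>2 = 0" by simp
  qed auto
  also have "sqrt \<dots> = norm (?R *v t)"
    by (simp add: norm_vec_def L2_set_def)
  finally show ?thesis .
qed

section \<open>Measurability of matrix expressions, entry by entry\<close>

lemma borel_measurable_cramer_inv:
  assumes "\<And>i j. (\<lambda>x. G x $ i $ j) \<in> borel_measurable M"
  shows "(\<lambda>x. cramer_inv (G x) $ k $ l) \<in> borel_measurable M"
proof -
  have "(\<lambda>x. (\<chi> i j. if j = k then axis l 1 $ i else G x $ i $ j) $ i $ j) \<in> borel_measurable M" for i j
    using assms by (cases "j = k") auto
  then have [measurable]: "(\<lambda>x. det (\<chi> i j. if j = k then axis l 1 $ i else G x $ i $ j)) \<in> borel_measurable M"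
    by (rule borel_measurable_det)
  have [measurable]: "(\<lambda>x. det (G x)) \<in> borel_measurable M"
    using assms by (rule borel_measurable_det)
  have "cramer_inv (G x) $ k $ l = det (\<chi> i j. if j = k then axis l 1 $ i else G x $ i $ j) / det (G x)" for x
    by (simp add: cramer_inv_def)
  then show ?thesis by (simp only:) measurable
qed

lemma borel_measurable_matrix_mult:
  fixes F G :: "'a \<Rightarrow> real^'n^'n"
  assumes "\<And>i j. (\<lambda>x. F x $ i $ j) \<in> borel_measurable M" "\<And>i j. (\<lambda>x. G x $ i $ j) \<in> borel_measurable M"
  shows "(\<lambda>x. (F x ** G x) $ i $ j) \<in> borel_measurable M"
  unfolding matrix_matrix_mult_def using assms by simp

lemma borel_measurable_transpose:
  assumes "\<And>i j. (\<lambda>x. G x $ i $ j) \<in> borel_measurable M"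
  shows "(\<lambda>x. transpose (G x) $ i $ j) \<in> borel_measurable M"
  unfolding transpose_def using assms by simp

lemma borel_measurable_gram_entry:
  fixes Y :: "'a \<Rightarrow> 'n::finite \<Rightarrow> 'b::euclidean_space"
  assumes "\<And>j. j \<in> K \<Longrightarrow> (\<lambda>x. Y x j) \<in> borel_measurable M"
  shows "(\<lambda>x. gram K (Y x) $ i $ j) \<in> borel_measurable M"
  using assms by (cases "i \<in> K \<and> j \<in> K") (auto simp: gram_def)

lemma borel_measurable_gram_vol:
  fixes Y :: "'a \<Rightarrow> 'n::finite \<Rightarrow> 'b::euclidean_space"
  assumes "\<And>j. j \<in> K \<Longrightarrow> (\<lambda>x. Y x j) \<in> borel_measurable M"
  shows "(\<lambda>x. gram_vol K (Y x)) \<in> borel_measurable M"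
proof -
  have [measurable]: "(\<lambda>x. det (gram K (Y x))) \<in> borel_measurable M"
    by (intro borel_measurable_det borel_measurable_gram_entry assms)
  show ?thesis unfolding gram_vol_def by measurable
qed

lemma borel_measurable_act:
  fixes Y :: "'a \<Rightarrow> 'n::finite \<Rightarrow> 'b::euclidean_space"
  assumes "\<And>i j. (\<lambda>x. G x $ i $ j) \<in> borel_measurable M" "\<And>i. i \<in> K \<Longrightarrow> (\<lambda>x. Y x i) \<in> borel_measurable M"
  shows "(\<lambda>x. act K (G x) (Y x) j) \<in> borel_measurable M"
  using assms by (cases "j \<in> K") (auto simp: act_def)

lemma borel_measurable_frame_coords:
  fixes Y :: "'a \<Rightarrow> 'n::finite \<Rightarrow> 'b::euclidean_space"
  assumes "\<And>j. j \<in> K \<Longrightarrow> (\<lambda>x. Y x j) \<in> borel_measurable M"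
  shows "(\<lambda>x. frame_coords K b (Y x) $ i $ j) \<in> borel_measurable M"
  using assms by (cases "i \<in> K \<and> j \<in> K") (auto simp: frame_coords_def)

lemmas borel_measurable_entries = borel_measurable_det borel_measurable_cramer_inv borel_measurable_matrix_mult
  borel_measurable_transpose borel_measurable_gram_entry borel_measurable_gram_vol borel_measurable_act
  borel_measurable_frame_coords

lemma in_span_axis_iff: "(x :: real^'n) \<in> span ((\<lambda>i. axis i 1) ` K) \<longleftrightarrow> (\<forall>i. i \<notin> K \<longrightarrow> x $ i = 0)"
proof (intro iffI allI impI)
  fix i assume x: "x \<in> span ((\<lambda>i. axis i 1) ` K)" and i: "i \<notin> K"
  obtain u where "x = (\<Sum>l\<in>K. u l *\<^sub>R axis l 1)" using in_span_image_sum[OF x finite] by blast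
  then show "x $ i = 0" using i by (auto simp: axis_def intro!: sum.neutral)
next
  assume x: "\<forall>i. i \<notin> K \<longrightarrow> x $ i = 0"
  have "x = (\<Sum>l\<in>K. x $ l *\<^sub>R axis l 1)"
    using x by (auto simp: vec_eq_iff axis_def if_distrib cong: if_cong)
  moreover have "(\<Sum>l\<in>K. x $ l *\<^sub>R axis l 1) \<in> span ((\<lambda>i. axis i (1::real)) ` K)"
    by (intro span_sum span_scale span_base) auto
  ultimately show "x \<in> span ((\<lambda>i. axis i 1) ` K)" by simp
qed

lemma matrix_vector_act:
  fixes A :: "real^'n^'n"
  assumes "j \<in> K" shows "A *v act K M Y j = act K M (\<lambda>i. A *v Y i) j"
  using assms by (simp add: act_def linear_sum[OF matrix_vector_mul_linear] matrix_vector_mult_scaleR)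

text \<open>If the images were dependent, their coordinate matrix would have determinant
  \<open>0\<close>; but \<open>Y\<close> is the preimage of the frame multiplied by that same
  matrix.\<close>

lemma gram_vol_matrix_nonzero:
  fixes Y :: "'n::finite \<Rightarrow> real^'n"
  assumes Y: "gram_vol K Y \<noteq> 0" and B: "det B \<noteq> 0"
  shows "gram_vol K (\<lambda>j. B *v Y j) \<noteq> 0"
proof
  assume 0: "gram_vol K (\<lambda>j. B *v Y j) = 0"
  let ?W = "\<lambda>j. B *v Y j"
  obtain b where b: "orthonormal_on UNIV b" "\<And>j. j \<in> K \<Longrightarrow> ?W j \<in> span (b ` K)" using ex_frame_coords[of K ?W] by blast
  have bK: "orthonormal_on K b" using b(1) by (rule orthonormal_on_subset) simp
  let ?R = "frame_coords K b ?W"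
  have "det ?R = 0" using gram_vol_frame_coords[OF bK b(2)] 0 by simp
  have "gram_vol K Y = gram_vol K (act K ?R (\<lambda>i. cramer_inv B *v b i))"
  proof (rule gram_vol_cong)
    fix j assume j: "j \<in> K"
    have "Y j = cramer_inv B *v ?W j"
      by (simp add: matrix_vector_mul_assoc cramer_inv_left[OF B])
    also have "?W j = act K ?R b j" using act_frame_coords[OF bK b(2)] j by simp
    finally show "Y j = act K ?R (\<lambda>i. cramer_inv B *v b i) j"
      using j by (simp add: matrix_vector_act)
  qed
  then show False using Y \<open>det ?R = 0\<close> by (simp add: gram_vol_act)
qed

context
  fixes K :: "'n::finite set"
begin

definition ball_tuple :: "('n \<Rightarrow> real^'n) \<Rightarrow> ennreal" where
  "ball_tuple Y = (\<Prod>j\<in>K. indicator (cball 0 1) (Y j))"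

text \<open>Tuples in the unit ball, weighted by a power of the Gram volume. It is phrased through
  the Gram matrix, whose diagonal entries are the squared norms, so that isometric tuples visibly
  get the same weight.\<close>

definition gram_weight :: "real^'n^'n \<Rightarrow> ennreal" where
  "gram_weight G = (\<Prod>j\<in>K. (if G $ j $ j \<le> 1 then 1 else 0)) * ennreal (sqrt (det G) ^ CARD('n))"

lemma gram_weight_gram: "gram_weight (gram K Y) = ball_tuple Y * ennreal (gram_vol K Y ^ CARD('n))"
proof -
  have "(\<Prod>j\<in>K. (if gram K Y $ j $ j \<le> 1 then 1 else 0 :: ennreal)) = ball_tuple Y"
    unfolding ball_tuple_def
    by (intro prod.cong) (auto simp: gram_def indicator_def norm_le_square)
  then show ?thesis by (simp add: gram_weight_def gram_vol_def)
qed

lemma borel_measurable_gram_weight: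
  assumes "\<And>i j. (\<lambda>x. G x $ i $ j) \<in> borel_measurable M"
  shows "(\<lambda>x. gram_weight (G x)) \<in> borel_measurable M"
  unfolding gram_weight_def using assms by measurable

text \<open>\<open>1 / \<bar>det M\<bar> ^ card K\<close> is the Haar density of the general linear
  group of size \<open>card K\<close>; the other factor is the weight of the columns of the inverse
  of \<open>M\<close>.\<close>

definition group_density :: "('n \<Rightarrow> real^'n) \<Rightarrow> ennreal" where
  "group_density T = (let M = coord_matrix K T in
     if det M = 0 then 0 else ennreal (1 / \<bar>det M\<bar> ^ card K) * gram_weight (transpose (cramer_inv M) ** cramer_inv M))"

text \<open>
  The weight is invariant under the left action of the orthogonal group, so only the Gram matrix
  \<open>S\<^sup>T S\<close> of \<open>Z\<close> matters; the substitution \<open>T \<mapsto> T S\<inverse>\<close> removes it.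
\<close>
lemma nn_integral_group_density:
  fixes Z :: "'n \<Rightarrow> real^'n"
  assumes Z: "gram_vol K Z \<noteq> 0"
  shows "(\<integral>\<^sup>+T. (let M = coord_matrix K T in if det M = 0 then 0
      else ennreal (1 / \<bar>det M\<bar> ^ card K) * gram_weight (gram K (act K (cramer_inv M) Z))) \<partial>Pi\<^sub>M K (\<lambda>_. coord_measure K))
    = (\<integral>\<^sup>+T. group_density T \<partial>Pi\<^sub>M K (\<lambda>_. coord_measure K))"
proof -
  interpret homogeneous_measure "coord_measure K" "span ((\<lambda>i. axis i 1) ` K)" "card K"
    by (rule homogeneous_frame_measure[OF orthonormal_on_axis])
  obtain b where b: "orthonormal_on UNIV b" "\<And>j. j \<in> K \<Longrightarrow> Z j \<in> span (b ` K)" using ex_frame_coords[of K Z] by blast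
  have bK: "orthonormal_on K b" using b(1) by (rule orthonormal_on_subset) simp
  define S where "S = frame_coords K b Z"
  have S: "block K S" "gram K Z = transpose S ** S" "\<bar>det S\<bar> = gram_vol K Z"
    using gram_frame_coords[OF bK b(2)] gram_vol_frame_coords[OF bK b(2)] by (auto simp: S_def)
  have detS: "det S \<noteq> 0" using S(3) Z by auto
  let ?Si = "cramer_inv S"
  have Si: "block K ?Si" by (rule block_cramer_inv[OF S(1) detS])
  have detSi: "det ?Si = 1 / det S"
    using arg_cong[OF cramer_inv_right[OF detS], of det] detS by (simp add: det_mul field_simps)
  have m[measurable]: "group_density \<in> borel_measurable (Pi\<^sub>M K (\<lambda>_. coord_measure K))"
  proof -
    have [measurable]: "(\<lambda>T. coord_matrix K T $ i $ j) \<in> borel_measurable (Pi\<^sub>M K (\<lambda>_. coord_measure K))" for i j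
      by (intro borel_measurable_frame_coords) measurable
    have [measurable]: "(\<lambda>T. gram_weight (transpose (cramer_inv (coord_matrix K T)) ** cramer_inv (coord_matrix K T))) \<in> borel_measurable (Pi\<^sub>M K (\<lambda>_. coord_measure K))"
      by (intro borel_measurable_gram_weight borel_measurable_entries) measurable
    show ?thesis unfolding group_density_def Let_def by measurable
  qed
  have "(let M = coord_matrix K T in if det M = 0 then 0
      else ennreal (1 / \<bar>det M\<bar> ^ card K) * gram_weight (gram K (act K (cramer_inv M) Z)))
     = ennreal (1 / \<bar>det S\<bar> ^ card K) * group_density (act K ?Si T)" for T
  proof -
    let ?M = "coord_matrix K T"
    have M: "block K ?M" by simp
    have M': "coord_matrix K (act K ?Si T) = ?M ** ?Si" by (rule frame_coords_act[OF Si])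
    show ?thesis
    proof (cases "det ?M = 0")
      case True
      then show ?thesis by (simp add: group_density_def Let_def M' det_mul)
    next
      case False
      have inv: "cramer_inv (?M ** ?Si) = S ** cramer_inv ?M"
      proof (rule cramer_inv_unique)
        have "?M ** ?Si ** (S ** cramer_inv ?M) = ?M ** (?Si ** S) ** cramer_inv ?M"
          by (simp add: matrix_mul_assoc)
        then show "?M ** ?Si ** (S ** cramer_inv ?M) = mat 1"
          by (simp add: cramer_inv_left[OF detS] cramer_inv_right[OF False])
      qed
      have G: "gram K (act K (cramer_inv ?M) Z) = transpose (S ** cramer_inv ?M) ** (S ** cramer_inv ?M)"
        using block_cramer_inv[OF M False] by (simp add: gram_act S(2) matrix_transpose_mul matrix_mul_assoc)
      have d: "det (?M ** ?Si) = det ?M / det S" by (simp add: det_mul detSi)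
      have "1 / \<bar>det ?M\<bar> ^ card K = 1 / \<bar>det S\<bar> ^ card K * (1 / \<bar>det ?M / det S\<bar> ^ card K)"
        using detS by (simp add: power_divide)
      then have "ennreal (1 / \<bar>det ?M\<bar> ^ card K) = ennreal (1 / \<bar>det S\<bar> ^ card K) * ennreal (1 / \<bar>det ?M / det S\<bar> ^ card K)"
        by (simp only: ennreal_mult'[symmetric] zero_le_divide_1_iff zero_le_power abs_ge_zero)
      then show ?thesis using False detS
        by (simp add: group_density_def Let_def M' inv G d mult.assoc)
    qed
  qed
  then have "(\<integral>\<^sup>+T. (let M = coord_matrix K T in if det M = 0 then 0
      else ennreal (1 / \<bar>det M\<bar> ^ card K) * gram_weight (gram K (act K (cramer_inv M) Z))) \<partial>Pi\<^sub>M K (\<lambda>_. coord_measure K))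
     = (\<integral>\<^sup>+T. ennreal (1 / \<bar>det S\<bar> ^ card K) * group_density (act K ?Si T) \<partial>Pi\<^sub>M K (\<lambda>_. coord_measure K))"
    by simp
  also have "\<dots> = ennreal (1 / \<bar>det S\<bar> ^ card K) * (\<integral>\<^sup>+T. group_density (act K ?Si T) \<partial>Pi\<^sub>M K (\<lambda>_. coord_measure K))"
    by (rule nn_integral_cmult) measurable
  \<comment> \<open>Invariance of Haar measure: the Jacobian of right multiplication by the inverse
    of \<open>S\<close> cancels the factor \<open>1 / \<bar>det S\<bar> ^ card K\<close>.\<close>
  also have "(\<integral>\<^sup>+T. group_density (act K ?Si T) \<partial>Pi\<^sub>M K (\<lambda>_. coord_measure K)) = ennreal (1 / \<bar>det ?Si\<bar> ^ card K) * (\<integral>\<^sup>+T. group_density T \<partial>Pi\<^sub>M K (\<lambda>_. coord_measure K))"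
    using detS by (intro nn_integral_act Si m) (simp add: detSi)
  also have "ennreal (1 / \<bar>det S\<bar> ^ card K) * (ennreal (1 / \<bar>det ?Si\<bar> ^ card K) * (\<integral>\<^sup>+T. group_density T \<partial>Pi\<^sub>M K (\<lambda>_. coord_measure K)))
     = (\<integral>\<^sup>+T. group_density T \<partial>Pi\<^sub>M K (\<lambda>_. coord_measure K))"
    using detS by (simp add: detSi mult.assoc[symmetric] ennreal_mult'[symmetric] power_divide)
  finally show ?thesis .
qed

text \<open>With \<open>B\<close> the inverse of the matrix of the ellipsoid, this is the integrand
  of the theorem up to a constant: the simplex has the Gram volume divided by
  \<open>fact k\<close>.\<close>

definition ellipsoid_power :: "real^'n^'n \<Rightarrow> real \<Rightarrow> ('n \<Rightarrow> real^'n) \<Rightarrow> ennreal" where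
  "ellipsoid_power B p Y = (\<Prod>j\<in>K. indicator {x. norm (B *v x) \<le> 1} (Y j)) * ennreal (gram_vol K Y powr p)"

lemma borel_measurable_ellipsoid_power:
  assumes "\<And>j. j \<in> K \<Longrightarrow> (\<lambda>x. Y x j) \<in> borel_measurable M"
  shows "(\<lambda>x. ellipsoid_power B p (Y x)) \<in> borel_measurable M"
proof -
  have E[measurable]: "{x. norm (B *v x) \<le> 1} \<in> sets borel" by measurable
  have [measurable]: "(\<lambda>x. gram_vol K (Y x)) \<in> borel_measurable M"
    by (intro borel_measurable_gram_vol assms)
  show ?thesis
    unfolding ellipsoid_power_def using assms
    by (intro borel_measurable_times_ennreal borel_measurable_prod_ennreal) (auto intro!: measurable_compose[OF assms borel_measurable_indicator[OF E]])
qed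

lemma borel_measurable_ball_tuple:
  assumes "\<And>j. j \<in> K \<Longrightarrow> (\<lambda>x. Y x j) \<in> borel_measurable M"
  shows "(\<lambda>x. ball_tuple (Y x)) \<in> borel_measurable M"
proof -
  have E: "cball (0::real^'n) 1 \<in> sets borel" by simp
  show ?thesis
    unfolding ball_tuple_def using assms
    by (intro borel_measurable_prod_ennreal) (auto intro!: measurable_compose[OF assms borel_measurable_indicator[OF E]])
qed

text \<open>The last power combines with the Jacobian
  \<open>1 / \<bar>det M\<bar> ^ CARD('n)\<close> of the substitution for \<open>Y\<close> to the
  Haar factor in \<open>group_density\<close>.\<close>

definition double_integrand :: "real^'n^'n \<Rightarrow> real \<Rightarrow> ('n \<Rightarrow> real^'n) \<Rightarrow> ('n \<Rightarrow> real^'n) \<Rightarrow> ennreal" where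
  "double_integrand B p T Y = ellipsoid_power B p (act K (coord_matrix K T) Y) * gram_weight (gram K Y)
     * ennreal (\<bar>det (coord_matrix K T)\<bar> ^ (CARD('n) - card K))"

lemma measurable_double_integrand:
  "(\<lambda>(T, Y). double_integrand B p T Y) \<in> borel_measurable (Pi\<^sub>M K (\<lambda>_. coord_measure K) \<Otimes>\<^sub>M Pi\<^sub>M K (\<lambda>_. lborel))"
  (is "_ \<in> borel_measurable ?P")
proof -
  have T[measurable]: "(\<lambda>x. fst x j) \<in> borel_measurable ?P" if "j \<in> K" for j
    using that by measurable
  have Y[measurable]: "(\<lambda>x. snd x j) \<in> borel_measurable ?P" if "j \<in> K" for j
    using that by measurable
  have C: "(\<lambda>x. coord_matrix K (fst x) $ i $ j) \<in> borel_measurable ?P" for i j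
    by (intro borel_measurable_frame_coords T)
  have [measurable]: "(\<lambda>x. det (coord_matrix K (fst x))) \<in> borel_measurable ?P"
    by (intro borel_measurable_det C)
  have [measurable]: "(\<lambda>x. ellipsoid_power B p (act K (coord_matrix K (fst x)) (snd x))) \<in> borel_measurable ?P"
    by (intro borel_measurable_ellipsoid_power borel_measurable_act C Y)
  have [measurable]: "(\<lambda>x. gram_weight (gram K (snd x))) \<in> borel_measurable ?P"
    by (intro borel_measurable_gram_weight borel_measurable_gram_entry Y)
  show ?thesis unfolding double_integrand_def case_prod_beta by measurable
qed

text \<open>For fixed \<open>T\<close>, the product of \<open>Y\<close> with the matrix of
  \<open>T\<close> becomes the new variable \<open>Z\<close>. After Fubini the integral over
  \<open>T\<close> is the same for all independent \<open>Z\<close>, so the double integral is a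
  product.\<close>

lemma double_integral_right:
  "(\<integral>\<^sup>+T. \<integral>\<^sup>+Y. double_integrand B p T Y \<partial>Pi\<^sub>M K (\<lambda>_. lborel) \<partial>Pi\<^sub>M K (\<lambda>_. coord_measure K))
    = (\<integral>\<^sup>+Z. ellipsoid_power B p Z \<partial>Pi\<^sub>M K (\<lambda>_. lborel)) * (\<integral>\<^sup>+T. group_density T \<partial>Pi\<^sub>M K (\<lambda>_. coord_measure K))"
proof -
  interpret N: homogeneous_measure "coord_measure K" "span ((\<lambda>i. axis i 1) ` K)" "card K"
    by (rule homogeneous_frame_measure[OF orthonormal_on_axis])
  interpret L: homogeneous_measure "lborel :: (real^'n) measure" UNIV "CARD('n)"
    by (rule homogeneous_lborel)
  let ?N = "Pi\<^sub>M K (\<lambda>_. coord_measure K)" and ?L = "Pi\<^sub>M K (\<lambda>_. lborel :: (real^'n) measure)"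
  interpret NK: finite_product_sigma_finite "\<lambda>_. coord_measure K" K by standard simp
  interpret LK: finite_product_sigma_finite "\<lambda>_. lborel :: (real^'n) measure" K by standard simp
  interpret P: pair_sigma_finite ?N ?L by standard
  let ?f = "ellipsoid_power B p"
  let ?R = "\<lambda>T Z. let M = coord_matrix K T in if det M = 0 then 0
      else ennreal (1 / \<bar>det M\<bar> ^ card K) * gram_weight (gram K (act K (cramer_inv M) Z))"
  have f[measurable]: "?f \<in> borel_measurable ?L" by (intro borel_measurable_ellipsoid_power) measurable
  have R[measurable]: "(\<lambda>x. ?R (fst x) (snd x)) \<in> borel_measurable (?N \<Otimes>\<^sub>M ?L)"
  proof -
    let ?P = "?N \<Otimes>\<^sub>M ?L"
    have T: "(\<lambda>x. fst x j) \<in> borel_measurable ?P" if "j \<in> K" for j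
      using that by measurable
    have Y: "(\<lambda>x. snd x j) \<in> borel_measurable ?P" if "j \<in> K" for j
      using that by measurable
    have C: "(\<lambda>x. coord_matrix K (fst x) $ i $ j) \<in> borel_measurable ?P" for i j
      by (intro borel_measurable_frame_coords T)
    have [measurable]: "(\<lambda>x. det (coord_matrix K (fst x))) \<in> borel_measurable ?P"
      by (intro borel_measurable_det C)
    have [measurable]: "(\<lambda>x. gram_weight (gram K (act K (cramer_inv (coord_matrix K (fst x))) (snd x)))) \<in> borel_measurable ?P"
      by (intro borel_measurable_gram_weight borel_measurable_gram_entry borel_measurable_act borel_measurable_cramer_inv C Y)
    show ?thesis unfolding Let_def by measurable
  qed
  have kd: "card K \<le> CARD('n)" by (simp add: card_mono)
  have "(\<integral>\<^sup>+Y. double_integrand B p T Y \<partial>?L) = (\<integral>\<^sup>+Z. ?f Z * ?R T Z \<partial>?L)" for T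
  \<comment> \<open>For singular \<open>T\<close> the Gram volume of the product is
    \<open>0\<close>, and \<open>0 powr p\<close> is \<open>0\<close> also for negative
    \<open>p\<close>; the default \<open>0\<close> on the other side agrees.\<close>
  proof (cases "det (coord_matrix K T) = 0")
    case True
    then have "double_integrand B p T Y = 0" for Y
      by (simp add: double_integrand_def ellipsoid_power_def gram_vol_act)
    then show ?thesis using True by (simp add: Let_def)
  next
    case False
    let ?M = "coord_matrix K T"
    let ?h = "\<lambda>Z. ?f Z * gram_weight (gram K (act K (cramer_inv ?M) Z))"
    have h[measurable]: "?h \<in> borel_measurable ?L"
      by (intro borel_measurable_times_ennreal f borel_measurable_gram_weight borel_measurable_gram_entry borel_measurable_act) measurable
    have "(\<integral>\<^sup>+Y. double_integrand B p T Y \<partial>?L) = (\<integral>\<^sup>+Y. ?h (act K ?M Y) * ennreal (\<bar>det ?M\<bar> ^ (CARD('n) - card K)) \<partial>?L)"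
    proof (intro nn_integral_cong)
      fix Y assume "Y \<in> space ?L"
      then have "restrict Y K = Y" by (auto simp: space_PiM PiE_def extensional_restrict)
      then have "act K (cramer_inv ?M) (act K ?M Y) = Y"
        using act_mult[of K ?M "cramer_inv ?M" Y] cramer_inv_right[OF False] act_mat_1[of K Y] by simp
      then show "double_integrand B p T Y = ?h (act K ?M Y) * ennreal (\<bar>det ?M\<bar> ^ (CARD('n) - card K))"
        by (simp add: double_integrand_def)
    qed
    also have "\<dots> = (\<integral>\<^sup>+Y. ?h (act K ?M Y) \<partial>?L) * ennreal (\<bar>det ?M\<bar> ^ (CARD('n) - card K))"
      by (rule nn_integral_multc) (rule measurable_compose[OF L.measurable_act h])
    also have "(\<integral>\<^sup>+Y. ?h (act K ?M Y) \<partial>?L) = ennreal (1 / \<bar>det ?M\<bar> ^ CARD('n)) * (\<integral>\<^sup>+Y. ?h Y \<partial>?L)"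
      by (intro L.nn_integral_act h False) simp
    also have "ennreal (1 / \<bar>det ?M\<bar> ^ CARD('n)) * (\<integral>\<^sup>+Y. ?h Y \<partial>?L) * ennreal (\<bar>det ?M\<bar> ^ (CARD('n) - card K))
       = ennreal (1 / \<bar>det ?M\<bar> ^ CARD('n)) * ennreal (\<bar>det ?M\<bar> ^ (CARD('n) - card K)) * (\<integral>\<^sup>+Y. ?h Y \<partial>?L)"
      by (simp add: mult_ac)
    also have "ennreal (1 / \<bar>det ?M\<bar> ^ CARD('n)) * ennreal (\<bar>det ?M\<bar> ^ (CARD('n) - card K)) = ennreal (1 / \<bar>det ?M\<bar> ^ card K)"
    proof -
      have "1 / \<bar>det ?M\<bar> ^ CARD('n) * \<bar>det ?M\<bar> ^ (CARD('n) - card K) = 1 / \<bar>det ?M\<bar> ^ card K"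
        using False kd by (simp add: power_diff field_simps)
      then show ?thesis by (subst ennreal_mult'[symmetric]) simp_all
    qed
    also have "ennreal (1 / \<bar>det ?M\<bar> ^ card K) * (\<integral>\<^sup>+Y. ?h Y \<partial>?L) = (\<integral>\<^sup>+Z. ?f Z * ?R T Z \<partial>?L)"
      using False by (subst nn_integral_cmult[symmetric]) (auto simp: Let_def mult_ac)
    finally show ?thesis .
  qed
  then have "(\<integral>\<^sup>+T. \<integral>\<^sup>+Y. double_integrand B p T Y \<partial>?L \<partial>?N) = (\<integral>\<^sup>+T. \<integral>\<^sup>+Z. ?f Z * ?R T Z \<partial>?L \<partial>?N)"
    by simp
  also have "\<dots> = (\<integral>\<^sup>+Z. \<integral>\<^sup>+T. ?f Z * ?R T Z \<partial>?N \<partial>?L)"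
  proof (rule P.Fubini'[symmetric])
    have "(\<lambda>x. ?f (snd x) * ?R (fst x) (snd x)) \<in> borel_measurable (?N \<Otimes>\<^sub>M ?L)"
      by (intro borel_measurable_times_ennreal R measurable_compose[OF measurable_snd f])
    then show "(\<lambda>(T, Z). ?f Z * ?R T Z) \<in> borel_measurable (?N \<Otimes>\<^sub>M ?L)"
      by (simp add: case_prod_beta)
  qed
  also have "\<dots> = (\<integral>\<^sup>+Z. ?f Z * (\<integral>\<^sup>+T. group_density T \<partial>?N) \<partial>?L)"
  proof (intro nn_integral_cong)
    fix Z assume Z: "Z \<in> space ?L"
    have "(\<lambda>T. ?R T Z) \<in> borel_measurable ?N"
      using measurable_compose[OF measurable_Pair2'[OF Z] R] by (simp only: fst_conv snd_conv)
    then have "(\<integral>\<^sup>+T. ?f Z * ?R T Z \<partial>?N) = ?f Z * (\<integral>\<^sup>+T. ?R T Z \<partial>?N)"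
      by (rule nn_integral_cmult)
    also have "\<dots> = ?f Z * (\<integral>\<^sup>+T. group_density T \<partial>?N)"
    proof (cases "gram_vol K Z = 0")
      case True
      then show ?thesis by (simp add: ellipsoid_power_def)
    next
      case False
      then show ?thesis by (simp only: nn_integral_group_density[OF False])
    qed
    finally show "(\<integral>\<^sup>+T. ?f Z * ?R T Z \<partial>?N) = ?f Z * (\<integral>\<^sup>+T. group_density T \<partial>?N)" .
  qed
  also have "\<dots> = (\<integral>\<^sup>+Z. ?f Z \<partial>?L) * (\<integral>\<^sup>+T. group_density T \<partial>?N)"
    by (rule nn_integral_multc[OF f])
  finally show ?thesis .
qed

text \<open>For fixed \<open>Y\<close>, the tuple of all \<open>B *v Y j\<close> is an orthonormal
  frame times a square matrix \<open>R\<close>. Taking \<open>R\<close> times the matrix of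
  \<open>T\<close> as new variable turns the ellipsoid into the unit ball of \<open>card K\<close>
  dimensions, where the moment formula with exponent \<open>p + real (CARD('n) - card K)\<close>
  applies; this needs the bound on \<open>p\<close>.\<close>

lemma double_integral_left:
  assumes B: "det B \<noteq> 0" and p: "p + real (CARD('n) - card K) + 1 > 0"
  shows "(\<integral>\<^sup>+T. \<integral>\<^sup>+Y. double_integrand B p T Y \<partial>Pi\<^sub>M K (\<lambda>_. lborel) \<partial>Pi\<^sub>M K (\<lambda>_. coord_measure K))
    = ennreal (moment_const (card K) (p + real (CARD('n) - card K)) (card K)) *
      (\<integral>\<^sup>+Y. ball_tuple Y * ennreal ((gram_vol K Y / gram_vol K (\<lambda>j. B *v Y j)) powr (p + CARD('n))) \<partial>Pi\<^sub>M K (\<lambda>_. lborel))"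
proof -
  interpret N: homogeneous_measure "coord_measure K" "span ((\<lambda>i. axis i 1) ` K)" "card K"
    by (rule homogeneous_frame_measure[OF orthonormal_on_axis])
  interpret L: homogeneous_measure "lborel :: (real^'n) measure" UNIV "CARD('n)"
    by (rule homogeneous_lborel)
  let ?N = "Pi\<^sub>M K (\<lambda>_. coord_measure K)" and ?L = "Pi\<^sub>M K (\<lambda>_. lborel :: (real^'n) measure)"
  interpret NK: finite_product_sigma_finite "\<lambda>_. coord_measure K" K by standard simp
  interpret LK: finite_product_sigma_finite "\<lambda>_. lborel :: (real^'n) measure" K by standard simp
  interpret P: pair_sigma_finite ?N ?L by standard
  define s where "s = p + real (CARD('n) - card K)"
  have kd: "card K \<le> CARD('n)" by (simp add: card_mono)
  let ?\<phi> = "\<lambda>T. ball_tuple T * ennreal (gram_vol K T powr s)"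
  let ?Mk = "ennreal (moment_const (card K) s (card K))"
  have \<phi>[measurable]: "?\<phi> \<in> borel_measurable ?N"
  proof -
    have [measurable]: "(\<lambda>T. gram_vol K T) \<in> borel_measurable ?N" "(\<lambda>T. ball_tuple T) \<in> borel_measurable ?N"
      by (intro borel_measurable_gram_vol borel_measurable_ball_tuple; measurable)+
    show ?thesis by measurable
  qed
  have Mk: "(\<integral>\<^sup>+T. ?\<phi> T \<partial>?N) = ?Mk"
    unfolding ball_tuple_def using p
    by (intro nn_integral_gram_vol_moment orthonormal_on_axis) (auto simp: s_def)
  have inner: "(\<integral>\<^sup>+T. double_integrand B p T Y \<partial>?N) = ?Mk * (ball_tuple Y * ennreal ((gram_vol K Y / gram_vol K (\<lambda>j. B *v Y j)) powr (p + CARD('n))))" for Y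
  proof (cases "gram_vol K Y = 0")
    case True
    then have "gram_weight (gram K Y) = 0" by (simp add: gram_weight_gram)
    then show ?thesis using True by (simp add: double_integrand_def)
  next
    case False
    define g where "g = gram_vol K Y"
    let ?W = "\<lambda>j. B *v Y j"
    define gB where "gB = gram_vol K ?W"
    have g: "g > 0" "gB > 0"
      using False gram_vol_matrix_nonzero[OF False B] gram_vol_nonneg[of K Y] gram_vol_nonneg[of K ?W]
      unfolding g_def gB_def by linarith+
    obtain b where b: "orthonormal_on UNIV b" "\<And>j. j \<in> K \<Longrightarrow> ?W j \<in> span (b ` K)" using ex_frame_coords[of K ?W] by blast
    have bK: "orthonormal_on K b" using b(1) by (rule orthonormal_on_subset) simp
    define R where "R = frame_coords K b ?W"
    have R: "block K R" "\<bar>det R\<bar> = gB" using gram_vol_frame_coords[OF bK b(2)] by (auto simp: R_def gB_def)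
    have detR: "det R \<noteq> 0" using R g by auto
    \<comment> \<open>Everything independent of \<open>T\<close>: the weight,
      \<open>g powr p\<close> from the Gram volume of the product, and \<open>gB powr (- s)\<close>,
      which compensates for replacing the determinant of \<open>T\<close> by that of
      \<open>R\<close> times \<open>T\<close>.\<close>
    let ?c = "gram_weight (gram K Y) * ennreal (g powr p * gB powr (- s))"
    have pointwise: "double_integrand B p T Y = ?c * ?\<phi> (\<lambda>j\<in>K. R *v T j)"
      if T: "\<forall>j\<in>K. T j \<in> span ((\<lambda>i. axis i 1) ` K)" for T
    proof -
      let ?C = "coord_matrix K T"
      have nrm: "norm (B *v act K ?C Y j) = norm (R *v T j)" if j: "j \<in> K" for j
      proof -
        have "B *v act K ?C Y j = (\<Sum>i\<in>K. T j $ i *\<^sub>R ?W i)"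
          using j by (simp add: matrix_vector_act) (simp add: act_def frame_coords_def inner_axis)
        then show ?thesis
          using frame_coords_cong_norm[OF bK b(2), where t = "T j"] T j by (simp add: R_def)
      qed
      have ind: "(\<Prod>j\<in>K. indicator {x. norm (B *v x) \<le> 1} (act K ?C Y j)) = ball_tuple (\<lambda>j\<in>K. R *v T j)"
        unfolding ball_tuple_def by (intro prod.cong) (auto simp: indicator_def nrm)
      have RT: "(R *v T j) \<in> span ((\<lambda>i. axis i 1) ` K)" if j: "j \<in> K" for j
        unfolding in_span_axis_iff
      proof (intro allI impI)
        fix i assume i: "i \<notin> K"
        have "T j $ i = 0" using T j i in_span_axis_iff by blast
        moreover have "R $ i $ l = (if l = i then 1 else 0)" for l using R(1) i by (auto simp: block_def)
        ultimately show "(R *v T j) $ i = 0"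
          by (simp add: matrix_vector_mult_def if_distrib[of "\<lambda>x. x * _"] cong: if_cong)
      qed
      have "gram_vol K (\<lambda>j\<in>K. R *v T j) = \<bar>det (coord_matrix K (\<lambda>j\<in>K. R *v T j))\<bar>"
        by (rule gram_vol_frame_coords[OF orthonormal_on_axis]) (simp add: RT)
      then have gv: "gram_vol K (\<lambda>j\<in>K. R *v T j) = gB * \<bar>det ?C\<bar>"
        by (simp add: coord_matrix_left_mult[OF R(1)] det_mul abs_mult R(2))
      have "(\<bar>det ?C\<bar> * g) powr p * \<bar>det ?C\<bar> ^ (CARD('n) - card K) = g powr p * gB powr (- s) * (gB * \<bar>det ?C\<bar>) powr s"
      proof (cases "det ?C = 0")
        case True then show ?thesis by simp
      next
        case False
        then have D: "\<bar>det ?C\<bar> > 0" by simp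
        have "\<bar>det ?C\<bar> powr p * \<bar>det ?C\<bar> ^ (CARD('n) - card K) = \<bar>det ?C\<bar> powr s"
          by (simp only: s_def powr_add powr_realpow[OF D])
        moreover have "gB powr (- s) * gB powr s = 1"
          using g by (simp add: powr_minus)
        ultimately show ?thesis
          using g by (simp add: powr_mult mult_ac)
      qed
      then have e: "ennreal ((\<bar>det ?C\<bar> * g) powr p) * ennreal (\<bar>det ?C\<bar> ^ (CARD('n) - card K)) = ennreal (g powr p * gB powr (- s)) * ennreal ((gB * \<bar>det ?C\<bar>) powr s)"
        by (simp add: ennreal_mult[symmetric])
      have "double_integrand B p T Y = ball_tuple (\<lambda>j\<in>K. R *v T j) * gram_weight (gram K Y) *
          (ennreal ((\<bar>det ?C\<bar> * g) powr p) * ennreal (\<bar>det ?C\<bar> ^ (CARD('n) - card K)))"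
        unfolding double_integrand_def ellipsoid_power_def ind by (simp add: gram_vol_act g_def mult_ac)
      then show ?thesis unfolding e gv by (simp only: mult_ac)
    qed
    have "(\<integral>\<^sup>+T. double_integrand B p T Y \<partial>?N) = (\<integral>\<^sup>+T. ?c * ?\<phi> (\<lambda>j\<in>K. R *v T j) \<partial>?N)"
      by (rule nn_integral_cong_AE, rule eventually_mono[OF N.AE_PiM_W[of K]], simp, rule pointwise)
    also have "\<dots> = ?c * (\<integral>\<^sup>+T. ?\<phi> (\<lambda>j\<in>K. R *v T j) \<partial>?N)"
    proof (rule nn_integral_cmult)
      have "(\<lambda>T. \<lambda>j\<in>K. R *v T j) \<in> measurable ?N ?N" by measurable
      then show "(\<lambda>T. ?\<phi> (\<lambda>j\<in>K. R *v T j)) \<in> borel_measurable ?N" by (rule measurable_compose[OF _ \<phi>])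
    qed
    \<comment> \<open>\<open>R\<close> acts on each of the \<open>card K\<close> columns separately,
      and each contributes one factor \<open>1 / \<bar>det R\<bar>\<close>.\<close>
    also have "(\<integral>\<^sup>+T. ?\<phi> (\<lambda>j\<in>K. R *v T j) \<partial>?N) = (\<Prod>j\<in>K. ennreal (1 / \<bar>det R\<bar>)) * (\<integral>\<^sup>+T. ?\<phi> T \<partial>?N)"
    proof (rule N.nn_integral_PiM_componentwise[OF finite _ _ \<phi>])
      show "(*v) R \<in> measurable (coord_measure K) (coord_measure K)" by measurable
      fix h :: "real^'n \<Rightarrow> ennreal" assume "h \<in> borel_measurable (coord_measure K)"
      then show "(\<integral>\<^sup>+x. h (R *v x) \<partial>coord_measure K) = ennreal (1 / \<bar>det R\<bar>) * integral\<^sup>N (coord_measure K) h"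
        by (intro nn_integral_coord_measure_matrix R detR) simp
    qed
    also have "\<dots> = ennreal (gB powr (- real (card K))) * ?Mk"
      using g by (simp add: Mk R(2) ennreal_power powr_minus powr_realpow power_one_over inverse_eq_divide)
    also have "?c * (ennreal (gB powr (- real (card K))) * ?Mk) = ?Mk * (ball_tuple Y * (ennreal (g ^ CARD('n)) * ennreal (g powr p * gB powr (- s)) * ennreal (gB powr (- real (card K)))))"
      by (simp add: gram_weight_gram g_def mult_ac)
    \<comment> \<open>The exponents of \<open>gB\<close> add up to minus those of \<open>g\<close>,
      so that only the quotient remains; this fixes the power of the Gram volume in the
      weight.\<close>
    also have "ennreal (g ^ CARD('n)) * ennreal (g powr p * gB powr (- s)) * ennreal (gB powr (- real (card K))) = ennreal ((g / gB) powr (p + CARD('n)))"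
    proof -
      have "- s + - real (card K) = - (p + CARD('n))" using kd by (simp add: s_def of_nat_diff)
      then have "gB powr (- s) * gB powr (- real (card K)) = gB powr (- (p + CARD('n)))"
        by (simp only: powr_add[symmetric])
      moreover have "g ^ CARD('n) * g powr p = g powr (p + CARD('n))"
        using g by (simp add: powr_add powr_realpow)
      ultimately have "g ^ CARD('n) * (g powr p * gB powr (- s)) * gB powr (- real (card K)) = g powr (p + CARD('n)) * gB powr (- (p + CARD('n)))"
        by (metis (no_types, lifting) mult.assoc)
      also have "\<dots> = (g / gB) powr (p + CARD('n))"
        using g by (simp only: powr_divide powr_minus_divide times_divide_eq_right mult_1_right)
      finally show ?thesis using g by (simp add: ennreal_mult[symmetric])
    qed
    finally show ?thesis by (simp add: g_def gB_def)
  qed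
  have G: "(\<lambda>Y. ball_tuple Y * ennreal ((gram_vol K Y / gram_vol K (\<lambda>j. B *v Y j)) powr (p + CARD('n)))) \<in> borel_measurable ?L"
  proof -
    have [measurable]: "(\<lambda>T. gram_vol K T) \<in> borel_measurable ?L" "(\<lambda>T. ball_tuple T) \<in> borel_measurable ?L"
       "(\<lambda>Y. gram_vol K (\<lambda>j. B *v Y j)) \<in> borel_measurable ?L"
      by (intro borel_measurable_gram_vol borel_measurable_ball_tuple; measurable)+
    show ?thesis by measurable
  qed
  have "(\<integral>\<^sup>+T. \<integral>\<^sup>+Y. double_integrand B p T Y \<partial>?L \<partial>?N) = (\<integral>\<^sup>+Y. \<integral>\<^sup>+T. double_integrand B p T Y \<partial>?N \<partial>?L)"
    by (rule P.Fubini'[OF measurable_double_integrand, symmetric])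
  also have "\<dots> = ?Mk * (\<integral>\<^sup>+Y. ball_tuple Y * ennreal ((gram_vol K Y / gram_vol K (\<lambda>j. B *v Y j)) powr (p + CARD('n))) \<partial>?L)"
    unfolding inner by (rule nn_integral_cmult[OF G])
  finally show ?thesis unfolding s_def .
qed

text \<open>Both evaluations hold for every invertible \<open>B\<close> with the same constants. At
  \<open>mat 1\<close> the two remaining integrals are ball moments, which determine the group
  integral \<open>c\<close>; being finite and positive, it cancels.\<close>

lemma nn_integral_ellipsoid_power:
  assumes B: "det B \<noteq> 0" and p: "p > - real CARD('n) + real (card K)"
  shows "(\<integral>\<^sup>+Y. ellipsoid_power B p Y \<partial>Pi\<^sub>M K (\<lambda>_. lborel)) * ennreal (unit_ball_vol CARD('n) ^ card K)
    = ennreal (moment_const CARD('n) p (card K)) *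
      (\<integral>\<^sup>+Y. ball_tuple Y * ennreal ((gram_vol K Y / gram_vol K (\<lambda>j. B *v Y j)) powr (p + CARD('n))) \<partial>Pi\<^sub>M K (\<lambda>_. lborel))"
proof -
  let ?L = "Pi\<^sub>M K (\<lambda>_. lborel :: (real^'n) measure)"
  define c where "c = (\<integral>\<^sup>+T. group_density T \<partial>Pi\<^sub>M K (\<lambda>_. coord_measure K))"
  define F where "F B = (\<integral>\<^sup>+Y. ellipsoid_power B p Y \<partial>?L)" for B
  define G where "G B = (\<integral>\<^sup>+Y. ball_tuple Y * ennreal ((gram_vol K Y / gram_vol K (\<lambda>j. B *v Y j)) powr (p + CARD('n))) \<partial>?L)" for B :: "real^'n^'n"
  define Mk where "Mk = moment_const (card K) (p + real (CARD('n) - card K)) (card K)"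
  define m where "m = moment_const CARD('n) p (card K)"
  define v where "v = unit_ball_vol CARD('n) ^ card K"
  have kd: "card K \<le> CARD('n)" by (simp add: card_mono)
  have s: "p + real (CARD('n) - card K) + 1 > 0" using p kd by (simp add: of_nat_diff)
  have pos: "Mk > 0" "m > 0" "v > 0"
    using p kd s unfolding Mk_def m_def v_def by (auto intro!: moment_const_pos zero_less_power)
  have FG: "F B * c = ennreal Mk * G B" if "det B \<noteq> 0" for B
    unfolding F_def G_def c_def Mk_def double_integral_right[symmetric] by (rule double_integral_left[OF that s])
  have moment: "(\<integral>\<^sup>+Y. ball_tuple Y * ennreal (gram_vol K Y powr q) \<partial>?L) = ennreal (moment_const CARD('n) q (card K))"
    if "q > - real CARD('n) + real (card K) - 1" for q
    using nn_integral_gram_vol_moment[OF orthonormal_on_axis, of K UNIV q] kd that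
    by (simp add: frame_measure_axis ball_tuple_def)
  have F1: "F (mat 1) = ennreal m"
  proof -
    have "ellipsoid_power (mat 1) p Y = ball_tuple Y * ennreal (gram_vol K Y powr p)" for Y
    proof -
      have "(\<Prod>j\<in>K. indicator {x. norm (mat 1 *v x) \<le> 1} (Y j)) = (\<Prod>j\<in>K. indicator (cball 0 1) (Y j) :: ennreal)"
        by (intro prod.cong) (auto simp: indicator_def)
      then show ?thesis unfolding ellipsoid_power_def ball_tuple_def by simp
    qed
    then show ?thesis using moment[of p] p by (simp add: F_def m_def)
  qed
  have G1: "G (mat 1) = ennreal v"
  proof -
    \<comment> \<open>On independent tuples the quotient is \<open>1\<close>. On dependent ones
      \<open>0 / 0\<close> is \<open>0\<close> and both powers are \<open>0\<close>, so this is the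
      moment integrand with exponent \<open>0\<close>.\<close>
    have "ball_tuple Y * ennreal ((gram_vol K Y / gram_vol K (\<lambda>j. mat 1 *v Y j)) powr (p + CARD('n))) = ball_tuple Y * ennreal (gram_vol K Y powr 0)" for Y
      by (cases "gram_vol K Y = 0") auto
    moreover have "moment_const CARD('n) 0 (card K) = v"
    proof -
      have "moment_const CARD('n) 0 (card K) = (\<Prod>j<card K. unit_ball_vol CARD('n))"
        unfolding moment_const_def
      proof (intro prod.cong refl)
        fix j assume "j \<in> {..<card K}"
        then have "real CARD('n) - real j > 0" using kd by auto
        then have "omega (real CARD('n) - real j) > 0" by (simp add: omega_def)
        then show "unit_ball_vol (real CARD('n) + 0) * (omega (real CARD('n) - real j) / omega (real CARD('n) - real j + 0)) = unit_ball_vol CARD('n)"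
          by simp
      qed
      then show ?thesis by (simp add: v_def)
    qed
    ultimately show ?thesis using moment[of 0] kd by (simp add: G_def)
  qed
  have mc: "ennreal m * c = ennreal Mk * ennreal v"
    using FG[of "mat 1"] by (simp add: F1 G1)
  have "ennreal Mk * ennreal v \<noteq> 0" "ennreal Mk * ennreal v \<noteq> top"
    using pos by (auto simp: ennreal_mult_eq_top_iff)
  then have c: "c \<noteq> 0" "c \<noteq> top" using mc pos by (auto simp: ennreal_mult_top)
  have "c * (F B * ennreal v) = c * (ennreal m * G B)"
  proof -
    have "c * (F B * ennreal v) = ennreal v * (F B * c)" by (simp add: mult_ac)
    also have "\<dots> = (ennreal Mk * ennreal v) * G B" unfolding FG[OF B] by (simp add: mult_ac)
    also have "\<dots> = c * (ennreal m * G B)" unfolding mc[symmetric] by (simp add: mult_ac)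
    finally show ?thesis .
  qed
  then have "F B * ennreal v = ennreal m * G B" using c ennreal_mult_cancel_left[of c] by blast
  then show ?thesis unfolding F_def G_def m_def v_def .
qed

end

section \<open>Volumes of simplices and ellipsoid sections\<close>

text \<open>For the new direction: if the span has full dimension, an orthonormal basis of it is
  \<open>Y\<close> times some matrix, so \<open>1\<close> is a multiple of the Gram volume of
  \<open>Y\<close>.\<close>

lemma gram_vol_eq_0_iff:
  fixes Y :: "'n::finite \<Rightarrow> real^'n"
  shows "gram_vol K Y = 0 \<longleftrightarrow> dim (span (Y ` K)) < card K"
proof
  assume 0: "gram_vol K Y = 0"
  show "dim (span (Y ` K)) < card K"
  proof (rule ccontr)
    assume "\<not> dim (span (Y ` K)) < card K"
    then have dimY: "dim (span (Y ` K)) = card K" using dim_image_le_card[of K Y] by simp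
    obtain b where b: "orthonormal_on K b" "span (b ` K) = span (Y ` K)" "span (b ` K) = span (Y ` K)"
      using orthonormal_frame_exists[OF subspace_span subspace_span order_refl order_refl finite dimY dimY] .
    have "\<exists>u. b j = (\<Sum>i\<in>K. u i *\<^sub>R Y i)" if "j \<in> K" for j
    proof (rule in_span_image_sum[OF _ finite])
      show "b j \<in> span (Y ` K)" unfolding b(2)[symmetric] using that by (intro span_base imageI)
    qed
    then have "\<forall>j\<in>K. \<exists>u. b j = (\<Sum>i\<in>K. u i *\<^sub>R Y i)" by blast
    then obtain u where u: "\<forall>j\<in>K. b j = (\<Sum>i\<in>K. u j i *\<^sub>R Y i)" by (rule bchoice[THEN exE])
    define N :: "real^'n^'n" where "N = (\<chi> i j. if i \<in> K \<and> j \<in> K then u j i else if i = j then 1 else 0)"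
    have N: "block K N" by (auto simp: block_def N_def)
    have "gram_vol K b = gram_vol K (act K N Y)"
      by (rule gram_vol_cong) (simp add: act_def N_def u)
    then have "gram_vol K b = 0" using 0 by (simp add: gram_vol_act[OF N])
    then show False by (simp add: gram_vol_def gram_orthonormal[OF b(1)])
  qed
qed (rule gram_vol_eq_0)

text \<open>\<open>k_volume\<close> picks a frame and an offset by choice, so nothing is known of
  them beyond the defining property. As \<open>S\<close> contains \<open>0\<close>, the offset lies
  in the span of the frame and translation invariance removes it; the frame stays unspecified apart
  from containing \<open>S\<close>.\<close>

lemma k_volume_frame:
  fixes S :: "(real^'n) set" and K :: "'m::finite set"
  assumes e: "bij_betw e {1..k} K" and S: "S \<in> sets borel" "0 \<in> S"
    and ex: "\<exists>b. orthonormal_on K b \<and> S \<subseteq> span (b ` K)"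
  obtains b where "orthonormal_on K b" "S \<subseteq> span (b ` K)" "k_volume k S = measure (frame_measure K b) S"
proof -
  define inv where "inv = the_inv_into {1..k} e"
  have K: "K = e ` {1..k}" and inj: "inj_on e {1..k}" using e by (auto simp: bij_betw_def)
  have ie: "inv (e i) = i" if "i \<in> {1..k}" for i unfolding inv_def using inj that by (rule the_inv_into_f_f)
  have iK: "inv j \<in> {1..k}" "e (inv j) = j" if "j \<in> K" for j
    using that the_inv_into_into[OF inj _ subset_refl] f_the_inv_into_f[OF inj] unfolding K inv_def by blast+
  let ?P = "\<lambda>(a :: real^'n, b). orthonormal_family k b \<and> S \<subseteq> range (flat_coord k a b)"
  have sum: "(\<Sum>j\<in>K. c (inv j) *\<^sub>R b (inv j)) = (\<Sum>i=1..k. c i *\<^sub>R b i)" for c and b :: "nat \<Rightarrow> real^'n"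
  proof -
    have "(\<Sum>j\<in>K. c (inv j) *\<^sub>R b (inv j)) = (\<Sum>i=1..k. c (inv (e i)) *\<^sub>R b (inv (e i)))"
      by (rule sum.reindex_bij_betw[OF e, symmetric])
    also have "\<dots> = (\<Sum>i=1..k. c i *\<^sub>R b i)"
      by (rule sum.cong[OF refl]) (simp only: ie)
    finally show ?thesis .
  qed
  have "\<exists>ab. ?P ab"
  proof -
    from ex obtain b where b: "orthonormal_on K b" "S \<subseteq> span (b ` K)" by blast
    have "orthonormal_family k (\<lambda>i. b (e i))"
      unfolding orthonormal_family_def
    proof (intro ballI)
      fix i j assume ij: "i \<in> {1..k}" "j \<in> {1..k}"
      then have "e i \<in> K" "e j \<in> K" "e i = e j \<longleftrightarrow> i = j" using inj K by (auto simp: inj_on_eq_iff)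
      then show "b (e i) \<bullet> b (e j) = (if i = j then 1 else 0)" using b(1) unfolding orthonormal_on_def by simp
    qed
    moreover have "S \<subseteq> range (flat_coord k 0 (\<lambda>i. b (e i)))"
    proof
      fix x assume "x \<in> S"
      then have "x \<in> span (b ` K)" using b(2) by blast
      from in_span_image_sum[OF this finite] obtain u where "x = (\<Sum>j\<in>K. u j *\<^sub>R b j)" by (rule exE)
      also have "\<dots> = (\<Sum>i=1..k. u (e i) *\<^sub>R b (e i))"
        by (rule sum.reindex_bij_betw[OF e, symmetric])
      finally have "x = flat_coord k 0 (\<lambda>i. b (e i)) (\<lambda>i. u (e i))"
        unfolding flat_coord_def by simp
      then show "x \<in> range (flat_coord k 0 (\<lambda>i. b (e i)))" by blast
    qed
    ultimately show ?thesis by (intro exI[of _ "(0, \<lambda>i. b (e i))"]) simp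
  qed
  then have P: "?P (SOME ab. ?P ab)" by (rule someI_ex)
  obtain a b where ab: "(SOME ab. ?P ab) = (a, b)" by (cases "SOME ab. ?P ab")
  have b: "orthonormal_family k b" "S \<subseteq> range (flat_coord k a b)" using P unfolding ab by auto
  define b' where "b' j = b (inv j)" for j
  have b': "orthonormal_on K b'"
    unfolding orthonormal_on_def
  proof (intro ballI)
    fix i j assume ij: "i \<in> K" "j \<in> K"
    have "inv i = inv j \<longleftrightarrow> i = j" using iK(2)[OF ij(1)] iK(2)[OF ij(2)] by metis
    then show "b' i \<bullet> b' j = (if i = j then 1 else 0)"
      using b(1) iK(1)[OF ij(1)] iK(1)[OF ij(2)] unfolding orthonormal_family_def b'_def by simp
  qed
  have range: "range (flat_coord k a b) \<subseteq> (+) a ` span (b' ` K)"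
  proof
    fix x assume "x \<in> range (flat_coord k a b)"
    then obtain c where "x = a + (\<Sum>i=1..k. c i *\<^sub>R b i)" by (auto simp: flat_coord_def)
    then have "x = a + (\<Sum>j\<in>K. c (inv j) *\<^sub>R b' j)" by (simp only: sum b'_def)
    moreover have "(\<Sum>j\<in>K. c (inv j) *\<^sub>R b' j) \<in> span (b' ` K)"
      by (intro span_sum span_scale span_base) auto
    ultimately show "x \<in> (+) a ` span (b' ` K)" by blast
  qed
  have "0 \<in> (+) a ` span (b' ` K)" using S(2) b(2) range by blast
  then obtain y where y: "y \<in> span (b' ` K)" "0 = a + y" by blast
  then have a: "a \<in> span (b' ` K)" using span_neg[OF y(1)] by (simp add: add_eq_0_iff2)
  have Ssub: "S \<subseteq> span (b' ` K)"
  proof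
    fix x assume "x \<in> S"
    then obtain z where "z \<in> span (b' ` K)" "x = a + z" using b(2) range by blast
    then show "x \<in> span (b' ` K)" using span_add[OF a] by simp
  qed
  interpret homogeneous_measure "frame_measure K b'" "span (b' ` K)" "card K"
    by (rule homogeneous_frame_measure[OF b'])
  let ?M = "Pi\<^sub>M {1..k} (\<lambda>_. lborel :: real measure)"
  have [measurable]: "S \<in> sets borel" by fact
  have sets: "{c \<in> space ?M. flat_coord k a b c \<in> S} \<in> sets ?M"
    unfolding flat_coord_def by measurable
  have "emeasure ?M {c \<in> space ?M. flat_coord k a b c \<in> S} = (\<integral>\<^sup>+c. indicator S (flat_coord k a b c) \<partial>?M)"
    by (subst nn_integral_indicator[OF sets, symmetric]) (intro nn_integral_cong, auto simp: indicator_def)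
  also have "\<dots> = (\<integral>\<^sup>+c. indicator S (a + (\<Sum>j\<in>K. (\<lambda>j\<in>K. c (inv j)) j *\<^sub>R b' j)) \<partial>?M)"
  proof -
    have "(\<Sum>j\<in>K. (\<lambda>j\<in>K. c (inv j)) j *\<^sub>R b' j) = (\<Sum>i=1..k. c i *\<^sub>R b i)" for c
      unfolding sum[symmetric] b'_def by (rule sum.cong) auto
    then show ?thesis by (simp only: flat_coord_def)
  qed
  also have "\<dots> = (\<integral>\<^sup>+c. indicator S (a + (\<Sum>j\<in>K. c j *\<^sub>R b' j)) \<partial>Pi\<^sub>M K (\<lambda>_. lborel))"
    by (rule nn_integral_PiM_reindex[OF _ e, symmetric, folded inv_def]) (auto intro: lborel.sigma_finite_measure_axioms)
  also have "\<dots> = (\<integral>\<^sup>+x. indicator S (x + a) \<partial>frame_measure K b')"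
    by (subst nn_integral_frame_measure) (auto simp: add.commute)
  also have "\<dots> = emeasure (frame_measure K b') S"
    by (subst translate[OF a]) auto
  finally have "k_volume k S = measure (frame_measure K b') S"
    unfolding k_volume_def ab by (simp add: measure_def)
  then show thesis using that b' Ssub by blast
qed

text \<open>In coordinates of the frame, the section is the preimage of the unit ball under the
  coordinate matrix of the vectors \<open>B *v b j\<close>.\<close>

lemma frame_measure_matrix_ball:
  fixes B :: "real^'n^'n" and b :: "'n \<Rightarrow> real^'n"
  assumes b: "orthonormal_on K b" and B: "det B \<noteq> 0"
  shows "emeasure (frame_measure K b) {x. norm (B *v x) \<le> 1} = ennreal (unit_ball_vol (card K) / gram_vol K (\<lambda>j. B *v b j))"
proof -
  let ?W = "\<lambda>j. B *v b j"
  interpret homogeneous_measure "coord_measure K" "span ((\<lambda>i. axis i 1) ` K)" "card K"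
    by (rule homogeneous_frame_measure[OF orthonormal_on_axis])
  have [measurable]: "(\<lambda>x. A *v x) \<in> borel_measurable borel" for A :: "real^'n^'n"
    by (intro borel_measurable_continuous_onI continuous_intros)
  have "gram_vol K b \<noteq> 0" by (simp add: gram_vol_def gram_orthonormal[OF b])
  then have W: "gram_vol K ?W \<noteq> 0" using B by (rule gram_vol_matrix_nonzero)
  obtain b2 where b2: "orthonormal_on UNIV b2" "\<And>j. j \<in> K \<Longrightarrow> ?W j \<in> span (b2 ` K)" using ex_frame_coords[of K ?W] by blast
  have bK: "orthonormal_on K b2" using b2(1) by (rule orthonormal_on_subset) simp
  define R where "R = frame_coords K b2 ?W"
  have R: "block K R" "\<bar>det R\<bar> = gram_vol K ?W" using gram_vol_frame_coords[OF bK b2(2)] by (auto simp: R_def)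
  have detR: "det R \<noteq> 0" using R W by auto
  have [measurable]: "{x. norm (B *v x) \<le> 1} \<in> sets borel" by measurable
  have [measurable]: "cball (0::real^'n) 1 \<in> sets borel" by simp
  have [measurable]: "{t::real^'n. norm (\<Sum>i\<in>K. t $ i *\<^sub>R ?W i) \<le> 1} \<in> sets borel"
    by (intro borel_closed closed_Collect_le continuous_intros)
  have comp: "(\<Sum>i\<in>K. c i *\<^sub>R axis i 1 :: real^'n) $ j = (if j \<in> K then c j else 0)" for c j
    by (simp add: axis_def if_distrib cong: if_cong)
  have "emeasure (frame_measure K b) {x. norm (B *v x) \<le> 1} = (\<integral>\<^sup>+c. indicator {x. norm (B *v x) \<le> 1} (\<Sum>i\<in>K. c i *\<^sub>R b i) \<partial>Pi\<^sub>M K (\<lambda>_. lborel))"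
    using nn_integral_frame_measure[of "indicator {x. norm (B *v x) \<le> 1}" K b] by (simp add: nn_integral_indicator)
  also have "\<dots> = (\<integral>\<^sup>+c. indicator {t. norm (\<Sum>i\<in>K. t $ i *\<^sub>R ?W i) \<le> 1} (\<Sum>i\<in>K. c i *\<^sub>R axis i 1) \<partial>Pi\<^sub>M K (\<lambda>_. lborel))"
    unfolding indicator_def mem_Collect_eq comp
    by (simp add: linear_sum[OF matrix_vector_mul_linear] matrix_vector_mult_scaleR)
  also have "\<dots> = (\<integral>\<^sup>+t. indicator {t. norm (\<Sum>i\<in>K. t $ i *\<^sub>R ?W i) \<le> 1} t \<partial>coord_measure K)"
    by (rule nn_integral_frame_measure[symmetric]) measurable
  also have "\<dots> = (\<integral>\<^sup>+t. indicator (cball 0 1) (R *v t) \<partial>coord_measure K)"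
  proof (rule nn_integral_cong_AE, rule eventually_mono[OF AE_W])
    fix t :: "real^'n" assume "t \<in> span ((\<lambda>i. axis i 1) ` K)"
    from frame_coords_cong_norm[OF bK b2(2) this]
    show "indicator {t. norm (\<Sum>i\<in>K. t $ i *\<^sub>R ?W i) \<le> 1} t = (indicator (cball 0 1) (R *v t) :: ennreal)"
      by (simp add: indicator_def R_def)
  qed
  also have "\<dots> = ennreal (1 / \<bar>det R\<bar>) * (\<integral>\<^sup>+t. indicator (cball 0 1) t \<partial>coord_measure K)"
    by (rule nn_integral_coord_measure_matrix[OF R(1) detR]) measurable
  also have "(\<integral>\<^sup>+t. indicator (cball 0 1) t \<partial>coord_measure K) = ennreal (unit_ball_vol (card K))"
    using emeasure_frame_measure_cball[OF orthonormal_on_axis, of 1 K] by (simp add: nn_integral_indicator)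
  finally show ?thesis using R(2) by (simp add: ennreal_mult'[symmetric])
qed

text \<open>The quotient is unchanged when \<open>Y\<close> is multiplied by an invertible matrix,
  so it may be computed for an orthonormal basis of the span, where the numerator is
  \<open>1\<close>.\<close>

lemma k_volume_ellipsoid_section:
  fixes Y :: "'n \<Rightarrow> real^'n" and B :: "real^'n^'n"
  assumes e: "bij_betw e {1..k} K" and Y: "gram_vol K Y \<noteq> 0" and B: "det B \<noteq> 0"
  shows "k_volume k ({x. norm (B *v x) \<le> 1} \<inter> span (Y ` K))
     = unit_ball_vol k * (gram_vol K Y / gram_vol K (\<lambda>j. B *v Y j))"
proof -
  let ?S = "{x. norm (B *v x) \<le> 1} \<inter> span (Y ` K)"
  have k: "k = card K" using bij_betw_same_card[OF e] by simp
  have dimY: "dim (span (Y ` K)) = card K"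
    using Y gram_vol_eq_0_iff[of K Y] dim_image_le_card[of K Y] by simp
  have "closed {x. norm (B *v x) \<le> 1}"
    by (intro closed_Collect_le continuous_intros)
  then have S: "?S \<in> sets borel" "0 \<in> ?S"
    by (auto simp: span_zero closed_subspace closed_Int)
  obtain b0 where "orthonormal_on K b0" "span (b0 ` K) = span (Y ` K)" "span (b0 ` K) = span (Y ` K)"
    using orthonormal_frame_exists[OF subspace_span subspace_span order_refl order_refl finite dimY dimY] .
  then have ex: "\<exists>b. orthonormal_on K b \<and> ?S \<subseteq> span (b ` K)" by blast
  obtain b where b: "orthonormal_on K b" "?S \<subseteq> span (b ` K)" "k_volume k ?S = measure (frame_measure K b) ?S"
    using k_volume_frame[OF e S ex] .
  \<comment> \<open>The frame is known only to contain the section. Every vector of the span has a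
    small multiple inside the ellipsoid, so the frame spans all of it.\<close>
  have sub: "span (Y ` K) \<subseteq> span (b ` K)"
  proof
    fix x assume x: "x \<in> span (Y ` K)"
    let ?c = "1 / (1 + norm (B *v x))"
    have c: "?c > 0" by (simp add: add_pos_nonneg)
    have "norm (B *v (?c *\<^sub>R x)) \<le> 1"
      by (simp add: matrix_vector_mult_scaleR divide_simps add_pos_nonneg)
    then have "?c *\<^sub>R x \<in> ?S" using span_scale[OF x] by blast
    then have "?c *\<^sub>R x \<in> span (b ` K)" using b(2) by blast
    then show "x \<in> span (b ` K)" using span_scale[of "?c *\<^sub>R x" "b ` K" "1 / ?c"] c by simp
  qed
  have eq: "span (Y ` K) = span (b ` K)"
    by (rule subspace_dim_equal) (auto simp: sub dimY dim_span_orthonormal[OF b(1)] simp del: dim_span)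
  interpret homogeneous_measure "frame_measure K b" "span (b ` K)" "card K"
    by (rule homogeneous_frame_measure[OF b(1)])
  have "emeasure (frame_measure K b) ?S = emeasure (frame_measure K b) {x. norm (B *v x) \<le> 1}"
    using AE_W S(1) \<open>closed _\<close> by (intro emeasure_eq_AE) (auto simp: eq)
  also have "\<dots> = ennreal (unit_ball_vol (card K) / gram_vol K (\<lambda>j. B *v b j))"
    by (rule frame_measure_matrix_ball[OF b(1) B])
  finally have vol: "k_volume k ?S = unit_ball_vol k / gram_vol K (\<lambda>j. B *v b j)"
    unfolding b(3) by (simp add: measure_def k)
  let ?C = "frame_coords K b Y"
  have Yb: "Y j \<in> span (b ` K)" if "j \<in> K" for j
    unfolding eq[symmetric] using that by (intro span_base) auto
  have "gram_vol K (\<lambda>j. B *v Y j) = gram_vol K (act K ?C (\<lambda>i. B *v b i))"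
  proof (rule gram_vol_cong)
    fix j assume j: "j \<in> K"
    have "Y j = act K ?C b j" using act_frame_coords[OF b(1) Yb] j by simp
    then show "B *v Y j = act K ?C (\<lambda>i. B *v b i) j" using j by (simp add: matrix_vector_act)
  qed
  then have "gram_vol K (\<lambda>j. B *v Y j) = gram_vol K Y * gram_vol K (\<lambda>j. B *v b j)"
    using gram_vol_frame_coords[OF b(1) Yb] by (simp add: gram_vol_act)
  then show ?thesis unfolding vol using Y by simp
qed

text \<open>The vertex \<open>0\<close> takes the remaining weight \<open>1 - sum u K\<close>, which
  turns the usual equation for the weights into an inequality.\<close>

lemma convex_hull_insert_0_image:
  fixes Y :: "'i \<Rightarrow> 'a::real_vector"
  assumes "finite K"
  shows "convex hull (insert 0 (Y ` K)) = {(\<Sum>j\<in>K. u j *\<^sub>R Y j) | u. (\<forall>j\<in>K. 0 \<le> u j) \<and> sum u K \<le> 1}" (is "_ = ?T")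
proof
  show "convex hull (insert 0 (Y ` K)) \<subseteq> ?T"
  proof (rule hull_minimal)
    have "0 \<in> ?T" by (intro CollectI exI[of _ "\<lambda>_. 0"]) simp
    moreover have "Y i \<in> ?T" if "i \<in> K" for i
      using assms that by (intro CollectI exI[of _ "\<lambda>j. if j = i then 1 else 0"]) (auto simp: if_distrib[of "\<lambda>x. x *\<^sub>R _"] cong: if_cong)
    ultimately show "insert 0 (Y ` K) \<subseteq> ?T" by blast
    show "convex ?T"
      unfolding convex_def
    proof (intro ballI allI impI)
      fix x y a b assume xy: "x \<in> ?T" "y \<in> ?T" and ab: "0 \<le> (a::real)" "0 \<le> b" "a + b = 1"
      then obtain u w where u: "x = (\<Sum>j\<in>K. u j *\<^sub>R Y j)" "\<forall>j\<in>K. 0 \<le> u j" "sum u K \<le> 1"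
        and w: "y = (\<Sum>j\<in>K. w j *\<^sub>R Y j)" "\<forall>j\<in>K. 0 \<le> w j" "sum w K \<le> 1" by blast
      have "a * sum u K + b * sum w K \<le> a * 1 + b * 1"
        using u(3) w(3) ab by (intro add_mono mult_left_mono) auto
      then have "(\<Sum>j\<in>K. a * u j + b * w j) \<le> 1"
        using ab by (simp add: sum.distrib sum_distrib_left)
      moreover have "a *\<^sub>R x + b *\<^sub>R y = (\<Sum>j\<in>K. (a * u j + b * w j) *\<^sub>R Y j)"
        by (simp add: u(1) w(1) scaleR_sum_right scaleR_add_left sum.distrib)
      ultimately show "a *\<^sub>R x + b *\<^sub>R y \<in> ?T"
        using u(2) w(2) ab by (intro CollectI exI[of _ "\<lambda>j. a * u j + b * w j"]) auto
    qed
  qed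
  show "?T \<subseteq> convex hull (insert 0 (Y ` K))"
  proof
    fix x assume "x \<in> ?T"
    then obtain u where u: "x = (\<Sum>j\<in>K. u j *\<^sub>R Y j)" "\<forall>j\<in>K. 0 \<le> u j" "sum u K \<le> 1" by blast
    let ?H = "convex hull (insert 0 (Y ` K))"
    have conv: "convex ?H" by (rule convex_convex_hull)
    have mem: "0 \<in> ?H" "\<And>j. j \<in> K \<Longrightarrow> Y j \<in> ?H" by (auto intro: hull_inc)
    show "x \<in> ?H"
    proof (cases "sum u K = 0")
      case True
      then have "\<forall>j\<in>K. u j = 0" using u(2) assms by (simp add: sum_nonneg_eq_0_iff)
      then show ?thesis using mem(1) u(1) by simp
    next
      case False
      then have pos: "sum u K > 0" using u(2) sum_nonneg[of K u] by force
      have "(\<Sum>j\<in>K. (u j / sum u K) *\<^sub>R Y j) \<in> ?H"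
        using u(2) pos mem assms by (intro convex_sum[OF _ conv]) (auto simp: sum_divide_distrib[symmetric])
      then have "(1 - sum u K) *\<^sub>R 0 + sum u K *\<^sub>R (\<Sum>j\<in>K. (u j / sum u K) *\<^sub>R Y j) \<in> ?H"
        using mem(1) u(3) pos by (intro convexD[OF conv]) auto
      then show ?thesis using pos u(1) by (simp add: scaleR_sum_right)
    qed
  qed
qed

text \<open>In coordinates, coefficient \<open>i\<close> vanishes on this subspace, and a single
  point of the line is a null set.\<close>

lemma emeasure_frame_measure_hyperplane:
  fixes b :: "'n::finite \<Rightarrow> 'a::euclidean_space"
  assumes b: "orthonormal_on K b" and i: "i \<in> K"
  shows "emeasure (frame_measure K b) (span (b ` (K - {i}))) = 0"
proof -
  let ?M = "Pi\<^sub>M K (\<lambda>_. lborel :: real measure)"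
  interpret finite_product_sigma_finite "\<lambda>_. lborel :: real measure" K by standard simp
  let ?A = "\<lambda>j. if j = i then {0} else UNIV :: real set"
  have [measurable]: "span (b ` (K - {i})) \<in> sets borel" using closed_subspace[OF subspace_span] by auto
  have sub: "(\<lambda>c. \<Sum>i\<in>K. c i *\<^sub>R b i) -` span (b ` (K - {i})) \<inter> space ?M \<subseteq> Pi\<^sub>E K ?A"
  proof
    fix c assume c: "c \<in> (\<lambda>c. \<Sum>i\<in>K. c i *\<^sub>R b i) -` span (b ` (K - {i})) \<inter> space ?M"
    then have "(\<Sum>i\<in>K. c i *\<^sub>R b i) \<in> span (b ` (K - {i}))" by simp
    from in_span_image_sum[OF this finite] obtain u where u: "(\<Sum>i\<in>K. c i *\<^sub>R b i) = (\<Sum>l\<in>K-{i}. u l *\<^sub>R b l)" by (rule exE)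
    have "(\<Sum>l\<in>K-{i}. u l *\<^sub>R b l) \<bullet> b i = 0"
      unfolding inner_sum_left using b i by (intro sum.neutral) (auto simp: orthonormal_on_def)
    then have "c i = 0" using inner_orthonormal_sum[OF b finite i, of c] u by simp
    then show "c \<in> Pi\<^sub>E K ?A" using c by (auto simp: space_PiM PiE_def Pi_def)
  qed
  have "emeasure (frame_measure K b) (span (b ` (K - {i}))) = emeasure ?M ((\<lambda>c. \<Sum>i\<in>K. c i *\<^sub>R b i) -` span (b ` (K - {i})) \<inter> space ?M)"
    unfolding frame_measure_def by (rule emeasure_distr) measurable
  also have "\<dots> \<le> emeasure ?M (Pi\<^sub>E K ?A)"
    by (rule emeasure_mono[OF sub]) (auto intro!: sets_PiM_I_finite)
  also have "\<dots> = (\<Prod>j\<in>K. emeasure lborel (?A j))"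
    by (subst lborel_real.emeasure_PiM) auto
  also have "\<dots> = 0" using i by (intro prod_zero) auto
  finally show ?thesis by simp
qed

text \<open>Independent vectors: the simplex is the image of the standard simplex, of volume
  \<open>1 / fact k\<close>, under the coordinate matrix. Dependent vectors: the simplex lies in a
  hyperplane, and both sides are \<open>0\<close>.\<close>

lemma k_volume_simplex:
  fixes Y :: "'n \<Rightarrow> real^'n"
  assumes e: "bij_betw e {1..k} K"
  shows "k_volume k (convex hull (insert 0 (Y ` K))) = gram_vol K Y / fact k"
proof -
  let ?S = "convex hull (insert 0 (Y ` K))"
  have k: "k = card K" using bij_betw_same_card[OF e] by simp
  have "compact ?S" by (intro finite_imp_compact_convex_hull) auto
  then have S[measurable]: "?S \<in> sets borel" by (intro borel_compact)
  have S0: "0 \<in> ?S" by (auto intro: hull_inc)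
  have SY: "?S \<subseteq> span (Y ` K)"
    by (rule hull_minimal) (auto intro: span_base span_zero subspace_imp_convex)
  have dimU: "dim (UNIV :: (real^'n) set) = card (UNIV :: 'n set)" by simp
  have dimY: "dim (span (Y ` K)) \<le> card K" by (rule dim_image_le_card) simp
  obtain b0 where b0: "orthonormal_on (UNIV::'n set) b0" "span (Y ` K) \<subseteq> span (b0 ` K)"
    using orthonormal_frame_superset[OF subspace_span subspace_UNIV subset_UNIV subset_UNIV finite dimY dimU] .
  have ex: "\<exists>b. orthonormal_on K b \<and> ?S \<subseteq> span (b ` K)"
    using b0 SY orthonormal_on_subset[OF b0(1) subset_UNIV] by blast
  obtain b where b: "orthonormal_on K b" "?S \<subseteq> span (b ` K)" "k_volume k ?S = measure (frame_measure K b) ?S"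
    using k_volume_frame[OF e S S0 ex] .
  have Yb: "Y j \<in> span (b ` K)" if "j \<in> K" for j
    using b(2) that by (auto intro: hull_inc)
  have YbK: "span (Y ` K) \<subseteq> span (b ` K)" using Yb by (intro span_minimal) auto
  have "emeasure (frame_measure K b) ?S = ennreal (gram_vol K Y / fact k)"
  proof (cases "gram_vol K Y = 0")
    case True
    then have less: "dim (span (Y ` K)) < card K" by (simp only: gram_vol_eq_0_iff)
    then obtain i where i: "i \<in> K" by (metis all_not_in_conv card.empty not_less_zero)
    have dimY': "dim (span (Y ` K)) \<le> card (K - {i})" using less i by simp
    \<comment> \<open>The frame \<open>b\<close> need not be adapted to the span of
      \<open>Y\<close>; an adapted frame of the same space carries the same measure.\<close>
    obtain b' where b': "orthonormal_on K b'" "span (Y ` K) \<subseteq> span (b' ` (K - {i}))" "span (b' ` K) = span (b ` K)"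
      using orthonormal_frame_superset[OF subspace_span subspace_span YbK Diff_subset finite dimY' dim_span_orthonormal[OF b(1)]] .
    have "span (b' ` (K - {i})) \<in> sets borel" using closed_subspace[OF subspace_span] by auto
    then have "emeasure (frame_measure K b) ?S \<le> emeasure (frame_measure K b) (span (b' ` (K - {i})))"
      using SY b'(2) by (intro emeasure_mono) auto
    also have "frame_measure K b = frame_measure K b'"
      by (rule frame_measure_cong_span[OF b(1) b'(1) b'(3)[symmetric]])
    also have "emeasure (frame_measure K b') (span (b' ` (K - {i}))) = 0"
      by (rule emeasure_frame_measure_hyperplane[OF b'(1) i])
    finally show ?thesis using True \<open>frame_measure K b = frame_measure K b'\<close> by simp
  next
    case False
    let ?C = "frame_coords K b Y"
    have C: "gram_vol K Y = \<bar>det ?C\<bar>" by (rule gram_vol_frame_coords[OF b(1) Yb])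
    have detC: "det ?C \<noteq> 0" using False C by simp
    let ?M = "Pi\<^sub>M K (\<lambda>_. lborel :: real measure)"
    let ?h = "\<lambda>c. indicator ?S (\<Sum>i\<in>K. c i *\<^sub>R b i) :: ennreal"
    \<comment> \<open>Barycentric weights are mapped to frame coefficients by \<open>?C\<close>; as
      \<open>act\<close> multiplies from the right, this is the action of its transpose.\<close>
    have comb: "(\<Sum>i\<in>K. act K (transpose ?C) u i *\<^sub>R b i) = (\<Sum>j\<in>K. u j *\<^sub>R Y j)" for u
    proof -
      have "(\<Sum>i\<in>K. act K (transpose ?C) u i *\<^sub>R b i) = (\<Sum>i\<in>K. \<Sum>j\<in>K. (?C $ i $ j * u j) *\<^sub>R b i)"
        by (intro sum.cong) (auto simp: act_def transpose_def scaleR_sum_left)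
      also have "\<dots> = (\<Sum>j\<in>K. u j *\<^sub>R (\<Sum>i\<in>K. ?C $ i $ j *\<^sub>R b i))"
        by (subst sum.swap) (simp add: scaleR_sum_right mult.commute)
      also have "\<dots> = (\<Sum>j\<in>K. u j *\<^sub>R Y j)"
        using orthonormal_expansion[OF b(1) finite Yb] by (intro sum.cong) (auto simp: frame_coords_def)
      finally show ?thesis .
    qed
    have uniq: "u j = w j" if eq: "(\<Sum>j\<in>K. u j *\<^sub>R Y j) = (\<Sum>j\<in>K. w j *\<^sub>R Y j)" and j: "j \<in> K" for u w j
    proof -
      have "act K (transpose ?C) u i = act K (transpose ?C) w i" if "i \<in> K" for i
        using inner_orthonormal_sum[OF b(1) finite that, of "act K (transpose ?C) u"]
          inner_orthonormal_sum[OF b(1) finite that, of "act K (transpose ?C) w"] eq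
        unfolding comb by simp
      then have "act K (transpose ?C) u = act K (transpose ?C) w"
        by (auto simp: fun_eq_iff act_def)
      then have "act K (cramer_inv (transpose ?C)) (act K (transpose ?C) u) = act K (cramer_inv (transpose ?C)) (act K (transpose ?C) w)"
        by simp
      then have "restrict u K = restrict w K"
        using detC cramer_inv_right[of "transpose ?C"] by (simp add: act_mult det_transpose act_mat_1)
      then show ?thesis using j by (metis restrict_apply')
    qed
    have simplex: "(\<Sum>j\<in>K. u j *\<^sub>R Y j) \<in> ?S \<longleftrightarrow> (\<forall>j\<in>K. 0 \<le> u j) \<and> sum u K \<le> 1" for u
    proof
      assume "(\<Sum>j\<in>K. u j *\<^sub>R Y j) \<in> ?S"
      then obtain w where w: "(\<Sum>j\<in>K. u j *\<^sub>R Y j) = (\<Sum>j\<in>K. w j *\<^sub>R Y j)" "\<forall>j\<in>K. 0 \<le> w j" "sum w K \<le> 1"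
        unfolding convex_hull_insert_0_image[OF finite] by blast
      have "\<forall>j\<in>K. u j = w j" using uniq[OF w(1)] by blast
      then show "(\<forall>j\<in>K. 0 \<le> u j) \<and> sum u K \<le> 1" using w(2,3) by simp
    qed (auto simp: convex_hull_insert_0_image)
    have hm: "?h \<in> borel_measurable ?M" by measurable
    have "(\<integral>\<^sup>+c. ?h (act K (transpose ?C) c) \<partial>?M) = (\<integral>\<^sup>+c. indicator ({u. (\<forall>j\<in>K. 0 \<le> u j) \<and> sum u K \<le> 1} \<inter> space ?M) c \<partial>?M)"
      unfolding comb by (intro nn_integral_cong) (auto simp: indicator_def simplex)
    also have "\<dots> = emeasure ?M ({u. (\<forall>j\<in>K. 0 \<le> u j) \<and> sum u K \<le> 1} \<inter> space ?M)"
      by (rule nn_integral_indicator) measurable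
    also have "\<dots> = ennreal (1 / fact k)"
      using emeasure_std_simplex_aux[where t = 1 and A = K] by (simp add: k)
    finally have "ennreal (1 / fact k) = ennreal (1 / \<bar>det (transpose ?C)\<bar> ^ 1) * (\<integral>\<^sup>+c. ?h c \<partial>?M)"
      using detC by (subst (asm) lborel_real.nn_integral_act[OF _ _ hm]) (auto simp: det_transpose)
    then have "ennreal \<bar>det ?C\<bar> * ennreal (1 / fact k) = ennreal \<bar>det ?C\<bar> * (ennreal (1 / \<bar>det ?C\<bar>) * (\<integral>\<^sup>+c. ?h c \<partial>?M))"
      by (simp add: det_transpose)
    then have "(\<integral>\<^sup>+c. ?h c \<partial>?M) = ennreal (gram_vol K Y / fact k)"
      using detC by (simp add: mult.assoc[symmetric] ennreal_mult'[symmetric] C)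
    then show ?thesis
      using nn_integral_frame_measure[of "indicator ?S" K b] by (simp add: nn_integral_indicator)
  qed
  then show ?thesis unfolding b(3) by (simp add: measure_def)
qed

section \<open>Random rotations\<close>

lemma rotation_matrix_inner:
  assumes "orthogonal_matrix (Q :: real^'n^'n)"
  shows "(Q *v x) \<bullet> (Q *v y) = x \<bullet> y"
  using assms orthogonal_transformation_matrix[of "(*v) Q"] by (auto simp: orthogonal_transformation_def)

lemma rotation_matrix_norm:
  assumes "orthogonal_matrix (Q :: real^'n^'n)"
  shows "norm (Q *v x) = norm x"
  using rotation_matrix_inner[OF assms, of x x] by (simp add: norm_eq_sqrt_inner)

lemma rotation_matrix_mult:
  fixes A B :: "real^'n^'n"
  shows "rotation_matrix A \<Longrightarrow> rotation_matrix B \<Longrightarrow> rotation_matrix (A ** B)"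
  using orthogonal_matrix_mul[of A B] by (simp add: rotation_matrix_def det_mul)

lemma rotation_matrix_transpose:
  fixes A :: "real^'n^'n"
  shows "rotation_matrix A \<Longrightarrow> rotation_matrix (transpose A)"
  by (simp add: rotation_matrix_def det_transpose)

lemma gram_orthogonal_matrix:
  fixes Q :: "real^'n^'n"
  shows "orthogonal_matrix Q \<Longrightarrow> gram K (\<lambda>j. Q *v Y j) = gram K Y"
  by (simp add: gram_def vec_eq_iff rotation_matrix_inner)

lemma gram_vol_orthogonal_matrix:
  fixes Q :: "real^'n^'n"
  shows "orthogonal_matrix Q \<Longrightarrow> gram_vol K (\<lambda>j. Q *v Y j) = gram_vol K Y"
  by (simp add: gram_vol_def gram_orthogonal_matrix)

text \<open>A vanishing residual yields the vector \<open>0\<close>, since inversion at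
  \<open>0\<close> gives \<open>0\<close>; orthonormality is therefore claimed for independent
  inputs.\<close>

function gram_schmidt :: "(nat \<Rightarrow> 'a::real_inner) \<Rightarrow> nat \<Rightarrow> 'a" where
  "gram_schmidt x n = (x n - (\<Sum>m<n. (x n \<bullet> gram_schmidt x m) *\<^sub>R gram_schmidt x m)) /\<^sub>R
     norm (x n - (\<Sum>m<n. (x n \<bullet> gram_schmidt x m) *\<^sub>R gram_schmidt x m))"
  by pat_completeness auto
termination by (relation "Wellfounded.measure snd") auto

declare gram_schmidt.simps[simp del]

lemma gram_schmidt_in_span: "gram_schmidt x n \<in> span (x ` {..n})"
proof (induction n rule: less_induct)
  case (less n)
  have "gram_schmidt x m \<in> span (x ` {..n})" if "m < n" for m
  proof (rule subsetD)
    show "span (x ` {..m}) \<subseteq> span (x ` {..n})" using that by (intro span_mono image_mono) auto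
  qed (rule less[OF that])
  moreover have "x n \<in> span (x ` {..n})" by (intro span_base) auto
  ultimately show ?case
    by (subst gram_schmidt.simps) (intro span_scale span_diff span_sum, auto)
qed

text \<open>Restricting to \<open>j \<le> i\<close> suits strong induction on the larger index;
  symmetry of the inner product supplies the other order.\<close>

lemma gram_schmidt_orthonormal:
  assumes "\<And>n. n < d \<Longrightarrow> x n \<notin> span (x ` {..<n})"
  shows "i < d \<Longrightarrow> j \<le> i \<Longrightarrow> gram_schmidt x i \<bullet> gram_schmidt x j = (if i = j then 1 else 0)"
proof (induction i arbitrary: j rule: less_induct)
  case (less n)
  let ?q = "gram_schmidt x"
  define r where "r = x n - (\<Sum>m<n. (x n \<bullet> ?q m) *\<^sub>R ?q m)"
  have q: "?q n = r /\<^sub>R norm r" unfolding r_def by (rule gram_schmidt.simps)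
  have orth: "?q l \<bullet> ?q m = (if l = m then 1 else 0)" if "l < n" "m < n" for l m
    using less.IH[of l m] less.IH[of m l] that less.prems(1) by (cases "m \<le> l") (auto simp: inner_commute)
  have "r \<noteq> 0"
  proof
    assume "r = 0"
    then have "x n = (\<Sum>m<n. (x n \<bullet> ?q m) *\<^sub>R ?q m)" by (simp add: r_def)
    moreover have "?q m \<in> span (x ` {..<n})" if "m < n" for m
    proof (rule subsetD)
      show "span (x ` {..m}) \<subseteq> span (x ` {..<n})" using that by (intro span_mono image_mono) auto
    qed (rule gram_schmidt_in_span)
    then have "(\<Sum>m<n. (x n \<bullet> ?q m) *\<^sub>R ?q m) \<in> span (x ` {..<n})"
      by (intro span_sum span_scale) auto
    ultimately show False using assms[OF less.prems(1)] by simp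
  qed
  show ?case
  proof (cases "j = n")
    case True
    then show ?thesis using \<open>r \<noteq> 0\<close> by (simp add: q power2_norm_eq_inner[symmetric] power2_eq_square)
  next
    case False
    then have j: "j < n" using less.prems by simp
    have "(\<Sum>m<n. (x n \<bullet> ?q m) *\<^sub>R ?q m) \<bullet> ?q j = (\<Sum>m<n. if m = j then x n \<bullet> ?q j else 0)"
      unfolding inner_sum_left using orth j by (intro sum.cong) auto
    then have "r \<bullet> ?q j = 0" using j by (simp add: r_def inner_diff_left)
    then show ?thesis using False by (simp add: q)
  qed
qed

text \<open>The recursion consists of linear combinations whose coefficients are inner products and
  norms, all preserved by an isometry.\<close>

lemma gram_schmidt_orthogonal_matrix:
  assumes "orthogonal_matrix (Q :: real^'n^'n)"
  shows "gram_schmidt (\<lambda>n. Q *v x n) n = Q *v gram_schmidt x n"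
proof (induction n rule: less_induct)
  case (less n)
  let ?y = "\<lambda>n. Q *v x n"
  have "(\<Sum>m<n. (?y n \<bullet> gram_schmidt ?y m) *\<^sub>R gram_schmidt ?y m) = Q *v (\<Sum>m<n. (x n \<bullet> gram_schmidt x m) *\<^sub>R gram_schmidt x m)"
    using less by (simp add: rotation_matrix_inner[OF assms] linear_sum[OF matrix_vector_mul_linear] matrix_vector_mult_scaleR)
  then have "?y n - (\<Sum>m<n. (?y n \<bullet> gram_schmidt ?y m) *\<^sub>R gram_schmidt ?y m) = Q *v (x n - (\<Sum>m<n. (x n \<bullet> gram_schmidt x m) *\<^sub>R gram_schmidt x m))"
    by (simp add: matrix_vector_mult_diff_distrib)
  then show ?case
    by (subst (1 2) gram_schmidt.simps) (simp only: rotation_matrix_norm[OF assms] matrix_vector_mult_scaleR)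
qed

lemma borel_measurable_gram_schmidt:
  fixes X :: "'b \<Rightarrow> nat \<Rightarrow> 'a::euclidean_space"
  assumes "\<And>n. n < d \<Longrightarrow> (\<lambda>w. X w n) \<in> borel_measurable M"
  shows "n < d \<Longrightarrow> (\<lambda>w. gram_schmidt (X w) n) \<in> borel_measurable M"
proof (induction n rule: less_induct)
  case (less n)
  have [measurable]: "(\<lambda>w. gram_schmidt (X w) m) \<in> borel_measurable M" if "m < n" for m
    using less that by auto
  have [measurable]: "(\<lambda>w. X w n) \<in> borel_measurable M" using assms less.prems by blast
  have [measurable]: "(\<lambda>w. \<Sum>m<n. (X w n \<bullet> gram_schmidt (X w) m) *\<^sub>R gram_schmidt (X w) m) \<in> borel_measurable M"
    by (rule borel_measurable_sum) measurable
  show ?case by (subst gram_schmidt.simps) measurable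
qed

text \<open>Gram-Schmidt needs an order on the rows; any fixed enumeration of the index type
  serves.\<close>

definition row_index :: "nat \<Rightarrow> 'n::finite" where
  "row_index = (SOME g. bij_betw g {..<CARD('n)} (UNIV :: 'n set))"

lemma bij_row_index: "bij_betw (row_index :: nat \<Rightarrow> 'n) {..<CARD('n::finite)} UNIV"
proof -
  have "\<exists>g. bij_betw g {..<CARD('n)} (UNIV :: 'n set)"
    by (rule finite_same_card_bij) auto
  then show ?thesis unfolding row_index_def by (rule someI_ex)
qed

definition row_number :: "'n::finite \<Rightarrow> nat" where
  "row_number = the_inv_into {..<CARD('n)} row_index"

lemma row_number: "row_number (i :: 'n::finite) < CARD('n)" "row_index (row_number i) = i"
proof -
  have inj: "inj_on (row_index :: nat \<Rightarrow> 'n) {..<CARD('n)}" and im: "(row_index :: nat \<Rightarrow> 'n) ` {..<CARD('n)} = UNIV"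
    using bij_row_index by (auto simp: bij_betw_def)
  have "i \<in> row_index ` {..<CARD('n)}" using im by simp
  then show "row_number i < CARD('n)" "row_index (row_number i) = i"
    using the_inv_into_into[OF inj _ subset_refl] f_the_inv_into_f[OF inj] unfolding row_number_def by blast+
qed

lemma row_number_eq_iff: "row_number (i :: 'n::finite) = row_number j \<longleftrightarrow> i = j"
proof
  assume "row_number i = row_number j"
  then have "(row_index (row_number i) :: 'n) = row_index (row_number j)" by simp
  then show "i = j" unfolding row_number(2) .
qed simp

text \<open>
  Orthonormalising the rows of \<open>X\<close>, instead of its columns, makes the construction equivariant
  under multiplication from the right.
\<close>
definition rows_orthonormalised :: "('n::finite \<Rightarrow> real^'n) \<Rightarrow> real^'n^'n" where
  "rows_orthonormalised X = (\<chi> i. gram_schmidt (\<lambda>n. X (row_index n)) (row_number i))"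

text \<open>For independent rows the determinant is \<open>1\<close> or \<open>-1\<close>, and
  multiplying one row by it forces determinant \<open>1\<close> while keeping the rows orthonormal.
  The correction is required because the measure on the Grassmannian is assumed invariant under
  rotations, not under reflections.\<close>

definition rotation_of :: "('n::finite \<Rightarrow> real^'n) \<Rightarrow> real^'n^'n" where
  "rotation_of X = (\<chi> i. if i = row_index 0 then det (rows_orthonormalised X) *s rows_orthonormalised X $ i
     else rows_orthonormalised X $ i)"

lemma rows_orthonormalised_orthogonal:
  fixes X :: "'n::finite \<Rightarrow> real^'n"
  assumes "gram_vol UNIV X \<noteq> 0"
  shows "orthogonal_matrix (rows_orthonormalised X)"
proof -
  let ?x = "\<lambda>n. X (row_index n)"
  have dimX: "dim (span (range X)) = CARD('n)"
    using assms gram_vol_eq_0_iff[of UNIV X] dim_image_le_card[of UNIV X] by simp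
  \<comment> \<open>A row depending on earlier ones would be redundant, leaving a span of dimension
    less than \<open>CARD('n)\<close>.\<close>
  have indep: "?x n \<notin> span (?x ` {..<n})" if n: "n < CARD('n)" for n
  proof
    assume mem: "?x n \<in> span (?x ` {..<n})"
    let ?i = "row_index n :: 'n"
    have sub: "?x ` {..<n} \<subseteq> X ` (UNIV - {?i})"
    proof
      fix y assume "y \<in> ?x ` {..<n}"
      then obtain m where m: "m < n" "y = ?x m" by auto
      have "(row_index m :: 'n) \<noteq> ?i"
      proof
        assume eq: "(row_index m :: 'n) = ?i"
        have "inj_on (row_index :: nat \<Rightarrow> 'n) {..<CARD('n)}" using bij_row_index by (rule bij_betw_imp_inj_on)
        from inj_onD[OF this eq] have "m = n" using m(1) n by simp
        then show False using m(1) by simp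
      qed
      then show "y \<in> X ` (UNIV - {?i})" using m by blast
    qed
    have xi: "X ?i \<in> span (X ` (UNIV - {?i}))" by (rule subsetD[OF span_mono[OF sub] mem])
    have "range X \<subseteq> span (X ` (UNIV - {?i}))"
    proof
      fix y assume "y \<in> range X"
      then obtain j where "y = X j" by blast
      then show "y \<in> span (X ` (UNIV - {?i}))"
        using xi span_base[of "X j" "X ` (UNIV - {?i})"] by (cases "j = ?i") simp_all
    qed
    then have "span (range X) \<subseteq> span (X ` (UNIV - {?i}))" by (rule span_minimal) simp
    then have "dim (span (range X)) \<le> dim (span (X ` (UNIV - {?i})))" by (rule dim_subset)
    also have "\<dots> \<le> card (UNIV - {?i})" by (rule dim_image_le_card) simp
    also have "\<dots> < card (UNIV :: 'n set)" by (rule psubset_card_mono) auto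
    finally have "CARD('n) < CARD('n)" unfolding dimX .
    then show False by simp
  qed
  have "rows_orthonormalised X $ i \<bullet> rows_orthonormalised X $ j = (if i = j then 1 else 0)" for i j
  proof (cases "row_number j \<le> row_number i")
    case True
    from gram_schmidt_orthonormal[OF indep row_number(1) True] show ?thesis
      by (simp only: rows_orthonormalised_def vec_lambda_beta row_number_eq_iff)
  next
    case False
    then have "row_number i \<le> row_number j" by simp
    from gram_schmidt_orthonormal[OF indep row_number(1) this] show ?thesis
      by (simp only: rows_orthonormalised_def vec_lambda_beta row_number_eq_iff inner_commute eq_commute)
  qed
  then have "rows_orthonormalised X ** transpose (rows_orthonormalised X) = mat 1"
    by (simp add: vec_eq_iff matrix_matrix_mult_def transpose_def mat_def inner_vec_def)
  then show ?thesis by (simp add: orthogonal_matrix_def matrix_left_right_inverse)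
qed

lemma rotation_matrix_rotation_of:
  assumes "gram_vol UNIV X \<noteq> 0"
  shows "rotation_matrix (rotation_of X)"
proof -
  let ?Q = "rows_orthonormalised X"
  have Q: "orthogonal_matrix ?Q" using assms by (rule rows_orthonormalised_orthogonal)
  have dd: "det ?Q * det ?Q = 1" using det_orthogonal_matrix[OF Q] by auto
  have QQ: "?Q ** transpose ?Q = mat 1" using Q by (simp add: orthogonal_matrix_def)
  have rows: "?Q $ i \<bullet> ?Q $ j = (if i = j then 1 else 0)" for i j
    using QQ by (simp add: vec_eq_iff matrix_matrix_mult_def transpose_def mat_def inner_vec_def)
  have "rotation_of X $ i \<bullet> rotation_of X $ j = (if i = j then 1 else 0)" for i j
    using rows[of i j] dd by (auto simp: rotation_of_def scalar_mult_eq_scaleR)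
  then have "rotation_of X ** transpose (rotation_of X) = mat 1"
    by (simp add: vec_eq_iff matrix_matrix_mult_def transpose_def mat_def inner_vec_def)
  then have "orthogonal_matrix (rotation_of X)" by (simp add: orthogonal_matrix_def matrix_left_right_inverse)
  moreover have "det (rotation_of X) = 1"
    using det_row_mul[of "row_index 0" "det ?Q" "\<lambda>i. ?Q $ i" "\<lambda>i. ?Q $ i"] dd by (simp add: rotation_of_def)
  ultimately show ?thesis by (simp add: rotation_matrix_def)
qed

text \<open>Applying \<open>Q\<close> to every row is right multiplication by
  \<open>transpose Q\<close>. Gram-Schmidt commutes with it, and \<open>det Q = 1\<close> leaves the
  sign correction unchanged.\<close>

lemma rotation_of_equivariant:
  fixes Q :: "real^'n^'n"
  assumes Q: "rotation_matrix Q"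
  shows "rotation_of (\<lambda>i. Q *v X i) = rotation_of X ** transpose Q"
proof -
  have Qo: "orthogonal_matrix Q" "det Q = 1" using Q by (auto simp: rotation_matrix_def)
  have comp: "(A ** transpose Q) $ i = Q *v A $ i" for A :: "real^'n^'n" and i
    unfolding vec_eq_iff matrix_matrix_mult_def transpose_def matrix_vector_mult_def vec_lambda_beta
    by (intro allI sum.cong refl) (rule mult.commute)
  have "rows_orthonormalised (\<lambda>i. Q *v X i) $ i = Q *v rows_orthonormalised X $ i" for i
    unfolding rows_orthonormalised_def vec_lambda_beta by (rule gram_schmidt_orthogonal_matrix[OF Qo(1)])
  then have eq: "rows_orthonormalised (\<lambda>i. Q *v X i) = rows_orthonormalised X ** transpose Q"
    by (subst vec_eq_iff) (simp only: comp simp_thms)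
  show ?thesis
  proof (rule vec_eq_iff[THEN iffD2], rule allI)
    fix i
    have d: "det (rows_orthonormalised X ** transpose Q) = det (rows_orthonormalised X)"
      by (simp add: det_mul det_transpose Qo(2))
    show "rotation_of (\<lambda>i. Q *v X i) $ i = (rotation_of X ** transpose Q) $ i"
      unfolding comp rotation_of_def eq vec_lambda_beta d
      by (cases "i = row_index 0") (simp_all add: scalar_mult_eq_scaleR matrix_vector_mult_scaleR)
  qed
qed

lemma borel_measurable_rotation_of:
  fixes X :: "'b \<Rightarrow> 'n::finite \<Rightarrow> real^'n"
  assumes X: "\<And>i. (\<lambda>w. X w i) \<in> borel_measurable M"
  shows "(\<lambda>w. rotation_of (X w) $ i $ j) \<in> borel_measurable M"
proof -
  have "(\<lambda>w. gram_schmidt (\<lambda>n. X w (row_index n)) (row_number i)) \<in> borel_measurable M" for i :: 'n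
    by (rule borel_measurable_gram_schmidt[where d = "CARD('n)"]) (auto simp: X row_number)
  then have g: "(\<lambda>w. gram_schmidt (\<lambda>n. X w (row_index n)) (row_number i) $ j) \<in> borel_measurable M" for i j :: 'n
    by (rule measurable_compose[OF _ borel_measurable_continuous_onI]) (intro continuous_intros)
  then have e[measurable]: "(\<lambda>w. rows_orthonormalised (X w) $ i $ j) \<in> borel_measurable M" for i j
    by (simp add: rows_orthonormalised_def)
  have [measurable]: "(\<lambda>w. det (rows_orthonormalised (X w))) \<in> borel_measurable M"
    by (rule borel_measurable_det) (rule e)
  show ?thesis
    by (cases "i = row_index 0") (simp_all add: rotation_of_def)
qed

section \<open>Rotation invariance and independence of random tuples in the ball\<close>

lemma nn_integral_lborel_orthogonal:
  assumes Q: "orthogonal_matrix (Q :: real^'n^'n)" and h: "h \<in> borel_measurable borel"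
  shows "(\<integral>\<^sup>+x. h (Q *v x) \<partial>lborel) = (\<integral>\<^sup>+x. h x \<partial>lborel)"
proof -
  have d: "\<bar>det Q\<bar> = 1" using det_orthogonal_matrix[OF Q] by auto
  then have "det Q \<noteq> 0" by auto
  moreover have "block UNIV Q" by (simp add: block_def)
  ultimately show ?thesis
    using nn_integral_coord_measure_matrix[of UNIV Q h] h d by (simp add: frame_measure_axis)
qed

lemma nn_integral_PiM_orthogonal:
  fixes K :: "'n::finite set"
  assumes Q: "orthogonal_matrix (Q :: real^'n^'n)" and f: "f \<in> borel_measurable (Pi\<^sub>M K (\<lambda>_. lborel))"
  shows "(\<integral>\<^sup>+Y. f (\<lambda>j\<in>K. Q *v Y j) \<partial>Pi\<^sub>M K (\<lambda>_. lborel)) = (\<integral>\<^sup>+Y. f Y \<partial>Pi\<^sub>M K (\<lambda>_. lborel))"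
proof -
  interpret L: homogeneous_measure "lborel :: (real^'n) measure" UNIV "CARD('n)"
    by (rule homogeneous_lborel)
  have "(\<integral>\<^sup>+Y. f (\<lambda>j\<in>K. Q *v Y j) \<partial>Pi\<^sub>M K (\<lambda>_. lborel)) = (\<Prod>j\<in>K. 1) * (\<integral>\<^sup>+Y. f Y \<partial>Pi\<^sub>M K (\<lambda>_. lborel))"
    by (intro L.nn_integral_PiM_componentwise f) (auto simp: nn_integral_lborel_orthogonal[OF Q])
  then show ?thesis by simp
qed

text \<open>As \<open>0 powr 0\<close> is \<open>0\<close>, the power is the indicator of
  independent tuples, so the moment formula with exponent \<open>0\<close> gives the mass of the
  independent tuples in the ball.\<close>

lemma nn_integral_ball_tuple_nonzero:
  fixes K :: "'n::finite set"
  shows "(\<integral>\<^sup>+Y. ball_tuple K Y * ennreal (gram_vol K Y powr 0) \<partial>Pi\<^sub>M K (\<lambda>_. lborel :: (real^'n) measure)) = ennreal (unit_ball_vol CARD('n) ^ card K)"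
proof -
  have kd: "card K \<le> CARD('n)" by (simp add: card_mono)
  have "moment_const CARD('n) 0 (card K) = (\<Prod>j<card K. unit_ball_vol CARD('n))"
    unfolding moment_const_def
  proof (intro prod.cong refl)
    fix j assume "j \<in> {..<card K}"
    then have "real CARD('n) - real j > 0" using kd by auto
    then have "omega (real CARD('n) - real j) > 0" by (simp add: omega_def)
    then show "unit_ball_vol (real CARD('n) + 0) * (omega (real CARD('n) - real j) / omega (real CARD('n) - real j + 0)) = unit_ball_vol CARD('n)"
      by simp
  qed
  then show ?thesis
    using nn_integral_gram_vol_moment[OF orthonormal_on_axis, of K UNIV 0] kd
    by (simp add: frame_measure_axis ball_tuple_def)
qed

lemma nn_integral_ball_tuple:
  fixes K :: "'n::finite set"
  shows "(\<integral>\<^sup>+Y. ball_tuple K Y \<partial>Pi\<^sub>M K (\<lambda>_. lborel :: (real^'n) measure)) = ennreal (unit_ball_vol CARD('n) ^ card K)"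
proof -
  interpret L: homogeneous_measure "lborel :: (real^'n) measure" UNIV "CARD('n)"
    by (rule homogeneous_lborel)
  have [measurable]: "cball (0::real^'n) 1 \<in> sets borel" by simp
  have "(\<integral>\<^sup>+Y. (\<Prod>i\<in>K. indicator (cball 0 1) (Y i)) \<partial>Pi\<^sub>M K (\<lambda>_. lborel :: (real^'n) measure)) = (\<Prod>j\<in>K. \<integral>\<^sup>+x. indicator (cball 0 1) x \<partial>(lborel :: (real^'n) measure))"
    by (rule L.product_nn_integral_prod[of K "\<lambda>_. indicator (cball 0 1)"]) (simp, measurable)
  also have "\<dots> = (\<Prod>j\<in>K. emeasure (lborel :: (real^'n) measure) (cball 0 1))"
    by simp
  also have "\<dots> = ennreal (unit_ball_vol CARD('n) ^ card K)"
    by (simp add: emeasure_cball ennreal_power)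
  finally show ?thesis unfolding ball_tuple_def .
qed

text \<open>The independent tuples already have the full, finite mass of the ball, so the dependent
  ones form a null set.\<close>

lemma AE_ball_tuple_gram_vol_nonzero:
  fixes K :: "'n::finite set"
  shows "AE Y in Pi\<^sub>M K (\<lambda>_. lborel :: (real^'n) measure). ball_tuple K Y \<noteq> 0 \<longrightarrow> gram_vol K Y \<noteq> 0"
proof -
  let ?L = "Pi\<^sub>M K (\<lambda>_. lborel :: (real^'n) measure)"
  let ?v = "ennreal (unit_ball_vol CARD('n) ^ card K)"
  have [measurable]: "ball_tuple K \<in> borel_measurable ?L" by (intro borel_measurable_ball_tuple) measurable
  have [measurable]: "gram_vol K \<in> borel_measurable ?L" by (intro borel_measurable_gram_vol) measurable
  let ?z = "\<lambda>Y. ball_tuple K Y * (if gram_vol K Y = 0 then 1 else 0)"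
  have "ball_tuple K Y = ball_tuple K Y * ennreal (gram_vol K Y powr 0) + ?z Y" for Y by simp
  then have "?v = (\<integral>\<^sup>+Y. ball_tuple K Y * ennreal (gram_vol K Y powr 0) + ?z Y \<partial>?L)"
    unfolding nn_integral_ball_tuple[symmetric] by (rule nn_integral_cong)
  also have "\<dots> = (\<integral>\<^sup>+Y. ball_tuple K Y * ennreal (gram_vol K Y powr 0) \<partial>?L) + (\<integral>\<^sup>+Y. ?z Y \<partial>?L)"
    by (rule nn_integral_add) measurable
  finally have "?v = ?v + (\<integral>\<^sup>+Y. ?z Y \<partial>?L)" unfolding nn_integral_ball_tuple_nonzero .
  then have "(\<integral>\<^sup>+Y. ?z Y \<partial>?L) = 0"
    using ennreal_add_left_cancel[of ?v 0] by simp
  then have "AE Y in ?L. ?z Y = 0" by (subst (asm) nn_integral_0_iff_AE) auto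
  then show ?thesis by eventually_elim (auto split: if_splits)
qed

text \<open>Takes the place of Haar measure on rotations. Averaging \<open>I\<close> over the random
  rotation and exchanging the integrals leaves, for each \<open>\<omega>\<close>, the mean of
  \<open>H\<close> at that rotation times \<open>P\<close>. Equivariance moves \<open>P\<close> into
  \<open>X\<close>, where rotation invariance of the ball removes it. Now \<open>M\<close> enters
  through its mass alone, so two families with the same \<open>H\<close> can be compared.\<close>

lemma rotation_average:
  fixes \<Theta> :: "real^'n^'n \<Rightarrow> 'b \<Rightarrow> ennreal" and H :: "real^'n^'n \<Rightarrow> ennreal" and M :: "'b measure"
  assumes M: "sigma_finite_measure M"
    and m: "(\<lambda>(X, \<omega>). \<Theta> (rotation_of X) \<omega>) \<in> borel_measurable (Pi\<^sub>M UNIV (\<lambda>_::'n. lborel :: (real^'n) measure) \<Otimes>\<^sub>M M)"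
    and mH: "(\<lambda>X. H (rotation_of X)) \<in> borel_measurable (Pi\<^sub>M UNIV (\<lambda>_::'n. lborel :: (real^'n) measure))"
    and inv: "\<And>Q. rotation_matrix Q \<Longrightarrow> (\<integral>\<^sup>+\<omega>. \<Theta> Q \<omega> \<partial>M) = I"
    and H: "AE \<omega> in M. \<exists>P. rotation_matrix P \<and> (\<forall>Q. rotation_matrix Q \<longrightarrow> \<Theta> Q \<omega> = H (Q ** P))"
  shows "ennreal (unit_ball_vol CARD('n) ^ CARD('n)) * I
    = (\<integral>\<^sup>+X. ball_tuple UNIV X * H (rotation_of X) \<partial>Pi\<^sub>M UNIV (\<lambda>_. lborel)) * emeasure M (space M)"
proof -
  let ?L = "Pi\<^sub>M UNIV (\<lambda>_::'n. lborel :: (real^'n) measure)"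
  interpret L: homogeneous_measure "lborel :: (real^'n) measure" UNIV "CARD('n)"
    by (rule homogeneous_lborel)
  interpret LU: finite_product_sigma_finite "\<lambda>_. lborel :: (real^'n) measure" "UNIV :: 'n set" by standard simp
  interpret M: sigma_finite_measure M by fact
  interpret P: pair_sigma_finite ?L M by standard
  let ?J = "\<integral>\<^sup>+X. ball_tuple UNIV X * H (rotation_of X) \<partial>?L"
  have ball[measurable]: "ball_tuple UNIV \<in> borel_measurable ?L" by (intro borel_measurable_ball_tuple) measurable
  have m2: "(\<lambda>(X, \<omega>). ball_tuple UNIV X * \<Theta> (rotation_of X) \<omega>) \<in> borel_measurable (?L \<Otimes>\<^sub>M M)"
    using measurable_compose[OF measurable_fst ball] m by (simp add: case_prod_beta)
  have "ennreal (unit_ball_vol CARD('n) ^ CARD('n)) * I = (\<integral>\<^sup>+X. ball_tuple UNIV X * I \<partial>?L)"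
    by (simp add: nn_integral_multc nn_integral_ball_tuple)
  also have "\<dots> = (\<integral>\<^sup>+X. \<integral>\<^sup>+\<omega>. ball_tuple UNIV X * \<Theta> (rotation_of X) \<omega> \<partial>M \<partial>?L)"
  proof (rule nn_integral_cong_AE)
    show "AE X in ?L. ball_tuple UNIV X * I = (\<integral>\<^sup>+\<omega>. ball_tuple UNIV X * \<Theta> (rotation_of X) \<omega> \<partial>M)"
      using AE_ball_tuple_gram_vol_nonzero[of UNIV] AE_space
    proof eventually_elim
      case (elim X)
      have "(\<lambda>\<omega>. \<Theta> (rotation_of X) \<omega>) \<in> borel_measurable M"
        using measurable_compose[OF measurable_Pair1'[OF elim(2)] m] by simp
      then have "(\<integral>\<^sup>+\<omega>. ball_tuple UNIV X * \<Theta> (rotation_of X) \<omega> \<partial>M) = ball_tuple UNIV X * (\<integral>\<^sup>+\<omega>. \<Theta> (rotation_of X) \<omega> \<partial>M)"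
        by (rule nn_integral_cmult)
      then show ?case
        using elim(1) inv[OF rotation_matrix_rotation_of, of X] by (cases "ball_tuple UNIV X = 0") auto
    qed
  qed
  also have "\<dots> = (\<integral>\<^sup>+\<omega>. \<integral>\<^sup>+X. ball_tuple UNIV X * \<Theta> (rotation_of X) \<omega> \<partial>?L \<partial>M)"
    by (rule P.Fubini'[OF m2, symmetric])
  also have "\<dots> = (\<integral>\<^sup>+\<omega>. ?J \<partial>M)"
  proof (rule nn_integral_cong_AE)
    show "AE \<omega> in M. (\<integral>\<^sup>+X. ball_tuple UNIV X * \<Theta> (rotation_of X) \<omega> \<partial>?L) = ?J"
      using H
    proof eventually_elim
      case (elim \<omega>)
      \<comment> \<open>\<open>P\<close> may depend on \<open>\<omega>\<close> in a non-measurable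
        way: the inner integral turns out to be independent of it.\<close>
      then obtain P where P: "rotation_matrix P" "\<And>Q. rotation_matrix Q \<Longrightarrow> \<Theta> Q \<omega> = H (Q ** P)" by blast
      let ?T = "transpose P"
      have To: "orthogonal_matrix ?T" using rotation_matrix_transpose[OF P(1)] by (simp add: rotation_matrix_def)
      have fm: "(\<lambda>X. ball_tuple UNIV X * H (rotation_of X)) \<in> borel_measurable ?L"
        by (intro borel_measurable_times_ennreal ball mH)
      \<comment> \<open>Turning the rows by \<open>transpose P\<close> multiplies
        \<open>rotation_of X\<close> by \<open>P\<close> from the right and leaves the ball
        condition unchanged.\<close>
      have "(\<integral>\<^sup>+X. ball_tuple UNIV X * \<Theta> (rotation_of X) \<omega> \<partial>?L)
         = (\<integral>\<^sup>+X. ball_tuple UNIV (\<lambda>j\<in>UNIV. ?T *v X j) * H (rotation_of (\<lambda>j\<in>UNIV. ?T *v X j)) \<partial>?L)"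
      proof (rule nn_integral_cong_AE, rule eventually_mono[OF AE_ball_tuple_gram_vol_nonzero[of UNIV]])
        fix X :: "'n \<Rightarrow> real^'n" assume X: "ball_tuple UNIV X \<noteq> 0 \<longrightarrow> gram_vol UNIV X \<noteq> 0"
        have b: "ball_tuple UNIV (\<lambda>j. ?T *v X j) = ball_tuple UNIV X"
          unfolding ball_tuple_def indicator_def mem_cball_0 rotation_matrix_norm[OF To] ..
        show "ball_tuple UNIV X * \<Theta> (rotation_of X) \<omega>
          = ball_tuple UNIV (\<lambda>j\<in>UNIV. ?T *v X j) * H (rotation_of (\<lambda>j\<in>UNIV. ?T *v X j))"
        proof -
          have r: "(\<lambda>j\<in>UNIV. ?T *v X j) = (\<lambda>j. ?T *v X j)" unfolding restrict_UNIV ..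
          show ?thesis
            unfolding r b rotation_of_equivariant[OF rotation_matrix_transpose[OF P(1)]] transpose_transpose
            using X P(2)[OF rotation_matrix_rotation_of, of X] by (cases "ball_tuple UNIV X = 0") auto
        qed
      qed
      also have "\<dots> = ?J" by (rule nn_integral_PiM_orthogonal[OF To fm])
      finally show ?case .
    qed
  qed
  also have "\<dots> = ?J * emeasure M (space M)" by simp
  finally show ?thesis .
qed

section \<open>Integration over the Grassmannian\<close>

text \<open>Gives the projection behind \<open>grassmannian_borel\<close> explicitly in terms of any
  orthonormal basis of the subspace.\<close>

lemma closest_point_span_orthonormal:
  fixes b :: "'n::finite \<Rightarrow> 'a::euclidean_space"
  assumes b: "orthonormal_on K b"
  shows "closest_point (span (b ` K)) x = (\<Sum>l\<in>K. (x \<bullet> b l) *\<^sub>R b l)"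
proof -
  let ?y = "\<Sum>l\<in>K. (x \<bullet> b l) *\<^sub>R b l"
  have y: "?y \<in> span (b ` K)" by (intro span_sum span_scale span_base) auto
  have orth: "(x - ?y) \<bullet> z = 0" if z: "z \<in> span (b ` K)" for z
  proof -
    have "(x - ?y) \<bullet> b l = 0" if "l \<in> K" for l
      using inner_orthonormal_sum[OF b finite that] by (simp add: inner_diff_left)
    then have "(x - ?y) \<bullet> (\<Sum>l\<in>K. (z \<bullet> b l) *\<^sub>R b l) = 0"
      unfolding inner_sum_right inner_scaleR_right by (intro sum.neutral ballI) (simp only: mult_zero_right)
    then show ?thesis using orthonormal_expansion[OF b finite z] by simp
  qed
  have "dist x ?y \<le> dist x z" if z: "z \<in> span (b ` K)" for z
  proof -
    have "(x - ?y) \<bullet> (?y - z) = 0" by (rule orth[OF span_diff[OF y z]])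
    then have "(norm ((x - ?y) + (?y - z)))\<^sup>2 = (norm (x - ?y))\<^sup>2 + (norm (?y - z))\<^sup>2"
      by (intro norm_add_Pythagorean) (simp add: orthogonal_def)
    then have "(norm (x - ?y))\<^sup>2 \<le> (norm (x - z))\<^sup>2" by simp
    then show ?thesis unfolding dist_norm by (rule power2_le_imp_le) simp
  qed
  then have "?y = closest_point (span (b ` K)) x"
    using y by (intro closest_point_unique) (auto simp: subspace_imp_convex closed_subspace)
  then show ?thesis ..
qed

definition projection_matrix :: "(real^'n) set \<Rightarrow> real^'n^'n" where
  "projection_matrix L = matrix (closest_point L)"

definition column_matrix :: "('n::finite \<Rightarrow> real^'n) \<Rightarrow> real^'n^'n" where
  "column_matrix b = (\<chi> i j. b j $ i)"

definition diag_indicator :: "'n::finite set \<Rightarrow> real^'n^'n" where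
  "diag_indicator K = (\<chi> i j. if i = j \<and> i \<in> K then 1 else 0)"

lemma matrix_mult_column_matrix: "C ** column_matrix b = column_matrix (\<lambda>j. C *v b j)"
  by (simp add: vec_eq_iff column_matrix_def matrix_matrix_mult_def matrix_vector_mult_def)

lemma column_matrix_gram: "(transpose (column_matrix b) ** column_matrix b) $ i $ j = b i \<bullet> b j"
  by (simp add: column_matrix_def matrix_matrix_mult_def transpose_def inner_vec_def)

lemma orthogonal_column_matrix:
  assumes "orthonormal_on UNIV b"
  shows "orthogonal_matrix (column_matrix b)"
  using assms by (simp add: orthogonal_matrix vec_eq_iff column_matrix_gram orthonormal_on_def mat_def)

lemma column_matrix_axis: "column_matrix b *v axis j 1 = b j"
  by (simp add: matrix_vector_mult_basis column_def column_matrix_def vec_eq_iff)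

lemma projection_matrix_span:
  assumes b: "orthonormal_on K (b :: 'n::finite \<Rightarrow> real^'n)"
  shows "projection_matrix (span (b ` K)) = column_matrix b ** diag_indicator K ** transpose (column_matrix b)"
proof -
  have d: "(\<Sum>m\<in>UNIV. b m $ i * diag_indicator K $ m $ l) = (if l \<in> K then b l $ i else 0)" for i l
  proof -
    have "(\<Sum>m\<in>UNIV. b m $ i * diag_indicator K $ m $ l) = (\<Sum>m\<in>UNIV. if m = l then (if l \<in> K then b l $ i else 0) else 0)"
      by (intro sum.cong) (auto simp: diag_indicator_def)
    then show ?thesis by simp
  qed
  have "projection_matrix (span (b ` K)) $ i $ j = (\<Sum>l\<in>K. b l $ j * b l $ i)" for i j
    by (simp add: projection_matrix_def matrix_def closest_point_span_orthonormal[OF b] inner_axis')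
  moreover have "(column_matrix b ** diag_indicator K ** transpose (column_matrix b)) $ i $ j = (\<Sum>l\<in>K. b l $ j * b l $ i)" for i j
  proof -
    have "(column_matrix b ** diag_indicator K ** transpose (column_matrix b)) $ i $ j = (\<Sum>l\<in>UNIV. (if l \<in> K then b l $ i else 0) * b l $ j)"
      unfolding matrix_matrix_mult_def transpose_def column_matrix_def vec_lambda_beta d ..
    also have "\<dots> = (\<Sum>l\<in>UNIV. if l \<in> K then b l $ j * b l $ i else 0)"
      by (intro sum.cong) auto
    also have "\<dots> = (\<Sum>l\<in>K. b l $ j * b l $ i)" by (subst sum.If_cases) auto
    finally show ?thesis .
  qed
  ultimately show ?thesis by (simp only: vec_eq_iff simp_thms)
qed

text \<open>
  In an orthonormal basis adapted to \<open>L\<close> the matrix below is block diagonal, with the Gram matrix of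
  the images of the basis vectors of \<open>L\<close> as its only non-trivial block.
\<close>
definition section_det :: "real^'n^'n \<Rightarrow> real^'n^'n \<Rightarrow> real" where
  "section_det C P = det (P ** transpose C ** C ** P + mat 1 - P)"

lemma matrix_mult_add_diff:
  fixes A B X Y Z :: "real^'n^'n"
  shows "A ** (X + Y - Z) ** B = A ** X ** B + A ** Y ** B - A ** Z ** B"
proof -
  have "A ** (X + Y - Z) = A ** X + A ** Y - A ** Z"
    by (simp add: vec_eq_iff matrix_matrix_mult_def distrib_left right_diff_distrib sum.distrib sum_subtractf)
  moreover have "(X + Y - Z) ** B = X ** B + Y ** B - Z ** B" for X Y Z
    by (simp add: vec_eq_iff matrix_matrix_mult_def distrib_right left_diff_distrib sum.distrib sum_subtractf)
  ultimately show ?thesis by simp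
qed

text \<open>Shows the Gram determinant behind the volume of a section to be a polynomial in the
  entries of \<open>C\<close> and of the projection, hence jointly measurable in a rotation and a
  subspace.\<close>

lemma section_det_projection:
  assumes b: "orthonormal_on UNIV (b :: 'n::finite \<Rightarrow> real^'n)"
  shows "section_det C (projection_matrix (span (b ` K))) = det (gram K (\<lambda>j. C *v b j))"
proof -
  let ?O = "column_matrix b" and ?D = "diag_indicator K"
  let ?P = "?O ** ?D ** transpose ?O"
  have bK: "orthonormal_on K b" using b by (rule orthonormal_on_subset) simp
  have O: "orthogonal_matrix ?O" by (rule orthogonal_column_matrix[OF b])
  have OO: "transpose ?O ** ?O = mat 1" using O by (simp add: orthogonal_matrix)
  have dO: "det (transpose ?O) * det ?O = 1"
    using OO by (metis det_I det_mul)
  let ?X = "?P ** transpose C ** C ** ?P + mat 1 - ?P"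
  let ?G = "transpose (column_matrix (\<lambda>j. C *v b j)) ** column_matrix (\<lambda>j. C *v b j)"
  have OP: "transpose ?O ** ?P = ?D ** transpose ?O"
    using OO by (simp add: matrix_mul_assoc)
  have PO: "?P ** ?O = ?O ** ?D"
    using OO by (simp add: matrix_mul_assoc[symmetric])
  have G: "?G = transpose ?O ** transpose C ** C ** ?O"
    by (simp add: matrix_mult_column_matrix[symmetric] matrix_transpose_mul matrix_mul_assoc)
  have "transpose ?O ** ?X ** ?O = transpose ?O ** (?P ** transpose C ** C ** ?P) ** ?O + transpose ?O ** ?O - transpose ?O ** ?P ** ?O"
    unfolding matrix_mult_add_diff by simp
  also have "transpose ?O ** (?P ** transpose C ** C ** ?P) ** ?O = (transpose ?O ** ?P) ** transpose C ** C ** (?P ** ?O)"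
    by (simp only: matrix_mul_assoc)
  also have "\<dots> = ?D ** ?G ** ?D"
    unfolding OP PO G by (simp only: matrix_mul_assoc)
  also have "transpose ?O ** ?P ** ?O = ?D"
    unfolding OP using OO by (simp add: matrix_mul_assoc[symmetric])
  finally have "transpose ?O ** ?X ** ?O = ?D ** ?G ** ?D + mat 1 - ?D" unfolding OO .
  also have "\<dots> = gram K (\<lambda>j. C *v b j)"
  proof -
    have DGD: "(?D ** A ** ?D) $ i $ j = (if i \<in> K \<and> j \<in> K then A $ i $ j else 0)" for A :: "real^'n^'n" and i j
    proof -
      have DA: "(?D ** A) $ i $ m = (if i \<in> K then A $ i $ m else 0)" for m
      proof -
        have "(\<Sum>l\<in>UNIV. ?D $ i $ l * A $ l $ m) = (\<Sum>l\<in>UNIV. if l = i then (if i \<in> K then A $ i $ m else 0) else 0)"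
          by (intro sum.cong) (auto simp: diag_indicator_def)
        then show ?thesis by (simp add: matrix_matrix_mult_def)
      qed
      have "(?D ** A ** ?D) $ i $ j = (\<Sum>m\<in>UNIV. (if i \<in> K then A $ i $ m else 0) * ?D $ m $ j)"
        unfolding DA[symmetric] by (simp add: matrix_matrix_mult_def[of "?D ** A"])
      also have "\<dots> = (\<Sum>m\<in>UNIV. if m = j then (if i \<in> K \<and> j \<in> K then A $ i $ j else 0) else 0)"
        by (intro sum.cong) (auto simp: diag_indicator_def)
      finally show ?thesis by simp
    qed
    have D: "?D $ i $ j = (if i = j \<and> i \<in> K then 1 else 0)" for i j
      by (simp add: diag_indicator_def)
    show ?thesis
    proof (rule vec_eq_iff[THEN iffD2], intro allI, rule vec_eq_iff[THEN iffD2], intro allI)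
      fix i j
      have "(?D ** ?G ** ?D + mat 1 - ?D) $ i $ j = (if i \<in> K \<and> j \<in> K then (C *v b i) \<bullet> (C *v b j) else 0) + (if i = j then 1 else 0) - (if i = j \<and> i \<in> K then 1 else 0)"
        unfolding vector_add_component vector_minus_component DGD column_matrix_gram D by (simp add: mat_def)
      also have "\<dots> = gram K (\<lambda>j. C *v b j) $ i $ j"
        by (auto simp: gram_def)
      finally show "(?D ** ?G ** ?D + mat 1 - ?D) $ i $ j = gram K (\<lambda>j. C *v b j) $ i $ j" .
    qed
  qed
  finally have eq: "transpose ?O ** ?X ** ?O = gram K (\<lambda>j. C *v b j)" .
  have "det ?X = det (transpose ?O ** ?X ** ?O)"
    using dO by (simp add: det_mul mult_ac)
  then show ?thesis
    unfolding section_det_def projection_matrix_span[OF bK] eq .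
qed

section \<open>Rotations acting on the Grassmannian and its sigma-algebra\<close>

lemma Grassmannian_frame:
  assumes L: "L \<in> Grassmannian k" and k: "card K = k"
  obtains b where "orthonormal_on UNIV (b :: 'n::finite \<Rightarrow> real^'n)" "span (b ` K) = L"
proof -
  have sL: "subspace L" and dL: "dim L = card K" using L k by (auto simp: Grassmannian_def)
  have dimU: "dim (UNIV :: (real^'n) set) = card (UNIV :: 'n set)" by simp
  obtain b where "orthonormal_on (UNIV :: 'n set) b" "span (b ` K) = L" "span (range b) = UNIV"
    using orthonormal_frame_exists[OF sL subspace_UNIV subset_UNIV subset_UNIV finite dL dimU] .
  then show thesis using that by blast
qed

lemma image_matrix_span:
  fixes A :: "real^'n^'n"
  shows "(\<lambda>x. A *v x) ` span (b ` K) = span ((\<lambda>j. A *v b j) ` K)"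
  by (simp add: linear_span_image[OF matrix_vector_mul_linear, symmetric] image_image)

lemma k_volume_section_frame:
  fixes b :: "'n::finite \<Rightarrow> real^'n"
  assumes e: "bij_betw e {1..k} K" and B: "det B \<noteq> 0" and b: "orthonormal_on K b" and Q: "orthogonal_matrix Q"
  shows "k_volume k ({x. norm (B *v x) \<le> 1} \<inter> (\<lambda>x. Q *v x) ` span (b ` K))
     = unit_ball_vol k / gram_vol K (\<lambda>j. (B ** Q) *v b j)"
proof -
  have "gram_vol K (\<lambda>j. Q *v b j) = 1"
    using gram_vol_orthogonal_matrix[OF Q, of K b] gram_orthonormal[OF b] by (simp add: gram_vol_def)
  then show ?thesis
    using k_volume_ellipsoid_section[OF e _ B, of "\<lambda>j. Q *v b j"]
    by (simp add: image_matrix_span matrix_vector_mul_assoc)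
qed

text \<open>The frame vectors are the columns of an orthogonal matrix. Changing the sign of one of
  them, if necessary, makes the determinant \<open>1\<close> without changing the span.\<close>

lemma rotation_to_subspace:
  assumes b: "orthonormal_on UNIV (b :: 'n::finite \<Rightarrow> real^'n)"
  obtains P where "rotation_matrix P" "(\<lambda>x. P *v x) ` span ((\<lambda>i. axis i 1) ` K) = span (b ` K)"
proof -
  let ?O = "column_matrix b"
  have O: "orthogonal_matrix ?O" by (rule orthogonal_column_matrix[OF b])
  obtain i0 :: 'n where True by blast
  define s where "s i = (if i = i0 then det ?O else 1)" for i
  have dd: "det ?O = 1 \<or> det ?O = -1" by (rule det_orthogonal_matrix[OF O])
  then have ss: "s i * s i = 1" for i by (auto simp: s_def)
  define b' where "b' i = s i *\<^sub>R b i" for i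
  have b': "orthonormal_on UNIV b'"
    unfolding orthonormal_on_def
  proof (intro ballI)
    fix i j
    have "b' i \<bullet> b' j = s i * s j * (if i = j then 1 else 0)"
      using b by (simp add: b'_def orthonormal_on_def)
    then show "b' i \<bullet> b' j = (if i = j then 1 else 0)" using ss by simp
  qed
  have "column_matrix b' = ?O ** (\<chi> i j. if i = j then s i else 0)"
  proof -
    have "(\<Sum>l\<in>UNIV. b l $ i * (if l = j then s l else 0)) = s j * b j $ i" for i j
    proof -
      have "(\<Sum>l\<in>UNIV. b l $ i * (if l = j then s l else 0)) = (\<Sum>l\<in>UNIV. if l = j then s j * b j $ i else 0)"
        by (intro sum.cong) auto
      then show ?thesis by simp
    qed
    then show ?thesis by (simp add: vec_eq_iff column_matrix_def b'_def matrix_matrix_mult_def)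
  qed
  moreover have "det ((\<chi> i j. if i = j then s i else 0) :: real^'n^'n) = det ?O"
  proof -
    have "det ((\<chi> i j. if i = j then s i else 0) :: real^'n^'n) = (\<Prod>i\<in>UNIV. s i)"
      by (subst det_diagonal) auto
    also have "\<dots> = det ?O" by (simp add: s_def prod.delta)
    finally show ?thesis .
  qed
  ultimately have "det (column_matrix b') = 1" using dd by (auto simp: det_mul)
  then have "rotation_matrix (column_matrix b')"
    using orthogonal_column_matrix[OF b'] by (simp add: rotation_matrix_def)
  moreover have "(\<lambda>x. column_matrix b' *v x) ` span ((\<lambda>i. axis i 1) ` K) = span (b ` K)"
  proof -
    have "(\<lambda>x. column_matrix b' *v x) ` span ((\<lambda>i. axis i 1) ` K) = span (b' ` K)"
      unfolding image_matrix_span column_matrix_axis ..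
    also have "\<dots> = span (b ` K)"
    proof (rule span_eq[THEN iffD2], intro conjI subsetI)
      fix x assume "x \<in> b' ` K"
      then obtain j where "j \<in> K" "x = s j *\<^sub>R b j" by (auto simp: b'_def)
      then show "x \<in> span (b ` K)" by (simp add: span_scale span_base)
    next
      fix x assume "x \<in> b ` K"
      then obtain j where j: "j \<in> K" "x = b j" by auto
      then have "x = s j *\<^sub>R b' j" using ss[of j] by (simp add: b'_def)
      then show "x \<in> span (b' ` K)" using j by (simp add: span_scale span_base)
    qed
    finally show ?thesis .
  qed
  ultimately show thesis by (rule that)
qed

lemma projection_matrix_image:
  assumes b: "orthonormal_on UNIV (b :: 'n::finite \<Rightarrow> real^'n)" and Q: "orthogonal_matrix Q"
  shows "projection_matrix ((\<lambda>x. Q *v x) ` span (b ` K)) = Q ** projection_matrix (span (b ` K)) ** transpose Q"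
proof -
  have bK: "orthonormal_on K b" using b by (rule orthonormal_on_subset) simp
  have Qb: "orthonormal_on K (\<lambda>j. Q *v b j)"
    using bK by (simp add: orthonormal_on_def rotation_matrix_inner[OF Q])
  show ?thesis
    unfolding image_matrix_span projection_matrix_span[OF bK] projection_matrix_span[OF Qb] matrix_mult_column_matrix[symmetric]
    by (simp add: matrix_transpose_mul matrix_mul_assoc)
qed

lemma grassmannian_measure_space:
  assumes "rotation_invariant_prob k (\<nu> :: (real^'n) set measure)"
  shows "space \<nu> = Grassmannian k"
proof -
  have "sets \<nu> = sets (grassmannian_borel k)" using assms by (simp add: rotation_invariant_prob_def)
  then show ?thesis using sets_eq_imp_space_eq[of \<nu> "grassmannian_borel k"] by (simp add: grassmannian_borel_def)
qed

lemma measurable_projection_matrix: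
  assumes "rotation_invariant_prob k (\<nu> :: (real^'n) set measure)"
  shows "projection_matrix \<in> borel_measurable \<nu>"
proof -
  have "sets \<nu> = sets (grassmannian_borel k)" using assms by (simp add: rotation_invariant_prob_def)
  moreover have "projection_matrix \<in> borel_measurable (grassmannian_borel k :: (real^'n) set measure)"
    unfolding grassmannian_borel_def projection_matrix_def[abs_def] by (rule measurable_vimage_algebra1) simp
  ultimately show ?thesis by (simp cong: measurable_cong_sets)
qed

lemma borel_measurable_projection_matrix_entry:
  assumes "rotation_invariant_prob k (\<nu> :: (real^'n) set measure)"
  shows "(\<lambda>L. projection_matrix L $ i $ j) \<in> borel_measurable \<nu>"
  by (rule measurable_compose[OF measurable_projection_matrix[OF assms] borel_measurable_continuous_onI]) (intro continuous_intros)

lemma Grassmannian_image: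
  assumes L: "L \<in> Grassmannian k" and Q: "orthogonal_matrix (Q :: real^'n^'n)"
  shows "(\<lambda>x. Q *v x) ` L \<in> Grassmannian k"
proof -
  have "k \<le> CARD('n)" using L dim_subset_UNIV[of L] by (auto simp: Grassmannian_def)
  then obtain K :: "'n set" where K: "card K = k" using obtain_subset_with_card_n[of k "UNIV :: 'n set"] by auto
  obtain b where b: "orthonormal_on UNIV b" "span (b ` K) = L" using Grassmannian_frame[OF L K] .
  have "orthonormal_on K (\<lambda>j. Q *v b j)"
    using orthonormal_on_subset[OF b(1), of K] by (simp add: orthonormal_on_def rotation_matrix_inner[OF Q])
  from dim_span_orthonormal[OF this] show ?thesis
    unfolding b(2)[symmetric] image_matrix_span Grassmannian_def using K by (simp del: dim_span)
qed

text \<open>Measurability is tested on the projections, and the projection of the image is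
  \<open>Q ** projection_matrix L ** transpose Q\<close>.\<close>

lemma measurable_rotation_Grassmannian:
  assumes \<nu>: "rotation_invariant_prob k (\<nu> :: (real^'n) set measure)" and Q: "orthogonal_matrix (Q :: real^'n^'n)"
  shows "(\<lambda>L. (\<lambda>x. Q *v x) ` L) \<in> measurable \<nu> \<nu>"
proof -
  have sp: "space \<nu> = Grassmannian k" by (rule grassmannian_measure_space[OF \<nu>])
  have cont: "continuous_on UNIV (\<lambda>P. Q ** P ** transpose Q)"
    unfolding matrix_matrix_mult_def by (intro continuous_intros)
  have "(\<lambda>L. projection_matrix ((\<lambda>x. Q *v x) ` L)) \<in> borel_measurable \<nu>"
  proof (subst measurable_cong)
    fix L assume L: "L \<in> space \<nu>"
    then have Lk: "L \<in> Grassmannian k" using sp by simp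
    have "k \<le> CARD('n)" using Lk dim_subset_UNIV[of L] by (auto simp: Grassmannian_def)
    then obtain K :: "'n set" where K: "card K = k" using obtain_subset_with_card_n[of k "UNIV :: 'n set"] by auto
    obtain b where b: "orthonormal_on UNIV b" "span (b ` K) = L" using Grassmannian_frame[OF Lk K] .
    show "projection_matrix ((\<lambda>x. Q *v x) ` L) = Q ** projection_matrix L ** transpose Q"
      using projection_matrix_image[OF b(1) Q, of K] b(2) by simp
  next
    show "(\<lambda>L. Q ** projection_matrix L ** transpose Q) \<in> borel_measurable \<nu>"
      by (rule measurable_compose[OF measurable_projection_matrix[OF \<nu>] borel_measurable_continuous_onI[OF cont]])
  qed
  then have "(\<lambda>L. (\<lambda>x. Q *v x) ` L) \<in> measurable \<nu> (grassmannian_borel k)"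
    unfolding grassmannian_borel_def projection_matrix_def[abs_def]
    by (intro measurable_vimage_algebra2) (auto simp: sp Grassmannian_image[OF _ Q])
  moreover have "sets \<nu> = sets (grassmannian_borel k)" using \<nu> by (simp add: rotation_invariant_prob_def)
  ultimately show ?thesis by (simp cong: measurable_cong_sets)
qed

text \<open>Both integrals average the same power of a section volume, once over the span of a
  random tuple and once over a subspace with law \<open>\<nu>\<close>. Each is an instance of
  \<open>rotation_average\<close>, with the same \<open>H\<close>: the value at the image of the
  fixed coordinate subspace \<open>L0\<close> under a rotation.\<close>

lemma nn_integral_Grassmannian:
  fixes B :: "real^'n^'n" and q :: real
  assumes e: "bij_betw e {1..k} K" and B: "det B \<noteq> 0" and \<nu>: "rotation_invariant_prob k (\<nu> :: (real^'n) set measure)"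
  defines "F \<equiv> \<lambda>L. ennreal (k_volume k ({x. norm (B *v x) \<le> 1} \<inter> L) powr q)"
  shows "F \<in> borel_measurable \<nu>"
    and "(\<integral>\<^sup>+Y. ball_tuple K Y * ennreal ((unit_ball_vol k * (gram_vol K Y / gram_vol K (\<lambda>j. B *v Y j))) powr q) \<partial>Pi\<^sub>M K (\<lambda>_. lborel))
      = ennreal (unit_ball_vol CARD('n) ^ card K) * (\<integral>\<^sup>+L. F L \<partial>\<nu>)"
proof -
  let ?E = "{x. norm (B *v x) \<le> 1}"
  let ?L = "Pi\<^sub>M K (\<lambda>_. lborel :: (real^'n) measure)" and ?U = "Pi\<^sub>M UNIV (\<lambda>_::'n. lborel :: (real^'n) measure)"
  have k: "card K = k" using bij_betw_same_card[OF e] by simp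
  have sp: "space \<nu> = Grassmannian k" by (rule grassmannian_measure_space[OF \<nu>])
  interpret \<nu>: prob_space \<nu> using \<nu> by (simp add: rotation_invariant_prob_def)
  interpret L: homogeneous_measure "lborel :: (real^'n) measure" UNIV "CARD('n)"
    by (rule homogeneous_lborel)
  interpret LK: finite_product_sigma_finite "\<lambda>_. lborel :: (real^'n) measure" K by standard simp
  define L0 where "L0 = span ((\<lambda>i. axis i 1 :: real^'n) ` K)"
  \<comment> \<open>For orthogonal \<open>Q\<close> this is \<open>F\<close> at the image of
    \<open>L\<close> under \<open>Q\<close>, written through the projection so as to be jointly
    measurable; \<open>\<Theta>2\<close> is the analogue for the span of an independent
    tuple.\<close>
  define \<Theta>1 where "\<Theta>1 Q L = ennreal ((unit_ball_vol k / sqrt (section_det (B ** Q) (projection_matrix L))) powr q)" for Q :: "real^'n^'n" and L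
  define \<Theta>2 where "\<Theta>2 Q Y = ennreal ((unit_ball_vol k * (gram_vol K Y / gram_vol K (\<lambda>j. (B ** Q) *v Y j))) powr q)" for Q :: "real^'n^'n" and Y :: "'n \<Rightarrow> real^'n"
  have frame1: "\<Theta>1 Q L = F ((\<lambda>x. Q *v x) ` L)" if L: "L \<in> Grassmannian k" and Q: "orthogonal_matrix Q" for Q L
  proof -
    obtain b where b: "orthonormal_on UNIV b" "span (b ` K) = L" using Grassmannian_frame[OF L k] .
    have bK: "orthonormal_on K b" using b(1) by (rule orthonormal_on_subset) simp
    show ?thesis
      unfolding \<Theta>1_def F_def b(2)[symmetric] section_det_projection[OF b(1)] k_volume_section_frame[OF e B bK Q] gram_vol_def ..
  qed
  have L0: "L0 \<in> Grassmannian k"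
    using dim_span_orthonormal[OF orthonormal_on_axis, of K] k by (simp add: L0_def Grassmannian_def del: dim_span)
  have move: "\<exists>P. rotation_matrix P \<and> (\<lambda>x. P *v x) ` L0 = L" if L: "L \<in> Grassmannian k" for L
  proof -
    obtain b where b: "orthonormal_on UNIV b" "span (b ` K) = L" using Grassmannian_frame[OF L k] .
    show ?thesis using rotation_to_subspace[OF b(1), of K] unfolding b(2) L0_def by blast
  qed
  have H: "F ((\<lambda>x. Q *v x) ` L) = \<Theta>1 (Q ** P) L0"
    if "rotation_matrix P" "(\<lambda>x. P *v x) ` L0 = L" "rotation_matrix Q" for P Q L
  proof -
    have "orthogonal_matrix (Q ** P)" using rotation_matrix_mult[OF that(3,1)] by (simp add: rotation_matrix_def)
    from frame1[OF L0 this] show ?thesis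
      by (simp add: that(2)[symmetric] image_image matrix_vector_mul_assoc)
  qed
  have \<Theta>1_meas: "(\<lambda>w. \<Theta>1 (Q w) (Lf w)) \<in> borel_measurable M"
    if Q: "\<And>i j. (\<lambda>w. Q w $ i $ j) \<in> borel_measurable M" and P: "\<And>i j. (\<lambda>w. projection_matrix (Lf w) $ i $ j) \<in> borel_measurable M"
    for Q :: "'b \<Rightarrow> real^'n^'n" and Lf :: "'b \<Rightarrow> (real^'n) set" and M :: "'b measure"
  proof -
    have BQ: "(\<lambda>w. (B ** Q w) $ i $ j) \<in> borel_measurable M" for i j
      by (rule borel_measurable_matrix_mult[OF _ Q]) simp
    have "(\<lambda>w. (projection_matrix (Lf w) ** transpose (B ** Q w) ** (B ** Q w) ** projection_matrix (Lf w)) $ i $ j) \<in> borel_measurable M" for i j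
      by (intro borel_measurable_matrix_mult borel_measurable_transpose BQ P)
    then have "(\<lambda>w. (projection_matrix (Lf w) ** transpose (B ** Q w) ** (B ** Q w) ** projection_matrix (Lf w) + mat 1 - projection_matrix (Lf w)) $ i $ j) \<in> borel_measurable M" for i j
      unfolding vector_add_component vector_minus_component
      by (intro borel_measurable_diff borel_measurable_add P) auto
    then have [measurable]: "(\<lambda>w. section_det (B ** Q w) (projection_matrix (Lf w))) \<in> borel_measurable M"
      unfolding section_det_def by (rule borel_measurable_det)
    show ?thesis unfolding \<Theta>1_def by measurable
  qed
  have one: "orthogonal_matrix (mat 1 :: real^'n^'n)" by (simp add: orthogonal_matrix_id)
  have "(\<lambda>L. \<Theta>1 (mat 1) L) \<in> borel_measurable \<nu>"
    by (intro \<Theta>1_meas borel_measurable_projection_matrix_entry[OF \<nu>]) simp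
  moreover have "\<Theta>1 (mat 1) L = F L" if "L \<in> space \<nu>" for L
    using frame1[OF _ one, of L] that sp by simp
  ultimately show F: "F \<in> borel_measurable \<nu>"
    by (subst measurable_cong[of \<nu> F "\<Theta>1 (mat 1)"]) auto
  let ?V = "ennreal (unit_ball_vol CARD('n) ^ CARD('n))"
  let ?J = "\<integral>\<^sup>+X. ball_tuple UNIV X * \<Theta>1 (rotation_of X) L0 \<partial>?U"
  have rot[measurable]: "(\<lambda>w. rotation_of (fst w) $ i $ j) \<in> borel_measurable (?U \<Otimes>\<^sub>M M)" for i j and M :: "'c measure"
    by (rule borel_measurable_rotation_of) measurable
  have mH: "(\<lambda>X. \<Theta>1 (rotation_of X) L0) \<in> borel_measurable ?U"
    by (rule \<Theta>1_meas, rule borel_measurable_rotation_of) measurable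
  have V1: "?V * (\<integral>\<^sup>+L. F L \<partial>\<nu>) = ?J * emeasure \<nu> (space \<nu>)"
  proof (rule rotation_average)
    show "sigma_finite_measure \<nu>" by unfold_locales
    have "(\<lambda>w. \<Theta>1 (rotation_of (fst w)) (snd w)) \<in> borel_measurable (?U \<Otimes>\<^sub>M \<nu>)"
      by (rule \<Theta>1_meas[OF rot]) (rule measurable_compose[OF measurable_snd borel_measurable_projection_matrix_entry[OF \<nu>]])
    then show "(\<lambda>(X, L). \<Theta>1 (rotation_of X) L) \<in> borel_measurable (?U \<Otimes>\<^sub>M \<nu>)" by (simp add: case_prod_beta)
    show "(\<lambda>X. \<Theta>1 (rotation_of X) L0) \<in> borel_measurable ?U" by (rule mH)
  next
    fix Q :: "real^'n^'n" assume Q: "rotation_matrix Q"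
    then have Qo: "orthogonal_matrix Q" by (simp add: rotation_matrix_def)
    have "(\<integral>\<^sup>+L. \<Theta>1 Q L \<partial>\<nu>) = (\<integral>\<^sup>+L. F ((\<lambda>x. Q *v x) ` L) \<partial>\<nu>)"
      by (intro nn_integral_cong frame1 Qo) (simp add: sp)
    also have "\<dots> = (\<integral>\<^sup>+L. F L \<partial>distr \<nu> \<nu> (\<lambda>L. (\<lambda>x. Q *v x) ` L))"
      by (rule nn_integral_distr[OF measurable_rotation_Grassmannian[OF \<nu> Qo], symmetric]) (simp add: F)
    also have "distr \<nu> \<nu> (\<lambda>L. (\<lambda>x. Q *v x) ` L) = \<nu>"
      using \<nu> Q by (simp add: rotation_invariant_prob_def)
    finally show "(\<integral>\<^sup>+L. \<Theta>1 Q L \<partial>\<nu>) = (\<integral>\<^sup>+L. F L \<partial>\<nu>)" .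
  next
    show "AE L in \<nu>. \<exists>P. rotation_matrix P \<and> (\<forall>Q. rotation_matrix Q \<longrightarrow> \<Theta>1 Q L = \<Theta>1 (Q ** P) L0)"
    proof (rule AE_I2)
      fix L assume "L \<in> space \<nu>"
      then have L: "L \<in> Grassmannian k" using sp by simp
      obtain P where P: "rotation_matrix P" "(\<lambda>x. P *v x) ` L0 = L" using move[OF L] by blast
      have "\<Theta>1 Q L = \<Theta>1 (Q ** P) L0" if Q: "rotation_matrix Q" for Q
        using H[OF P Q] frame1[OF L, of Q] Q by (simp add: rotation_matrix_def)
      then show "\<exists>P. rotation_matrix P \<and> (\<forall>Q. rotation_matrix Q \<longrightarrow> \<Theta>1 Q L = \<Theta>1 (Q ** P) L0)" using P(1) by blast
    qed
  qed
  \<comment> \<open>Lebesgue measure on tuples in the ball, not normalised; its mass is the constant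
    in the conclusion.\<close>
  define M2 where "M2 = density ?L (ball_tuple K)"
  have ball[measurable]: "ball_tuple K \<in> borel_measurable ?L" by (intro borel_measurable_ball_tuple) measurable
  have setsM2[measurable_cong]: "sets M2 = sets ?L" by (simp add: M2_def)
  have spM2: "emeasure M2 (space M2) = ennreal (unit_ball_vol CARD('n) ^ card K)"
  proof -
    have "emeasure M2 (space M2) = (\<integral>\<^sup>+Y. ball_tuple K Y * indicator (space ?L) Y \<partial>?L)"
      unfolding M2_def by (simp add: emeasure_density[OF ball])
    also have "\<dots> = (\<integral>\<^sup>+Y. ball_tuple K Y \<partial>?L)" by (intro nn_integral_cong) simp
    finally show ?thesis by (simp add: nn_integral_ball_tuple)
  qed
  have \<Theta>2_meas: "(\<lambda>w. \<Theta>2 (Q w) (Y w)) \<in> borel_measurable M"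
    if Q: "\<And>i j. (\<lambda>w. Q w $ i $ j) \<in> borel_measurable M" and Y: "\<And>j. j \<in> K \<Longrightarrow> (\<lambda>w. Y w j) \<in> borel_measurable M"
    for Q :: "'b \<Rightarrow> real^'n^'n" and Y :: "'b \<Rightarrow> 'n \<Rightarrow> real^'n" and M :: "'b measure"
  proof -
    have BQ: "(\<lambda>w. (B ** Q w) $ i $ j) \<in> borel_measurable M" for i j
      by (rule borel_measurable_matrix_mult[OF _ Q]) simp
    have "(\<lambda>w. (B ** Q w) *v Y w j) \<in> borel_measurable M" if "j \<in> K" for j
    proof -
      have "(\<lambda>w. Y w j $ l) \<in> borel_measurable M" for l
        by (rule measurable_compose[OF Y[OF that] borel_measurable_continuous_onI]) (intro continuous_intros)
      then have "(\<lambda>w. ((B ** Q w) *v Y w j) $ i) \<in> borel_measurable M" for i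
        unfolding matrix_vector_mult_def vec_lambda_beta using BQ by (intro borel_measurable_sum borel_measurable_times)
      then show ?thesis
        by (subst borel_measurable_euclidean_space) (auto simp: Basis_vec_def inner_axis)
    qed
    then have [measurable]: "(\<lambda>w. gram_vol K (\<lambda>j. (B ** Q w) *v Y w j)) \<in> borel_measurable M"
      by (intro borel_measurable_gram_vol)
    have [measurable]: "(\<lambda>w. gram_vol K (Y w)) \<in> borel_measurable M"
      by (intro borel_measurable_gram_vol Y)
    show ?thesis unfolding \<Theta>2_def by measurable
  qed
  have V2: "?V * (\<integral>\<^sup>+Y. ball_tuple K Y * \<Theta>2 (mat 1) Y \<partial>?L) = ?J * emeasure M2 (space M2)"
  proof (rule rotation_average)
    have "emeasure M2 (space M2) \<noteq> \<infinity>" unfolding spM2 by simp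
    then have "finite_measure M2" by (rule finite_measureI)
    then show "sigma_finite_measure M2" by (rule finite_measure.axioms(1))
    have "(\<lambda>w. \<Theta>2 (rotation_of (fst w)) (snd w)) \<in> borel_measurable (?U \<Otimes>\<^sub>M M2)"
      by (rule \<Theta>2_meas[OF rot]) measurable
    then show "(\<lambda>(X, Y). \<Theta>2 (rotation_of X) Y) \<in> borel_measurable (?U \<Otimes>\<^sub>M M2)" by (simp add: case_prod_beta)
    show "(\<lambda>X. \<Theta>1 (rotation_of X) L0) \<in> borel_measurable ?U" by (rule mH)
  next
    fix Q :: "real^'n^'n" assume Q: "rotation_matrix Q"
    then have Qo: "orthogonal_matrix Q" by (simp add: rotation_matrix_def)
    have m2: "(\<lambda>Y. \<Theta>2 Q Y) \<in> borel_measurable ?L" for Q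
      by (rule \<Theta>2_meas) measurable
    have m3: "(\<lambda>Y. ball_tuple K Y * \<Theta>2 (mat 1) Y) \<in> borel_measurable ?L"
      by (intro borel_measurable_times_ennreal ball m2)
    have "(\<integral>\<^sup>+Y. \<Theta>2 Q Y \<partial>M2) = (\<integral>\<^sup>+Y. ball_tuple K Y * \<Theta>2 Q Y \<partial>?L)"
      unfolding M2_def by (rule nn_integral_density[OF ball m2])
    \<comment> \<open>\<open>Q\<close> moves from the matrix into the tuple, which changes neither
      the ball condition nor the Gram volume in the numerator; the invariance of Lebesgue measure
      then removes it.\<close>
    also have "\<dots> = (\<integral>\<^sup>+Y. ball_tuple K (\<lambda>j\<in>K. Q *v Y j) * \<Theta>2 (mat 1) (\<lambda>j\<in>K. Q *v Y j) \<partial>?L)"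
    proof (rule nn_integral_cong)
      fix Y :: "'n \<Rightarrow> real^'n"
      have b: "ball_tuple K (\<lambda>j\<in>K. Q *v Y j) = ball_tuple K Y"
        unfolding ball_tuple_def
        by (intro prod.cong refl) (simp only: restrict_apply' indicator_def mem_cball_0 rotation_matrix_norm[OF Qo])
      have g1: "gram_vol K (\<lambda>j\<in>K. Q *v Y j) = gram_vol K Y"
        unfolding gram_vol_orthogonal_matrix[OF Qo, of K Y, symmetric] by (rule gram_vol_cong) simp
      have g2: "gram_vol K (\<lambda>j. (B ** mat 1) *v (\<lambda>j\<in>K. Q *v Y j) j) = gram_vol K (\<lambda>j. (B ** Q) *v Y j)"
        by (rule gram_vol_cong) (simp add: matrix_vector_mul_assoc)
      show "ball_tuple K Y * \<Theta>2 Q Y = ball_tuple K (\<lambda>j\<in>K. Q *v Y j) * \<Theta>2 (mat 1) (\<lambda>j\<in>K. Q *v Y j)"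
        unfolding b \<Theta>2_def g1 g2 ..
    qed
    also have "\<dots> = (\<integral>\<^sup>+Y. ball_tuple K Y * \<Theta>2 (mat 1) Y \<partial>?L)"
      by (rule nn_integral_PiM_orthogonal[OF Qo m3])
    finally show "(\<integral>\<^sup>+Y. \<Theta>2 Q Y \<partial>M2) = (\<integral>\<^sup>+Y. ball_tuple K Y * \<Theta>2 (mat 1) Y \<partial>?L)" .
  next
    have "AE Y in M2. gram_vol K Y \<noteq> 0"
      unfolding M2_def AE_density[OF ball] using AE_ball_tuple_gram_vol_nonzero[of K]
      by eventually_elim (auto simp: zero_less_iff_neq_zero)
    then show "AE Y in M2. \<exists>P. rotation_matrix P \<and> (\<forall>Q. rotation_matrix Q \<longrightarrow> \<Theta>2 Q Y = \<Theta>1 (Q ** P) L0)"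
    proof (rule eventually_mono)
      fix Y :: "'n \<Rightarrow> real^'n" assume Y: "gram_vol K Y \<noteq> 0"
      have L: "span (Y ` K) \<in> Grassmannian k"
        using Y gram_vol_eq_0_iff[of K Y] dim_image_le_card[of K Y] k by (auto simp: Grassmannian_def)
      obtain P where P: "rotation_matrix P" "(\<lambda>x. P *v x) ` L0 = span (Y ` K)" using move[OF L] by blast
      have "\<Theta>2 Q Y = \<Theta>1 (Q ** P) L0" if Q: "rotation_matrix Q" for Q
      proof -
        have Qo: "orthogonal_matrix Q" using Q by (simp add: rotation_matrix_def)
        have gQ: "gram_vol K (\<lambda>j. Q *v Y j) = gram_vol K Y" by (rule gram_vol_orthogonal_matrix[OF Qo])
        have "\<Theta>2 Q Y = F ((\<lambda>x. Q *v x) ` span (Y ` K))"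
          using k_volume_ellipsoid_section[OF e _ B, of "\<lambda>j. Q *v Y j"] Y gQ
          by (simp add: \<Theta>2_def F_def image_matrix_span matrix_vector_mul_assoc)
        then show ?thesis using H[OF P Q] by simp
      qed
      then show "\<exists>P. rotation_matrix P \<and> (\<forall>Q. rotation_matrix Q \<longrightarrow> \<Theta>2 Q Y = \<Theta>1 (Q ** P) L0)" using P(1) by blast
    qed
  qed
  have "unit_ball_vol (real CARD('n)) ^ CARD('n) > 0" by simp
  then have Vpos: "?V \<noteq> 0" "?V \<noteq> top" by (simp_all only: ennreal_eq_0_iff not_le ennreal_neq_top not_False_eq_True)
  \<comment> \<open>The same \<open>?J\<close> came out of both applications and is eliminated
    here.\<close>
  have J: "?J = ?V * (\<integral>\<^sup>+L. F L \<partial>\<nu>)" using V1 unfolding \<nu>.emeasure_space_1 by simp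
  have "?V * (\<integral>\<^sup>+Y. ball_tuple K Y * \<Theta>2 (mat 1) Y \<partial>?L) = (?V * (\<integral>\<^sup>+L. F L \<partial>\<nu>)) * ennreal (unit_ball_vol CARD('n) ^ card K)"
    using V2 unfolding spM2 J .
  also have "\<dots> = ?V * (ennreal (unit_ball_vol CARD('n) ^ card K) * (\<integral>\<^sup>+L. F L \<partial>\<nu>))"
    by (simp only: mult_ac)
  finally have "(\<integral>\<^sup>+Y. ball_tuple K Y * \<Theta>2 (mat 1) Y \<partial>?L) = ennreal (unit_ball_vol CARD('n) ^ card K) * (\<integral>\<^sup>+L. F L \<partial>\<nu>)"
    using Vpos ennreal_mult_cancel_left[of ?V] by blast
  then show "(\<integral>\<^sup>+Y. ball_tuple K Y * ennreal ((unit_ball_vol k * (gram_vol K Y / gram_vol K (\<lambda>j. B *v Y j))) powr q) \<partial>?L)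
      = ennreal (unit_ball_vol CARD('n) ^ card K) * (\<integral>\<^sup>+L. F L \<partial>\<nu>)"
    by (simp add: \<Theta>2_def)
qed

section \<open>Finiteness, the closed form of the constant, and the final formula\<close>

lemma matrix_ellipsoid_bounded:
  fixes B :: "real^'n^'n"
  assumes "det B \<noteq> 0"
  obtains r where "r > 0" "{x. norm (B *v x) \<le> 1} \<subseteq> cball 0 r"
proof -
  obtain r where r: "r > 0" "\<And>x. norm (cramer_inv B *v x) \<le> r * norm x"
    using linear_bounded_pos[OF matrix_vector_mul_linear[of "cramer_inv B"]] by blast
  have "norm x \<le> r" if "norm (B *v x) \<le> 1" for x
  proof -
    have "norm x = norm (cramer_inv B *v (B *v x))"
      by (simp add: matrix_vector_mul_assoc cramer_inv_left[OF assms])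
    also have "\<dots> \<le> r * norm (B *v x)" by (rule r(2))
    also have "\<dots> \<le> r * 1" using that r(1) by (intro mult_left_mono) auto
    finally show ?thesis by simp
  qed
  then show thesis using r(1) by (intro that[of r]) auto
qed

text \<open>The denominators of the two constants are the same product of
  \<open>omega (real i)\<close> and cancel; reversing the product by \<open>i = k - j\<close>
  matches the remaining factors.\<close>

lemma moment_const_eq_b_const:
  fixes d p :: real
  assumes "real k \<le> d" "d - real k + p > 0"
  shows "moment_const d p k = unit_ball_vol (d + p) ^ k * (b_const d k / b_const (d + p) k)"
proof -
  have om: "omega (real i) > 0" if "i \<in> {1..k}" for i using that by (simp add: omega_def)
  then have Z: "(\<Prod>i=1..k. omega (real i)) \<noteq> 0" by (subst prod_zero_iff) force+
  have "b_const d k / b_const (d + p) k = (\<Prod>i=1..k. omega (d - real k + real i) / omega (d + p - real k + real i))"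
    using Z by (simp add: b_const_def prod_dividef)
  also have "\<dots> = (\<Prod>j<k. omega (d - real j) / omega (d - real j + p))"
    by (rule prod.reindex_bij_witness[of _ "\<lambda>j. k - j" "\<lambda>i. k - i"]) (auto simp: of_nat_diff algebra_simps)
  finally show ?thesis by (simp only: moment_const_def prod.distrib prod_constant card_lessThan)
qed

theorem theorem1p14:
  fixes E :: "(real ^ 'n) set" and k :: nat and p :: real
    and \<nu> :: "(real ^ 'n) set measure"
  assumes "nondegenerate_ellipsoid E"
    and "k \<le> CARD('n)"
    and "p > - real CARD('n) + real k"
    and "rotation_invariant_prob k \<nu>"
  shows "set_integrable (Pi\<^sub>M {1..k} (\<lambda>_. lborel)) (Pi\<^sub>E {1..k} (\<lambda>_. E))
           (\<lambda>x. k_volume k (convex hull (insert 0 (x ` {1..k}))) powr p)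
       \<and> integrable \<nu> (\<lambda>L. k_volume k (E \<inter> L) powr (p + real CARD('n)))
       \<and> (LINT x : Pi\<^sub>E {1..k} (\<lambda>_. E) | Pi\<^sub>M {1..k} (\<lambda>_. lborel).
            k_volume k (convex hull (insert 0 (x ` {1..k}))) powr p) =
          1 / fact k powr p
          * (unit_ball_vol (real CARD('n) + p) ^ k
             / unit_ball_vol (real k) powr (p + real CARD('n)))
          * (b_const (real CARD('n)) k / b_const (real CARD('n) + p) k)
          * (LINT L | \<nu>. k_volume k (E \<inter> L) powr (p + real CARD('n)))"
proof -
  obtain A :: "real^'n^'n" where A: "invertible A" "E = (\<lambda>x. A *v x) ` cball 0 1"
    using assms(1) by (auto simp: nondegenerate_ellipsoid_def)
  define B where "B = cramer_inv A"
  have detA: "det A \<noteq> 0" using A(1) by (simp add: invertible_det_nz)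
  have AB: "A ** B = mat 1" "B ** A = mat 1"
    using cramer_inv_right[OF detA] cramer_inv_left[OF detA] by (auto simp: B_def)
  have B: "det B \<noteq> 0" using AB(1) by (metis det_I det_mul mult_zero_right zero_neq_one)
  have E: "E = {x. norm (B *v x) \<le> 1}"
  proof (intro equalityI subsetI)
    fix x assume "x \<in> E"
    then obtain y where "x = A *v y" "norm y \<le> 1" unfolding A(2) by auto
    then show "x \<in> {x. norm (B *v x) \<le> 1}" by (simp add: matrix_vector_mul_assoc AB)
  next
    fix x assume x: "x \<in> {x. norm (B *v x) \<le> 1}"
    have "x = A *v (B *v x)" by (simp add: matrix_vector_mul_assoc AB)
    then show "x \<in> E" unfolding A(2) using x by (intro image_eqI[of _ _ "B *v x"]) auto
  qed
  \<comment> \<open>Any \<open>k\<close> coordinate indices will do; the tuples are transported to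
    this index set, where the matrix arguments live.\<close>
  obtain K :: "'n set" where K: "card K = k"
    using obtain_subset_with_card_n[of k "UNIV :: 'n set"] assms(2) by auto
  have "\<exists>e. bij_betw e {1..k} K" by (rule finite_same_card_bij) (auto simp: K)
  then obtain e where e: "bij_betw e {1..k} K" ..
  define inv where "inv = the_inv_into {1..k} e"
  have Ke: "K = e ` {1..k}" and inj: "inj_on e {1..k}" using e by (auto simp: bij_betw_def)
  have inv: "bij_betw inv K {1..k}" unfolding inv_def by (rule bij_betw_the_inv_into[OF e])
  define Y where "Y x = (\<lambda>j\<in>K. x (inv j))" for x :: "nat \<Rightarrow> real^'n"
  have YK: "Y x ` K = x ` {1..k}" for x
  proof -
    have "Y x ` K = x ` (inv ` K)" unfolding image_image Y_def by (intro image_cong) auto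
    then show ?thesis using inv by (simp add: bij_betw_def)
  qed
  let ?M = "Pi\<^sub>M {1..k} (\<lambda>_. lborel :: (real^'n) measure)" and ?L = "Pi\<^sub>M K (\<lambda>_. lborel :: (real^'n) measure)"
  let ?d = "real CARD('n)"
  define q where "q = p + ?d"
  have q: "q > real k" using assms(3) by (simp add: q_def)
  define \<kappa> where "\<kappa> = unit_ball_vol (real k)"
  define v where "v = unit_ball_vol ?d ^ card K"
  define m where "m = moment_const ?d p k"
  have pos: "\<kappa> > 0" "v > 0" "m > 0"
    using assms(2,3) by (auto simp: \<kappa>_def v_def m_def intro!: moment_const_pos)
  let ?F = "\<lambda>L. k_volume k (E \<inter> L) powr q"
  define I where "I = (\<integral>\<^sup>+L. ennreal (?F L) \<partial>\<nu>)"
  define U where "U = (\<integral>\<^sup>+Y. ellipsoid_power K B p Y \<partial>?L)"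
  let ?R = "\<integral>\<^sup>+Y. ball_tuple K Y * ennreal ((gram_vol K Y / gram_vol K (\<lambda>j. B *v Y j)) powr q) \<partial>?L"
  interpret \<nu>: prob_space \<nu> using assms(4) by (simp add: rotation_invariant_prob_def)
  have Fm: "(\<lambda>L. ennreal (?F L)) \<in> borel_measurable \<nu>"
    unfolding E by (rule nn_integral_Grassmannian(1)[OF e B assms(4)])
  \<comment> \<open>Passing from quotients to section volumes costs the \<open>q\<close>-th power of
    \<open>\<kappa>\<close>; this is the origin of the power of
    \<open>unit_ball_vol (real k)\<close> in the denominator.\<close>
  have RI: "ennreal (\<kappa> powr q) * ?R = ennreal v * I"
  proof -
    have "ennreal (\<kappa> powr q) * ?R = (\<integral>\<^sup>+Y. ennreal (\<kappa> powr q) * (ball_tuple K Y * ennreal ((gram_vol K Y / gram_vol K (\<lambda>j. B *v Y j)) powr q)) \<partial>?L)"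
    proof (rule nn_integral_cmult[symmetric])
      have [measurable]: "(\<lambda>T. gram_vol K T) \<in> borel_measurable ?L" "(\<lambda>T. ball_tuple K T) \<in> borel_measurable ?L"
         "(\<lambda>Y. gram_vol K (\<lambda>j. B *v Y j)) \<in> borel_measurable ?L"
        by (intro borel_measurable_gram_vol borel_measurable_ball_tuple; measurable)+
      show "(\<lambda>Y. ball_tuple K Y * ennreal ((gram_vol K Y / gram_vol K (\<lambda>j. B *v Y j)) powr q)) \<in> borel_measurable ?L"
        by measurable
    qed
    also have "\<dots> = (\<integral>\<^sup>+Y. ball_tuple K Y * ennreal ((\<kappa> * (gram_vol K Y / gram_vol K (\<lambda>j. B *v Y j))) powr q) \<partial>?L)"
    proof (rule nn_integral_cong)
      fix Y :: "'n \<Rightarrow> real^'n"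
      let ?x = "gram_vol K Y / gram_vol K (\<lambda>j. B *v Y j)"
      have "ennreal ((\<kappa> * ?x) powr q) = ennreal (\<kappa> powr q) * ennreal (?x powr q)"
        using pos by (subst powr_mult) (simp_all add: ennreal_mult)
      then show "ennreal (\<kappa> powr q) * (ball_tuple K Y * ennreal (?x powr q)) = ball_tuple K Y * ennreal ((\<kappa> * ?x) powr q)"
        by (simp only: mult_ac)
    qed
    also have "\<dots> = ennreal v * I"
      unfolding \<kappa>_def v_def I_def E by (rule nn_integral_Grassmannian(2)[OF e B assms(4)])
    finally show ?thesis .
  qed
  have UR: "U * ennreal v = ennreal m * ?R"
    using nn_integral_ellipsoid_power[OF B, of K p] assms(3) K
    unfolding U_def v_def m_def q_def by simp
  \<comment> \<open>The mass \<open>v\<close> of the tuples in the ball occurs in both relations and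
    cancels.\<close>
  have UI: "U = ennreal (m / \<kappa> powr q) * I"
  proof -
    have kp: "\<kappa> powr q > 0" using pos by simp
    have "ennreal (v * \<kappa> powr q) * U = ennreal (\<kappa> powr q) * (U * ennreal v)"
      using pos kp by (simp add: ennreal_mult mult_ac)
    also have "\<dots> = ennreal m * (ennreal (\<kappa> powr q) * ?R)"
      unfolding UR by (simp only: mult_ac)
    also have "\<dots> = ennreal (m * v) * I"
      unfolding RI using pos by (simp add: ennreal_mult mult_ac)
    also have "m * v = v * \<kappa> powr q * (m / \<kappa> powr q)" using kp by simp
    also have "ennreal (v * \<kappa> powr q * (m / \<kappa> powr q)) = ennreal (v * \<kappa> powr q) * ennreal (m / \<kappa> powr q)"
      using pos kp by (intro ennreal_mult) auto
    finally have "ennreal (v * \<kappa> powr q) * U = ennreal (v * \<kappa> powr q) * (ennreal (m / \<kappa> powr q) * I)"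
      by (simp only: mult_ac)
    moreover have "ennreal (v * \<kappa> powr q) \<noteq> 0" "ennreal (v * \<kappa> powr q) \<noteq> top"
      using pos kp by (auto simp: ennreal_eq_0_iff not_le)
    ultimately show ?thesis using ennreal_mult_cancel_left[of "ennreal (v * \<kappa> powr q)"] by blast
  qed
  \<comment> \<open>Up to here the identity is one in \<open>ennreal\<close>. Finiteness of
    \<open>I\<close> follows since \<open>E\<close> lies in a ball, which bounds the volumes of all
    its sections.\<close>
  obtain r where r: "r > 0" "E \<subseteq> cball 0 r" unfolding E by (rule matrix_ellipsoid_bounded[OF B])
  have Fbound: "?F L \<le> (\<kappa> * r ^ k) powr q" if L: "L \<in> Grassmannian k" for L
  proof -
    obtain b where b: "orthonormal_on UNIV b" "span (b ` K) = L" using Grassmannian_frame[OF L K] .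
    have bK: "orthonormal_on K b" using b(1) by (rule orthonormal_on_subset) simp
    have vol: "k_volume k (E \<inter> L) = \<kappa> / gram_vol K (\<lambda>j. B *v b j)"
      using k_volume_section_frame[OF e B bK, of "mat 1"] b(2)
      by (simp add: E \<kappa>_def orthogonal_matrix_id)
    have "ennreal (\<kappa> / gram_vol K (\<lambda>j. B *v b j)) = emeasure (frame_measure K b) E"
      unfolding E \<kappa>_def using frame_measure_matrix_ball[OF bK B] K by simp
    also have "\<dots> \<le> emeasure (frame_measure K b) (cball 0 r)"
      using r(2) by (intro emeasure_mono) auto
    also have "\<dots> = ennreal (\<kappa> * r ^ k)"
      using emeasure_frame_measure_cball[OF bK r(1)] K by (simp add: \<kappa>_def)
    finally have "\<kappa> / gram_vol K (\<lambda>j. B *v b j) \<le> \<kappa> * r ^ k"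
      using pos r(1) by (simp add: ennreal_le_iff)
    then show ?thesis unfolding vol using pos q by (intro powr_mono2) auto
  qed
  have "I \<le> (\<integral>\<^sup>+L. ennreal ((\<kappa> * r ^ k) powr q) \<partial>\<nu>)"
    unfolding I_def using Fbound grassmannian_measure_space[OF assms(4)]
    by (intro nn_integral_mono ennreal_leI) auto
  also have "\<dots> < top" by (simp add: \<nu>.emeasure_space_1)
  finally have I: "I < top" .
  have Fm': "?F \<in> borel_measurable \<nu>"
    using borel_measurable_enn2real[OF Fm] by simp
  have Fint: "integrable \<nu> ?F"
    using I Fm' unfolding I_def by (intro integrableI_nonneg) auto
  have Fval: "(LINT L|\<nu>. ?F L) = enn2real I"
    unfolding I_def using Fm' by (intro integral_eq_nn_integral) auto
  let ?g = "\<lambda>x. indicator (Pi\<^sub>E {1..k} (\<lambda>_. E)) x *\<^sub>R k_volume k (convex hull (insert 0 (x ` {1..k}))) powr p"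
  \<comment> \<open>Besides the value this provides measurability: \<open>k_volume\<close> is
    defined by choice, whereas the right-hand side is an explicit expression in the entries.\<close>
  have g_eq: "ennreal (?g x) = ennreal (1 / fact k powr p) * ellipsoid_power K B p (Y x)"
    if x: "x \<in> space ?M" for x
  proof -
    have vol: "k_volume k (convex hull (insert 0 (x ` {1..k}))) = gram_vol K (Y x) / fact k"
      using k_volume_simplex[OF e, of "Y x"] unfolding YK .
    have "x \<in> Pi\<^sub>E {1..k} (\<lambda>_. E) \<longleftrightarrow> (\<forall>j\<in>K. Y x j \<in> E)"
    proof -
      have "x \<in> Pi\<^sub>E {1..k} (\<lambda>_. E) \<longleftrightarrow> x ` {1..k} \<subseteq> E" using x by (auto simp: space_PiM PiE_def Pi_def)
      then show ?thesis unfolding YK[symmetric] by auto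
    qed
    then have ind: "(indicator (Pi\<^sub>E {1..k} (\<lambda>_. E)) x :: ennreal) = (\<Prod>j\<in>K. indicator E (Y x j))"
      by (cases "x \<in> Pi\<^sub>E {1..k} (\<lambda>_. E)") (auto simp: indicator_def intro!: prod_zero)
    have "ennreal (?g x) = indicator (Pi\<^sub>E {1..k} (\<lambda>_. E)) x * ennreal ((gram_vol K (Y x) / fact k) powr p)"
      unfolding vol by (simp add: indicator_def)
    also have "(gram_vol K (Y x) / fact k) powr p = 1 / fact k powr p * gram_vol K (Y x) powr p"
      by (simp add: powr_divide)
    finally show ?thesis
      unfolding ind ellipsoid_power_def E[symmetric] by (simp only: ennreal_mult'[OF divide_nonneg_nonneg[OF zero_le_one powr_ge_zero]] mult_ac)
  qed
  have Ym: "(\<lambda>x. Y x j) \<in> borel_measurable ?M" if "j \<in> K" for j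
  proof -
    have "inv j \<in> {1..k}" using inv that by (auto simp: bij_betw_def)
    then show ?thesis using that by (simp add: Y_def)
  qed
  have gm: "(\<lambda>x. ennreal (1 / fact k powr p) * ellipsoid_power K B p (Y x)) \<in> borel_measurable ?M"
    by (intro borel_measurable_times_ennreal borel_measurable_ellipsoid_power Ym) simp
  have "(\<lambda>x. ennreal (?g x)) \<in> borel_measurable ?M"
    using gm by (subst measurable_cong[OF g_eq])
  from borel_measurable_enn2real[OF this] have gm': "?g \<in> borel_measurable ?M"
    by (simp add: indicator_def)
  have gU: "(\<integral>\<^sup>+x. ennreal (?g x) \<partial>?M) = ennreal (1 / fact k powr p) * U"
  proof -
    have em: "ellipsoid_power K B p \<in> borel_measurable ?L"
      by (intro borel_measurable_ellipsoid_power) measurable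
    have "(\<integral>\<^sup>+x. ennreal (?g x) \<partial>?M) = (\<integral>\<^sup>+x. ennreal (1 / fact k powr p) * ellipsoid_power K B p (Y x) \<partial>?M)"
      by (rule nn_integral_cong) (rule g_eq)
    also have "\<dots> = ennreal (1 / fact k powr p) * (\<integral>\<^sup>+x. ellipsoid_power K B p (Y x) \<partial>?M)"
      by (intro nn_integral_cmult borel_measurable_ellipsoid_power Ym)
    also have "(\<integral>\<^sup>+x. ellipsoid_power K B p (Y x) \<partial>?M) = U"
      unfolding U_def Y_def inv_def
      by (rule nn_integral_PiM_reindex[OF _ e _ em, symmetric]) (auto intro: lborel.sigma_finite_measure_axioms)
    finally show ?thesis .
  qed
  have gfin: "(\<integral>\<^sup>+x. ennreal (?g x) \<partial>?M) < top"
    unfolding gU UI using I by (simp add: ennreal_mult_less_top)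
  have gint: "integrable ?M ?g"
    using gfin gm' by (intro integrableI_nonneg) auto
  have gval: "(LINT x|?M. ?g x) = enn2real (\<integral>\<^sup>+x. ennreal (?g x) \<partial>?M)"
    using gm' by (intro integral_eq_nn_integral) auto
  have "(LINT x|?M. ?g x) = 1 / fact k powr p * (m / \<kappa> powr q) * (LINT L|\<nu>. ?F L)"
    unfolding gval gU UI Fval using pos by (simp add: enn2real_mult)
  also have "m / \<kappa> powr q = unit_ball_vol (?d + p) ^ k / \<kappa> powr q * (b_const ?d k / b_const (?d + p) k)"
    unfolding m_def using moment_const_eq_b_const[of k ?d p] assms(2,3) by simp
  finally have "(LINT x|?M. ?g x) = 1 / fact k powr p * (unit_ball_vol (?d + p) ^ k / \<kappa> powr q)
      * (b_const ?d k / b_const (?d + p) k) * (LINT L|\<nu>. ?F L)"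
    by (simp only: mult.assoc)
  then show ?thesis
    using gint Fint unfolding set_integrable_def set_lebesgue_integral_def q_def \<kappa>_def by blast
qed

end
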